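(* Let $\mathbb G$ be a stratified group equipped with a homogeneous distance $d$. Let $\Sigma\subset\mathbb G$ be a $p$-dimensional Lipschitz submanifold, let $\Sigma_\ast$ be its singular set and denote by $\Sigma_c$ the subset of points in $\Sigma\setminus\Sigma_\ast$ whose degree is less than $D(p)$. Then $$\mathcal H^{D(p)}(\Sigma_\ast\cup\Sigma_c)=0,$$ where $\mathcal H^{D(p)}$ is the Hausdorff measure with respect to $d$.
   Context: Stratified group: a connected, simply connected nilpotent Lie group $\mathbb G$ with Lie algebra $\mathcal G=V_1\oplus\dots\oplus V_\iota$, $V_{i+1}=[V_1,V_i]$ for $i\ge1$, $V_{\iota+1}=\{0\}$. Put $n_j=\dim V_j$, $m_0=0$, $m_j=n_1+\dots+n_j$, $n=m_\iota$; the degree $d_j$ of $j\in\{1,\dots,n\}$ is defined by $m_{d_j-1}<j\le m_{d_j}$. A graded metric $g$ (left invariant Riemannian metric with the $V_k$ mutually orthogonal) is fixed; a graded basis $(X_1,\dots,X_n)$ is a $g$-orthonormal basis of $\mathcal G$ such that $X_{m_{j-1}+1},\dots,X_{m_j}$ is a basis of $V_j$ for all $j$. $\mathbb G$ is identified with $\mathbb R^n$ via $(x_1,\dots,x_n)\leftrightarrow\exp(\sum_i x_iX_i)$. Dilations: $\delta_r(x_1,\dots,x_n)=(r^{d_1}x_1,\dots,r^{d_n}x_n)$. A homogeneous distance $d$ is a continuous distance on $\mathbb G$ with $d(zx,zy)=d(x,y)$ and $d(\delta_rx,\delta_ry)=r\,d(x,y)$ for all $x,y,z$, $r>0$. A $p$-dimensional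 Lipschitz submanifold is a subset $\Sigma\subset\mathbb G\equiv\mathbb R^n$ that is locally the graph of a Euclidean Lipschitz function from an open subset of a $p$-dimensional linear subspace $W$ to an $(n-p)$-dimensional complementary linear subspace. The (Euclidean) tangent cone at $x\in\Sigma$ is $C_x\Sigma=\{tv: t\ge0,\ v=\lim_i\frac{x_i-x}{|x_i-x|}\text{ for some sequence }(x_i)\subset\Sigma,\ x_i\to x\}$, and the singular set is $\Sigma_\ast=\{x\in\Sigma: C_x\Sigma\text{ is not a }p\text{-dimensional subspace of }\mathbb R^n\}$. $I_p$ is the set of $\alpha=(\alpha_1,\dots,\alpha_p)$ with $1\le\alpha_1<\dots<\alpha_p\le n$, $d(\alpha)=d_{\alpha_1}+\dots+d_{\alpha_p}$, and $D(p)=\max_{\alpha\in I_p}d(\alpha)$. For $x\in\Sigma\setminus\Sigma_\ast$, let $\tau_\Sigma(x)=\sum_{\alpha\in I_p}c_\alpha\,(X_{\alpha_1}\wedge\dots\wedge X_{\alpha_p})(x)$ be a $p$-vector associated with the $p$-plane $C_x\Sigma$; the degree of $\Sigma$ at $x$ is $d_\Sigma(x)=\max\{d(\alpha):c_\alpha\ne0\}$. *)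

theory Defs
  imports "HOL-Analysis.Analysis"
begin

text \<open>
  Exponential coordinates: a type \<open>'a\<close> of class \<open>euclidean_space\<close> plays at the same time the role
  of the Lie algebra (identified with the tangent space at the unit \<open>0\<close>) and of the group, the
  exponential map being the identity. The inner product of \<open>'a\<close> is the graded metric at the
  unit. Since the graded basis \<open>X\<close> is orthonormal, the map sending \<open>(x\<^sub>1,\<dots>,x\<^sub>n)\<close> to
  \<open>\<Sum>i. x\<^sub>i X\<^sub>i\<close> is an isometry from \<open>\<real>\<^sup>n\<close> onto \<open>'a\<close>, and all Euclidean notions on \<open>\<real>\<^sup>n\<close> are those
  of \<open>'a\<close>.
\<close>

section \<open>Stratified groups in exponential coordinates\<close>

fun Ck_map :: "nat \<Rightarrow> ('a::euclidean_space \<Rightarrow> 'b::real_normed_vector) \<Rightarrow> bool" where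
  "Ck_map 0 f \<longleftrightarrow> continuous_on UNIV f"
| "Ck_map (Suc k) f \<longleftrightarrow> (\<forall>x. f differentiable (at x)) \<and>
     (\<forall>v. Ck_map k (\<lambda>x. frechet_derivative f (at x) v))"

definition smooth_map :: "('a::euclidean_space \<Rightarrow> 'b::real_normed_vector) \<Rightarrow> bool" where
  "smooth_map f \<longleftrightarrow> (\<forall>k. Ck_map k f)"

text \<open>
  A Lie group whose underlying manifold is its Lie algebra and whose exponential map is the
  identity: the one-parameter subgroup with velocity \<open>v\<close> at the unit is \<open>t \<mapsto> t v\<close>. Every connected,
  simply connected nilpotent Lie group is of this form, as its exponential map is a
  diffeomorphism.
\<close>

definition exp_coord_lie_group :: "('a::euclidean_space \<Rightarrow> 'a \<Rightarrow> 'a) \<Rightarrow> bool" where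
  "exp_coord_lie_group mul \<longleftrightarrow>
     Groups.group mul 0 uminus \<and>
     smooth_map (\<lambda>(x, y). mul x y) \<and>
     (\<forall>v s t. mul (s *\<^sub>R v) (t *\<^sub>R v) = (s + t) *\<^sub>R v)"

definition left_inv_field :: "('a::euclidean_space \<Rightarrow> 'a \<Rightarrow> 'a) \<Rightarrow> 'a \<Rightarrow> 'a \<Rightarrow> 'a" where
  "left_inv_field mul v x = frechet_derivative (mul x) (at 0) v"

definition vf_bracket :: "('a::euclidean_space \<Rightarrow> 'a) \<Rightarrow> ('a \<Rightarrow> 'a) \<Rightarrow> 'a \<Rightarrow> 'a" where
  "vf_bracket X Y x = frechet_derivative Y (at x) (X x) - frechet_derivative X (at x) (Y x)"

definition lie_bracket :: "('a::euclidean_space \<Rightarrow> 'a \<Rightarrow> 'a) \<Rightarrow> 'a \<Rightarrow> 'a \<Rightarrow> 'a" where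
  "lie_bracket mul u v = vf_bracket (left_inv_field mul u) (left_inv_field mul v) 0"

text \<open>Nilpotency of the Lie algebra is a consequence of the stratification.\<close>

definition stratified_group ::
    "('a::euclidean_space \<Rightarrow> 'a \<Rightarrow> 'a) \<Rightarrow> (nat \<Rightarrow> 'a set) \<Rightarrow> nat \<Rightarrow> bool" where
  "stratified_group mul V \<iota> \<longleftrightarrow>
     exp_coord_lie_group mul \<and>
     1 \<le> \<iota> \<and>
     (\<forall>i\<in>{1..\<iota>}. subspace (V i)) \<and>
     (\<forall>x. \<exists>!v. v \<in> (\<Pi>\<^sub>E i\<in>{1..\<iota>}. V i) \<and> x = (\<Sum>i=1..\<iota>. v i)) \<and>
     (\<forall>i\<ge>1. V (Suc i) = span {lie_bracket mul u v | u v. u \<in> V 1 \<and> v \<in> V i}) \<and>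
     V (Suc \<iota>) = {0}"

definition graded_metric :: "(nat \<Rightarrow> 'a::euclidean_space set) \<Rightarrow> nat \<Rightarrow> bool" where
  "graded_metric V \<iota> \<longleftrightarrow>
     (\<forall>i\<in>{1..\<iota>}. \<forall>j\<in>{1..\<iota>}. i \<noteq> j \<longrightarrow> (\<forall>u\<in>V i. \<forall>v\<in>V j. orthogonal u v))"

definition layer_sum :: "(nat \<Rightarrow> 'a::euclidean_space set) \<Rightarrow> nat \<Rightarrow> nat" where
  "layer_sum V j = (\<Sum>i=1..j. dim (V i))"

definition index_degree :: "(nat \<Rightarrow> 'a::euclidean_space set) \<Rightarrow> nat \<Rightarrow> nat" where
  "index_degree V j = (THE k. 1 \<le> k \<and> layer_sum V (k - 1) < j \<and> j \<le> layer_sum V k)"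

definition graded_basis ::
    "(nat \<Rightarrow> 'a::euclidean_space set) \<Rightarrow> nat \<Rightarrow> (nat \<Rightarrow> 'a) \<Rightarrow> bool" where
  "graded_basis V \<iota> X \<longleftrightarrow>
     (\<forall>i\<in>{1..DIM('a)}. \<forall>j\<in>{1..DIM('a)}. X i \<bullet> X j = (if i = j then 1 else 0)) \<and>
     (\<forall>j\<in>{1..\<iota>}.
        independent (X ` {layer_sum V (j - 1)<..layer_sum V j}) \<and>
        span (X ` {layer_sum V (j - 1)<..layer_sum V j}) = V j)"

definition dilation ::
    "(nat \<Rightarrow> 'a::euclidean_space set) \<Rightarrow> (nat \<Rightarrow> 'a) \<Rightarrow> real \<Rightarrow> 'a \<Rightarrow> 'a" where
  "dilation V X r x = (\<Sum>j=1..DIM('a). (r ^ index_degree V j * (x \<bullet> X j)) *\<^sub>R X j)"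

definition homogeneous_distance ::
    "('a::euclidean_space \<Rightarrow> 'a \<Rightarrow> 'a) \<Rightarrow> (nat \<Rightarrow> 'a set) \<Rightarrow> (nat \<Rightarrow> 'a) \<Rightarrow>
     ('a \<Rightarrow> 'a \<Rightarrow> real) \<Rightarrow> bool" where
  "homogeneous_distance mul V X d \<longleftrightarrow>
     Metric_space UNIV d \<and>
     continuous_on UNIV (\<lambda>(x, y). d x y) \<and>
     (\<forall>x y z. d (mul z x) (mul z y) = d x y) \<and>
     (\<forall>x y r. r > 0 \<longrightarrow> d (dilation V X r x) (dilation V X r y) = r * d x y)"

section \<open>Hausdorff measure of a distance\<close>

definition ediam :: "('a \<Rightarrow> 'a \<Rightarrow> real) \<Rightarrow> 'a set \<Rightarrow> ennreal" where
  "ediam d A = (SUP x\<in>A. SUP y\<in>A. ennreal (d x y))"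

definition hausdorff_premeasure ::
    "('a \<Rightarrow> 'a \<Rightarrow> real) \<Rightarrow> nat \<Rightarrow> real \<Rightarrow> 'a set \<Rightarrow> ennreal" where
  "hausdorff_premeasure d k \<delta> E =
     (INF A \<in> {A :: nat \<Rightarrow> 'a set. E \<subseteq> (\<Union>i. A i) \<and> (\<forall>i. ediam d (A i) \<le> ennreal \<delta>)}.
        (\<Sum>i. if A i = {} then 0 else ediam d (A i) ^ k))"

definition hausdorff_measure :: "('a \<Rightarrow> 'a \<Rightarrow> real) \<Rightarrow> nat \<Rightarrow> 'a set \<Rightarrow> ennreal" where
  "hausdorff_measure d k E = (SUP \<delta>\<in>{0<..}. hausdorff_premeasure d k \<delta> E)"

section \<open>Lipschitz submanifolds, singular points and degree\<close>

definition lipschitz_submanifold :: "nat \<Rightarrow> 'a::euclidean_space set \<Rightarrow> bool" where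
  "lipschitz_submanifold p S \<longleftrightarrow>
     (\<forall>x\<in>S. \<exists>U W W' A f L.
        open U \<and> x \<in> U \<and>
        subspace W \<and> dim W = p \<and>
        subspace W' \<and> dim W' = DIM('a) - p \<and> W \<inter> W' = {0} \<and>
        openin (top_of_set W) A \<and> f ` A \<subseteq> W' \<and> L-lipschitz_on A f \<and>
        S \<inter> U = (\<lambda>w. w + f w) ` A)"

definition tangent_cone :: "'a::euclidean_space set \<Rightarrow> 'a \<Rightarrow> 'a set" where
  "tangent_cone S x =
     {t *\<^sub>R v | t v. t \<ge> 0 \<and>
        (\<exists>\<xi>. (\<forall>i. \<xi> i \<in> S \<and> \<xi> i \<noteq> x) \<and> \<xi> \<longlonglongrightarrow> x \<and>
             (\<lambda>i::nat. (\<xi> i - x) /\<^sub>R norm (\<xi> i - x)) \<longlonglongrightarrow> v)}"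

definition singular_set :: "nat \<Rightarrow> 'a::euclidean_space set \<Rightarrow> 'a set" where
  "singular_set p S =
     {x \<in> S. \<not> (subspace (tangent_cone S x) \<and> dim (tangent_cone S x) = p)}"

definition multi_indices :: "nat \<Rightarrow> nat \<Rightarrow> nat list set" where
  "multi_indices n p = {\<alpha>. length \<alpha> = p \<and> sorted_wrt (<) \<alpha> \<and> set \<alpha> \<subseteq> {1..n}}"

definition multi_degree :: "(nat \<Rightarrow> 'a::euclidean_space set) \<Rightarrow> nat list \<Rightarrow> nat" where
  "multi_degree V \<alpha> = (\<Sum>j\<leftarrow>\<alpha>. index_degree V j)"

definition max_degree :: "(nat \<Rightarrow> 'a::euclidean_space set) \<Rightarrow> nat \<Rightarrow> nat" where
  "max_degree V p = Max (multi_degree V ` multi_indices DIM('a) p)"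

text \<open>
  The \<open>p\<close>-vector \<open>v\<^sub>1 \<and> \<dots> \<and> v\<^sub>p\<close> is represented by its action
  \<open>(w\<^sub>1,\<dots>,w\<^sub>p) \<mapsto> det (v\<^sub>i \<bullet> w\<^sub>j)\<close>. This realises the \<open>p\<close>-th exterior power of \<open>'a\<close> as the space of
  alternating \<open>p\<close>-linear forms on the dual of \<open>'a\<close>, covectors being written as
  \<open>\<lambda>x. x \<bullet> w\<close>. Only \<open>w 0,\<dots>,w (p - 1)\<close> matter.
\<close>

definition wedge :: "'a::euclidean_space list \<Rightarrow> (nat \<Rightarrow> 'a) \<Rightarrow> real" where
  "wedge vs w =
     (\<Sum>\<sigma> | \<sigma> permutes {..<length vs}.
        of_int (sign \<sigma>) * (\<Prod>i<length vs. (vs ! \<sigma> i) \<bullet> w i))"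

text \<open>
  The \<open>p\<close>-vector associated with the tangent plane is determined up to a nonzero factor (a change
  of basis of the plane), which does not affect the degree; hence the definite description below
  has exactly one witness \<open>k\<close> whenever \<open>x\<close> is a nonsingular point.
\<close>

definition degree_at ::
    "('a::euclidean_space \<Rightarrow> 'a \<Rightarrow> 'a) \<Rightarrow> (nat \<Rightarrow> 'a set) \<Rightarrow> (nat \<Rightarrow> 'a) \<Rightarrow> nat \<Rightarrow>
     'a set \<Rightarrow> 'a \<Rightarrow> nat" where
  "degree_at mul V X p S x =
     (THE k. \<exists>ts c.
        length ts = p \<and> distinct ts \<and> independent (set ts) \<and> span (set ts) = tangent_cone S x \<and>
        wedge ts = (\<lambda>w. \<Sum>\<alpha>\<in>multi_indices DIM('a) p.
                       c \<alpha> * wedge (map (\<lambda>j. left_inv_field mul (X j) x) \<alpha>) w) \<and>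
        k = Max {multi_degree V \<alpha> | \<alpha>. \<alpha> \<in> multi_indices DIM('a) p \<and> c \<alpha> \<noteq> (0::real)})"

definition low_degree_set ::
    "('a::euclidean_space \<Rightarrow> 'a \<Rightarrow> 'a) \<Rightarrow> (nat \<Rightarrow> 'a set) \<Rightarrow> (nat \<Rightarrow> 'a) \<Rightarrow> nat \<Rightarrow>
     'a set \<Rightarrow> 'a set" where
  "low_degree_set mul V X p S =
     {x \<in> S - singular_set p S. degree_at mul V X p S x < max_degree V p}"

end

theory Submission
  imports Defs
begin

text \<open>
  In a local graph chart Rademacher's theorem turns the singular set into a Lebesgue null set of
  parameters, and a Vitali covering of the parameters reduces the claim to single points \<open>x\<close>: for
  arbitrarily small \<open>s\<close> the premeasure of \<open>\<Sigma> \<inter> cball x s\<close> (a Euclidean ball) is at most \<open>C s\<^sup>p\<close>, and at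
  most \<open>\<eta> s\<^sup>p\<close> for every \<open>\<eta> > 0\<close> if \<open>x\<close> has low degree.

  To see this, count a maximal \<open>r\<close>-separated subset of \<open>\<Sigma> \<inter> cball x s\<close>, translated to the unit. The
  points carry disjoint translates of a box with sides \<open>\<kappa> r^(d\<^sub>j)\<close>, whose union lies in a region of
  known volume; since \<open>s\<close> and the boxes are small, only the first order expansion of the group law
  at the unit matters. Let \<open>m\<close> be the least degree occurring in a multi-index of maximal degree. For
  \<open>s = r^m\<close> the count is at most \<open>C s\<^sup>p r^(-D)\<close> with \<open>D = max_degree V p\<close>. If \<open>\<Sigma>\<close> is close to a plane of
  low degree, then the region is thin, and \<open>s = M r^m\<close> with \<open>M\<close> large gains an arbitrarily small factor.
\<close>

section \<open>Outer density and Lipschitz images\<close>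

text \<open>Why the scale r^m: a multi-index of maximal degree consists of the p largest degrees, so
  its degrees are at least m and all others at most m. A Euclidean ball of radius r^m is no wider
  than the box of size r in a direction of degree at most m; it is longer only in directions of
  degree above m, all of which belong to the multi-index. Counting boxes therefore gives (r^m)^p /
  r^D up to a constant. This count holds for the whole ball of the group and not merely for its part
  on \<Sigma>, so it works at singular points, where no tangent plane is at hand; there smallness
  comes from the null set of parameters. Low degree parameters may fill positive volume, so
  smallness must come from the factor \<open>\<eta>\<close>. The estimates are asserted only along
  some scales tending to 0, not at every scale. This is exactly what a Vitali covering can use, and
  it is harmless because the Hausdorff measure is the supremum of the premeasures, each of which is
  shown to vanish with \<open>\<delta>\<close> fixed.\<close>

lemma sum_measure_disjoint_le:
  assumes "finite I" "\<And>i. i \<in> I \<Longrightarrow> B i \<in> lmeasurable" "pairwise (\<lambda>i j. disjnt (B i) (B j)) I"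
    and "\<And>i. i \<in> I \<Longrightarrow> B i \<subseteq> T" "T \<in> lmeasurable"
  shows "(\<Sum>i\<in>I. measure lebesgue (B i)) \<le> measure lebesgue T"
proof -
  have "(\<Sum>i\<in>I. measure lebesgue (B i)) = measure lebesgue (\<Union>i\<in>I. B i)"
    using assms by (intro measure_UNION'[symmetric]) auto
  also have "\<dots> \<le> measure lebesgue T"
    using assms by (intro measure_mono_fmeasurable) (auto intro!: sets.finite_UN)
  finally show ?thesis .
qed

text \<open>A bound uniform over finite subfamilies passes to the countable union. It serves to
  exchange disjoint Vitali balls \<open>B i\<close> for substitutes \<open>U i\<close> of comparable
  volume.\<close>

lemma measure_UN_le_of_disjoint:
  assumes "countable C" "\<And>i. i \<in> C \<Longrightarrow> B i \<in> lmeasurable"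
    and "pairwise (\<lambda>i j. disjnt (B i) (B j)) C"
    and "\<And>i. i \<in> C \<Longrightarrow> B i \<subseteq> T" "T \<in> lmeasurable"
    and "\<And>i. i \<in> C \<Longrightarrow> U i \<in> lmeasurable"
    and "\<And>i. i \<in> C \<Longrightarrow> measure lebesgue (U i) \<le> \<theta> * measure lebesgue (B i)" "0 \<le> \<theta>"
  shows "(\<Union>i\<in>C. U i) \<in> lmeasurable" "measure lebesgue (\<Union>i\<in>C. U i) \<le> \<theta> * measure lebesgue T"
proof -
  have le: "measure lebesgue (\<Union>i\<in>I. U i) \<le> \<theta> * measure lebesgue T" if "I \<subseteq> C" "finite I" for I
  proof -
    have "measure lebesgue (\<Union>i\<in>I. U i) \<le> (\<Sum>i\<in>I. measure lebesgue (U i))"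
      using that assms by (intro measure_UNION_le) auto
    also have "\<dots> \<le> (\<Sum>i\<in>I. \<theta> * measure lebesgue (B i))"
      using that assms by (intro sum_mono) auto
    also have "\<dots> = \<theta> * (\<Sum>i\<in>I. measure lebesgue (B i))"
      by (simp add: sum_distrib_left)
    also have "\<dots> \<le> \<theta> * measure lebesgue T"
      using that assms by (intro mult_left_mono sum_measure_disjoint_le) (auto simp: pairwise_subset)
    finally show ?thesis .
  qed
  show "(\<Union>i\<in>C. U i) \<in> lmeasurable"
    by (rule fmeasurable_UN_bound[OF assms(1) assms(6) le]) auto
  show "measure lebesgue (\<Union>i\<in>C. U i) \<le> \<theta> * measure lebesgue T"
    by (rule measure_UN_bound[OF assms(1) assms(6) le]) auto
qed

lemma lmeasurable_outer_open:
  assumes "T \<in> lmeasurable" "e > 0"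
  obtains G where "open G" "T \<subseteq> G" "G \<in> lmeasurable" "measure lebesgue G < measure lebesgue T + e"
proof -
  obtain G where G: "open G" "T \<subseteq> G" "(G - T) \<in> lmeasurable" "emeasure lebesgue (G - T) < ennreal e"
    using sets_lebesgue_outer_open[of T e] assms by auto
  have "measure lebesgue (G - T) < e"
    using G assms by (simp add: emeasure_eq_measure2 ennreal_less_iff)
  moreover have GT: "G = T \<union> (G - T)" using G by auto
  have "G \<in> lmeasurable" using G assms by (subst GT) (intro fmeasurable.Un; simp)
  moreover have "measure lebesgue G \<le> measure lebesgue T + measure lebesgue (G - T)"
    using G assms by (subst GT) (intro measure_Un_le; auto)
  ultimately show ?thesis using that G by fastforce
qed

text \<open>Replaces the density theorem for sets not known to be measurable. Let \<open>m\<close>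
  be the outer measure. In an open set of volume almost \<open>m\<close>, disjoint Vitali balls
  exhaust \<open>S\<close> up to a null set, and exchanging each ball for its \<open>U\<close> gives
  a cover of volume at most \<open>\<theta> * (m + e)\<close>; letting \<open>e\<close> shrink
  forces \<open>m = 0\<close>. The balls need not be centred at points of \<open>S\<close>, which
  matters for one-sided difference quotients.\<close>

lemma negligible_of_density_less_one_bounded:
  fixes S :: "'a::euclidean_space set"
  assumes \<theta>: "0 \<le> \<theta>" "\<theta> < 1" and bS: "bounded S"
    and dens: "\<And>x e. x \<in> S \<Longrightarrow> 0 < e \<Longrightarrow> \<exists>a r U. 0 < r \<and> r < e \<and> x \<in> cball a r \<and>
      S \<inter> cball a r \<subseteq> U \<and> U \<in> lmeasurable \<and>
      measure lebesgue U \<le> \<theta> * measure lebesgue (cball a r)"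
  shows "negligible S"
proof -
  define \<M> where "\<M> = {measure lebesgue T | T. T \<in> lmeasurable \<and> S \<subseteq> T}"
  define m where "m = Inf \<M>"
  obtain a b where ab: "S \<subseteq> cbox a b" using bS bounded_subset_cbox_symmetric by blast
  have ne: "\<M> \<noteq> {}" using ab unfolding \<M>_def by blast
  have bdd: "bdd_below \<M>" unfolding \<M>_def by (rule bdd_belowI[of _ 0]) auto
  have m0: "0 \<le> m" unfolding m_def using ne by (intro cInf_greatest) (auto simp: \<M>_def)
  have near: "\<exists>T. T \<in> lmeasurable \<and> S \<subseteq> T \<and> measure lebesgue T < m + e" if "e > 0" for e
  proof -
    have "Inf \<M> < m + e" using that by (simp add: m_def)
    then obtain y where "y \<in> \<M>" "y < m + e" using cInf_lessD[OF ne] by blast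
    then show ?thesis unfolding \<M>_def by blast
  qed
  have key: "m \<le> \<theta> * (m + e)" if e: "e > 0" for e
  proof -
    obtain T where T: "T \<in> lmeasurable" "S \<subseteq> T" "measure lebesgue T < m + e/2"
      using near[of "e/2"] e by auto
    obtain G where G: "open G" "T \<subseteq> G" "G \<in> lmeasurable" "measure lebesgue G < measure lebesgue T + e/2"
      using lmeasurable_outer_open[OF T(1), of "e/2"] \<open>e > 0\<close> by auto
    \<comment> \<open>Each index carries its own \<open>U\<close>, so the cover attached to a ball
      survives the Vitali selection.\<close>
    define K where "K = {(a, r, U). 0 < r \<and> cball a r \<subseteq> G \<and> S \<inter> cball a r \<subseteq> U \<and> U \<in> lmeasurable \<and>
      measure lebesgue U \<le> \<theta> * measure lebesgue (cball a r)}"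
    have KD: "cball (fst i) (fst (snd i)) \<subseteq> G" "S \<inter> cball (fst i) (fst (snd i)) \<subseteq> snd (snd i)"
      "snd (snd i) \<in> lmeasurable"
      "measure lebesgue (snd (snd i)) \<le> \<theta> * measure lebesgue (cball (fst i) (fst (snd i)))"
      if "i \<in> K" for i using that by (auto simp: K_def)
    have K1: "0 < fst (snd i)" if "i \<in> K" for i using that by (auto simp: K_def)
    have K2: "\<exists>i. i \<in> K \<and> x \<in> cball (fst i) (fst (snd i)) \<and> fst (snd i) < d"
      if x: "x \<in> S" "0 < d" for x d
    proof -
      obtain e0 where e0: "e0 > 0" "ball x e0 \<subseteq> G" using x T G openE by blast
      \<comment> \<open>The ball contains \<open>x\<close> without being centred there, so its
        radius has to stay below half of \<open>e0\<close>.\<close>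
      obtain a r U where aru: "0 < r" "r < min d (e0/2)" "x \<in> cball a r"
        "S \<inter> cball a r \<subseteq> U" "U \<in> lmeasurable" "measure lebesgue U \<le> \<theta> * measure lebesgue (cball a r)"
        using dens[of x "min d (e0/2)"] x e0 by auto
      have "cball a r \<subseteq> ball x e0"
      proof
        fix y assume "y \<in> cball a r"
        then have "dist x y \<le> r + r" using aru dist_triangle[of x y a] by (auto simp: dist_commute)
        then show "y \<in> ball x e0" using aru by auto
      qed
      then have "(a, r, U) \<in> K" using aru e0 by (auto simp: K_def)
      then show ?thesis using aru by (intro exI[of _ "(a, r, U)"]) auto
    qed
    obtain C where C: "countable C" "C \<subseteq> K"
      "pairwise (\<lambda>i j. disjnt (cball (fst i) (fst (snd i))) (cball (fst j) (fst (snd j)))) C"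
      "negligible (S - (\<Union>i\<in>C. cball (fst i) (fst (snd i))))"
      by (rule Vitali_covering_theorem_cballs[of K "\<lambda>i. fst (snd i)" S fst, OF K1 K2])
    let ?N = "S - (\<Union>i\<in>C. cball (fst i) (fst (snd i)))"
    let ?V = "\<Union>i\<in>C. snd (snd i)"
    have V: "?V \<in> lmeasurable" "measure lebesgue ?V \<le> \<theta> * measure lebesgue G"
      using measure_UN_le_of_disjoint[OF C(1) _ C(3) _ G(3), of "\<lambda>i. snd (snd i)" \<theta>,
          OF lmeasurable_cball KD(1)[OF subsetD[OF C(2)]] KD(3)[OF subsetD[OF C(2)]]
            KD(4)[OF subsetD[OF C(2)]] \<theta>(1)] by blast+
    have "S \<subseteq> ?V \<union> ?N" using C(2) KD(2) by blast
    moreover have "?V \<union> ?N \<in> lmeasurable" using V C negligible_imp_measurable by (intro fmeasurable.Un) auto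
    ultimately have "measure lebesgue (?V \<union> ?N) \<in> \<M>" unfolding \<M>_def by blast
    then have "m \<le> measure lebesgue (?V \<union> ?N)" unfolding m_def using bdd by (rule cInf_lower)
    also have "\<dots> \<le> measure lebesgue ?V + measure lebesgue ?N"
      using V C by (intro measure_Un_le) (auto simp: negligible_imp_sets)
    also have "\<dots> = measure lebesgue ?V" using C by (simp add: negligible_imp_measure0)
    also have "\<dots> \<le> \<theta> * measure lebesgue G" by (rule V)
    also have "\<dots> \<le> \<theta> * (m + e)" using T G \<theta> by (intro mult_left_mono) auto
    finally show ?thesis .
  qed
  have "m = 0"
  proof (rule ccontr)
    assume "m \<noteq> 0"
    then have mp: "m > 0" using m0 by auto
    \<comment> \<open>The error \<open>(1 - \<theta>) * m / 2\<close> is absorbed by the gap between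
      \<open>\<theta>\<close> and 1.\<close>
    have "m \<le> \<theta> * (m + (1 - \<theta>) * m / 2)" using mp \<theta> by (intro key) auto
    also have "\<dots> \<le> \<theta> * m + 1 * ((1 - \<theta>) * m / 2)"
      using mp \<theta> by (simp only: distrib_left) (intro add_left_mono mult_right_mono, auto)
    finally have "m * (1 - \<theta>) \<le> 0" by (simp add: field_simps)
    then show False using mp \<theta> by (simp add: mult_le_0_iff)
  qed
  show ?thesis unfolding negligible_outer
  proof (intro allI impI)
    fix e :: real assume "e > 0"
    then show "\<exists>T. S \<subseteq> T \<and> T \<in> lmeasurable \<and> measure lebesgue T < e"
      using near[of e] \<open>m = 0\<close> by auto
  qed
qed

lemma negligible_of_density_less_one:
  fixes S :: "'a::euclidean_space set"
  assumes \<theta>: "0 \<le> \<theta>" "\<theta> < 1"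
    and dens: "\<And>x e. x \<in> S \<Longrightarrow> 0 < e \<Longrightarrow> \<exists>a r U. 0 < r \<and> r < e \<and> x \<in> cball a r \<and>
      S \<inter> cball a r \<subseteq> U \<and> U \<in> lmeasurable \<and>
      measure lebesgue U \<le> \<theta> * measure lebesgue (cball a r)"
  shows "negligible S"
proof -
  have "negligible (S \<inter> ball 0 (real n))" for n
  proof (rule negligible_of_density_less_one_bounded[OF \<theta>])
    show "bounded (S \<inter> ball 0 (real n))" by (intro bounded_Int) auto
    fix x and e :: real assume "x \<in> S \<inter> ball 0 (real n)" "0 < e"
    then obtain a r U where "0 < r" "r < e" "x \<in> cball a r" "S \<inter> cball a r \<subseteq> U"
      "U \<in> lmeasurable" "measure lebesgue U \<le> \<theta> * measure lebesgue (cball a r)"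
      using dens[of x e] by auto
    then show "\<exists>a r U. 0 < r \<and> r < e \<and> x \<in> cball a r \<and> S \<inter> ball 0 (real n) \<inter> cball a r \<subseteq> U \<and>
      U \<in> lmeasurable \<and> measure lebesgue U \<le> \<theta> * measure lebesgue (cball a r)"
      by (intro exI[of _ a] exI[of _ r] exI[of _ U]) auto
  qed
  then have "negligible (\<Union>n. S \<inter> ball 0 (real n))" by (intro negligible_countable_Union) auto
  moreover have "S \<subseteq> (\<Union>n. S \<inter> ball 0 (real n))" using reals_Archimedean2 by auto
  ultimately show ?thesis by (rule negligible_subset)
qed

text \<open>Small balls go into balls of \<open>K\<close> times the radius, and the null remainder
  of a Vitali covering has null image. A measurable superset is produced because the image itself is
  not shown to be measurable.\<close>

lemma lipschitz_image_measure:
  fixes f :: "'a::euclidean_space \<Rightarrow> 'a"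
  assumes "open S" "S \<in> lmeasurable" and lip: "K-lipschitz_on S f"
  obtains U where "U \<in> lmeasurable" "f ` S \<subseteq> U"
    "measure lebesgue U \<le> K ^ DIM('a) * measure lebesgue S"
proof -
  have K0: "K \<ge> 0" using lip lipschitz_on_nonneg by blast
  define I where "I = {(a, r). 0 < r \<and> cball a r \<subseteq> S}"
  have 1: "0 < snd i" if "i \<in> I" for i using that by (auto simp: I_def)
  have 2: "\<exists>i. i \<in> I \<and> x \<in> cball (fst i) (snd i) \<and> snd i < d" if x: "x \<in> S" "0 < d" for x d
  proof -
    obtain e where "e > 0" "cball x e \<subseteq> S" using x assms open_contains_cball by blast
    moreover have "cball x (min e (d/2)) \<subseteq> cball x e" by auto
    ultimately have "(x, min e (d/2)) \<in> I" using x unfolding I_def by auto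
    then show ?thesis using x \<open>e > 0\<close> by (intro exI[of _ "(x, min e (d/2))"]) auto
  qed
  obtain C where C: "countable C" "C \<subseteq> I"
      "pairwise (\<lambda>i j. disjnt (cball (fst i) (snd i)) (cball (fst j) (snd j))) C"
      "negligible (S - (\<Union>i\<in>C. cball (fst i) (snd i)))"
    by (rule Vitali_covering_theorem_cballs[of I snd S fst, OF 1 2])
  let ?N = "S - (\<Union>i\<in>C. cball (fst i) (snd i))"
  let ?V = "\<Union>i\<in>C. cball (f (fst i)) (K * snd i)"
  have mc: "measure lebesgue (cball (f a) (K * r)) \<le> K ^ DIM('a) * measure lebesgue (cball a r)"
    if "0 < r" for a r
    using that K0 content_ball_conv_unit_ball[of "K*r" "f a"] content_ball_conv_unit_ball[of r a]
    by (simp add: content_cball_conv_ball power_mult_distrib)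
  have V: "?V \<in> lmeasurable" "measure lebesgue ?V \<le> K ^ DIM('a) * measure lebesgue S"
    using measure_UN_le_of_disjoint[OF C(1) _ C(3) _ assms(2), of "\<lambda>i. cball (f (fst i)) (K * snd i)",
        OF lmeasurable_cball _ lmeasurable_cball mc[OF 1[OF subsetD[OF C(2)]]]] C(2) K0
    by (fastforce simp: I_def)+
  have neg: "negligible (f ` ?N)"
  proof (rule negligible_locally_Lipschitz_image[OF _ C(4)])
    fix x assume "x \<in> ?N"
    then show "\<exists>T B. open T \<and> x \<in> T \<and> (\<forall>y\<in>?N \<inter> T. norm (f y - f x) \<le> B * norm (y - x))"
      using lipschitz_on_normD[OF lip] by (intro exI[of _ UNIV] exI[of _ K]) auto
  qed auto
  have sub: "f ` S \<subseteq> ?V \<union> f ` ?N"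
  proof
    fix y assume "y \<in> f ` S"
    then obtain x where x: "x \<in> S" "y = f x" by auto
    show "y \<in> ?V \<union> f ` ?N"
    proof (cases "x \<in> ?N")
      case False
      then obtain i where i: "i \<in> C" "x \<in> cball (fst i) (snd i)" using x by auto
      moreover have "i \<in> I" using i C(2) by blast
      ultimately have "0 < snd i" "cball (fst i) (snd i) \<subseteq> S" by (auto simp: I_def)
      then have "fst i \<in> S" by (meson centre_in_cball less_imp_le subsetD)
      then have "dist (f (fst i)) (f x) \<le> K * dist (fst i) x" using lip x lipschitz_onD by blast
      also have "\<dots> \<le> K * snd i" using i K0 by (intro mult_left_mono) auto
      finally show ?thesis using i x by auto
    qed (use x in auto)
  qed
  show ?thesis
  proof (rule that[of "?V \<union> f ` ?N"])
    show "?V \<union> f ` ?N \<in> lmeasurable" using V neg negligible_imp_measurable by (intro fmeasurable.Un) auto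
    have "measure lebesgue (?V \<union> f ` ?N) \<le> measure lebesgue ?V + measure lebesgue (f ` ?N)"
      using V neg by (intro measure_Un_le) (auto simp: negligible_imp_sets)
    then show "measure lebesgue (?V \<union> f ` ?N) \<le> K ^ DIM('a) * measure lebesgue S"
      using V neg by (simp add: negligible_imp_measure0)
  qed (rule sub)
qed

section \<open>Rademacher's theorem\<close>

text \<open>The half-open intervals are disjoint sets for the Stieltjes measure of \<open>h\<close>,
  so additivity replaces a telescoping argument that would have to order the intervals.\<close>

lemma sum_increments_le:
  fixes h :: "real \<Rightarrow> real"
  assumes "mono h" and cont: "continuous_on UNIV h" and "finite I"
    and r: "\<And>i. i \<in> I \<Longrightarrow> 0 < r i"
    and disj: "pairwise (\<lambda>i j. disjnt (cball (a i) (r i)) (cball (a j) (r j))) I"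
    and sub: "\<And>i. i \<in> I \<Longrightarrow> cball (a i) (r i) \<subseteq> {u..v}" and "u \<le> v"
  shows "(\<Sum>i\<in>I. h (a i + r i) - h (a i - r i)) \<le> h v - h u"
proof -
  let ?M = "interval_measure h"
  have mono: "\<And>x y. x \<le> y \<Longrightarrow> h x \<le> h y" using \<open>mono h\<close> by (rule monoD)
  have rc: "continuous (at_right x) h" for x
    using cont by (simp add: continuous_on_eq_continuous_at continuous_at_imp_continuous_within)
  define B where "B i = {a i - r i<..a i + r i}" for i
  have em: "emeasure ?M (B i) = ennreal (h (a i + r i) - h (a i - r i))" if "i \<in> I" for i
    unfolding B_def using r[OF that] by (intro emeasure_interval_measure_Ioc mono rc) auto
  have Bs': "B i \<subseteq> {u<..v}" if "i \<in> I" for i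
  proof
    fix x assume "x \<in> B i"
    moreover have "a i - r i \<in> cball (a i) (r i)" "a i + r i \<in> cball (a i) (r i)"
      using r[OF that] by (auto simp: dist_real_def)
    ultimately have "u \<le> a i - r i" "a i + r i \<le> v" "a i - r i < x" "x \<le> a i + r i"
      using subsetD[OF sub[OF that]] by (auto simp: B_def)
    then show "x \<in> {u<..v}" by simp
  qed
  have dB: "disjoint_family_on B I"
    using disj unfolding disjoint_family_on_def pairwise_def disjnt_def B_def
    by (force simp: cball_eq_atLeastAtMost)
  have "ennreal (\<Sum>i\<in>I. h (a i + r i) - h (a i - r i)) = (\<Sum>i\<in>I. ennreal (h (a i + r i) - h (a i - r i)))"
    using r by (intro sum_ennreal[symmetric]) (simp add: mono less_imp_le)
  also have "\<dots> = (\<Sum>i\<in>I. emeasure ?M (B i))" using em by simp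
  also have "\<dots> = emeasure ?M (\<Union>i\<in>I. B i)"
  proof (rule sum_emeasure[OF _ dB \<open>finite I\<close>])
    show "B ` I \<subseteq> sets ?M" by (auto simp: B_def)
  qed
  also have "\<dots> \<le> emeasure ?M {u<..v}" using Bs' by (intro emeasure_mono) auto
  also have "\<dots> = ennreal (h v - h u)" using \<open>u \<le> v\<close> by (intro emeasure_interval_measure_Ioc mono rc)
  finally show ?thesis using mono[OF \<open>u \<le> v\<close>] by (simp add: ennreal_le_iff)
qed

text \<open>The classical comparison behind Lebesgue's theorem on monotone functions, cast as an
  outer density estimate. Some interval at \<open>x\<close> has increment below \<open>a\<close>
  times its length; inside it the set is exhausted, up to a null set, by disjoint intervals with
  increment above \<open>b\<close> times their length. Comparing increments bounds their total
  length by the fraction \<open>a / b\<close>.\<close>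

lemma negligible_derivates_separated:
  fixes h :: "real \<Rightarrow> real"
  assumes mono: "mono h" and cont: "continuous_on UNIV h" and ab: "0 < a" "a < b"
  shows "negligible {x. (\<forall>e>0. \<exists>t. t \<noteq> 0 \<and> \<bar>t\<bar> < e \<and> (h (x + t) - h x) / t < a) \<and>
    (\<forall>e>0. \<exists>t. t \<noteq> 0 \<and> \<bar>t\<bar> < e \<and> (h (x + t) - h x) / t > b)}" (is "negligible ?E")
proof (rule negligible_of_density_less_one[of "a / b"])
  show "0 \<le> a / b" "a / b < 1" using ab by auto
  fix x e :: real assume x: "x \<in> ?E" and e: "0 < e"
  \<comment> \<open>Steps to the left and to the right are treated alike by viewing the interval
    between \<open>z\<close> and \<open>z + t\<close> as the ball about its midpoint.\<close>
  have qe: "(h (z + t) - h z) / t = (h (z + t/2 + \<bar>t\<bar>/2) - h (z + t/2 - \<bar>t\<bar>/2)) / \<bar>t\<bar>"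
    if "t \<noteq> 0" for z t
  proof (cases "t > 0")
    case True
    then have eq: "z + t/2 + \<bar>t\<bar>/2 = z + t" "z + t/2 - \<bar>t\<bar>/2 = z" by auto
    show ?thesis unfolding eq using True by simp
  next
    case False
    then have eq: "z + t/2 + \<bar>t\<bar>/2 = z" "z + t/2 - \<bar>t\<bar>/2 = z + t" by auto
    have abs: "\<bar>t\<bar> = - t" using False by simp
    show ?thesis unfolding eq unfolding abs using that by (simp add: field_simps)
  qed
  obtain t where t: "t \<noteq> 0" "\<bar>t\<bar> < e" "(h (x + t) - h x) / t < a" using x e by blast
  define c \<rho> where "c = x + t/2" and "\<rho> = \<bar>t\<bar>/2"
  have \<rho>: "\<rho> > 0" "\<rho> < e" using t by (auto simp: \<rho>_def)
  have xc: "x \<in> cball c \<rho>" by (auto simp: c_def \<rho>_def dist_real_def)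
  have inc: "h (c + \<rho>) - h (c - \<rho>) < a * (2 * \<rho>)"
  proof -
    have "(h (c + \<rho>) - h (c - \<rho>)) / (2 * \<rho>) < a" using t qe[of t x] by (simp add: c_def \<rho>_def)
    then show ?thesis using \<rho> by (simp add: divide_less_eq)
  qed
  \<comment> \<open>The intervals stay in the open ball so that every point has room around it; the
    two endpoints \<open>c - \<rho>\<close> and \<open>c + \<rho>\<close> come back later inside the
    null set \<open>?N\<close>.\<close>
  define K where "K = {(z, s). 0 < s \<and> cball z s \<subseteq> ball c \<rho> \<and> b * (2 * s) < h (z + s) - h (z - s)}"
  have KD: "0 < snd i" "cball (fst i) (snd i) \<subseteq> ball c \<rho>"
    "b * (2 * snd i) < h (fst i + snd i) - h (fst i - snd i)" if "i \<in> K" for i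
    using that by (auto simp: K_def)
  have K2: "\<exists>i. i \<in> K \<and> y \<in> cball (fst i) (snd i) \<and> snd i < d"
    if y: "y \<in> ?E \<inter> ball c \<rho>" and d: "0 < d" for y d
  proof -
    obtain e0 where e0: "e0 > 0" "ball y e0 \<subseteq> ball c \<rho>" using openE[OF open_ball, of y c \<rho>] y by blast
    obtain t where t: "t \<noteq> 0" "\<bar>t\<bar> < min d e0" "(h (y + t) - h y) / t > b"
    proof -
      have "\<forall>e>0. \<exists>t. t \<noteq> 0 \<and> \<bar>t\<bar> < e \<and> (h (y + t) - h y) / t > b" using y by blast
      moreover have "min d e0 > 0" using d e0 by simp
      ultimately show thesis using that by blast
    qed
    let ?z = "y + t/2" and ?s = "\<bar>t\<bar>/2"
    have "cball ?z ?s \<subseteq> ball y e0"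
    proof
      fix w assume "w \<in> cball ?z ?s"
      then have "\<bar>y + t/2 - w\<bar> \<le> \<bar>t\<bar>/2" by (simp add: dist_real_def)
      then have "\<bar>y - w\<bar> \<le> \<bar>t\<bar>" by (simp add: abs_if split: if_splits)
      then show "w \<in> ball y e0" using t by (simp add: dist_real_def)
    qed
    moreover have "b * (2 * ?s) < h (?z + ?s) - h (?z - ?s)"
    proof -
      have "(h (?z + ?s) - h (?z - ?s)) / (2 * ?s) > b" using t qe[of t y] by simp
      then show ?thesis using t by (simp add: less_divide_eq)
    qed
    ultimately have "(?z, ?s) \<in> K" using e0 t by (auto simp: K_def)
    then show ?thesis using t by (intro exI[of _ "(?z, ?s)"]) (auto simp: dist_real_def)
  qed
  obtain C where C: "countable C" "C \<subseteq> K"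
      "pairwise (\<lambda>i j. disjnt (cball (fst i) (snd i)) (cball (fst j) (snd j))) C"
      "negligible (?E \<inter> ball c \<rho> - (\<Union>i\<in>C. cball (fst i) (snd i)))"
    by (rule Vitali_covering_theorem_cballs[of K snd "?E \<inter> ball c \<rho>" fst, OF KD(1) K2])
  let ?V = "\<Union>i\<in>C. cball (fst i) (snd i)"
  let ?N = "?E \<inter> cball c \<rho> - ?V"
  have len: "measure lebesgue (cball z s) = 2 * s" if "s \<ge> 0" for z s :: real
    using that by (simp add: cball_eq_atLeastAtMost)
  have le: "measure lebesgue (\<Union>i\<in>I. cball (fst i) (snd i)) \<le> a / b * measure lebesgue (cball c \<rho>)"
    if I: "I \<subseteq> C" "finite I" for I
  proof -
    have IK: "i \<in> K" if "i \<in> I" for i using that I C by auto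
    have "measure lebesgue (\<Union>i\<in>I. cball (fst i) (snd i)) \<le> (\<Sum>i\<in>I. measure lebesgue (cball (fst i) (snd i)))"
      using I by (intro measure_UNION_le) auto
    also have "\<dots> \<le> (\<Sum>i\<in>I. (h (fst i + snd i) - h (fst i - snd i)) / b)"
    proof (intro sum_mono)
      fix i assume "i \<in> I"
      then show "measure lebesgue (cball (fst i) (snd i)) \<le> (h (fst i + snd i) - h (fst i - snd i)) / b"
        using len[of "snd i" "fst i"] KD[OF IK[of i]] ab by (simp add: pos_le_divide_eq mult.commute)
    qed
    also have "\<dots> = (\<Sum>i\<in>I. h (fst i + snd i) - h (fst i - snd i)) / b" by (simp add: sum_divide_distrib)
    also have "\<dots> \<le> (h (c + \<rho>) - h (c - \<rho>)) / b"
    proof (intro divide_right_mono sum_increments_le mono cont I(2))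
      show sub: "cball (fst i) (snd i) \<subseteq> {c - \<rho>..c + \<rho>}" if "i \<in> I" for i
        using KD(2)[OF IK[OF that]] ball_subset_cball[of c \<rho>] cball_eq_atLeastAtMost[of c \<rho>]
        by (metis order_trans)
      show "0 < snd i" if "i \<in> I" for i using KD(1)[OF IK[OF that]] .
      show "pairwise (\<lambda>i j. disjnt (cball (fst i) (snd i)) (cball (fst j) (snd j))) I"
        using C(3) I(1) by (rule pairwise_subset)
    qed (use ab \<rho> in auto)
    also have "\<dots> \<le> a * (2 * \<rho>) / b" using inc ab by (intro divide_right_mono) auto
    also have "\<dots> = a / b * measure lebesgue (cball c \<rho>)" using len \<rho> by simp
    finally show ?thesis .
  qed
  have V: "?V \<in> lmeasurable" "measure lebesgue ?V \<le> a / b * measure lebesgue (cball c \<rho>)"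
    using fmeasurable_UN_bound[OF C(1) _ le] measure_UN_bound[OF C(1) _ le] by auto
  have "negligible ?N"
  proof (rule negligible_subset)
    show "negligible ((?E \<inter> ball c \<rho> - ?V) \<union> {c - \<rho>, c + \<rho>})"
      by (intro negligible_Un[OF C(4)] negligible_finite) simp
    show "?N \<subseteq> (?E \<inter> ball c \<rho> - ?V) \<union> {c - \<rho>, c + \<rho>}"
      by (auto simp: dist_real_def abs_real_def split: if_splits)
  qed
  then have N: "?N \<in> lmeasurable" "measure lebesgue ?N = 0" "?N \<in> sets lebesgue"
    using negligible_imp_measurable negligible_imp_measure0 negligible_imp_sets by blast+
  have "?V \<union> ?N \<in> lmeasurable" using V N by (intro fmeasurable.Un) auto
  moreover have "measure lebesgue (?V \<union> ?N) \<le> a / b * measure lebesgue (cball c \<rho>)"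
    using measure_Un_le[of ?V lebesgue ?N] V N by (simp add: fmeasurableD)
  moreover have "?E \<inter> cball c \<rho> \<subseteq> ?V \<union> ?N" by blast
  ultimately show "\<exists>c r U. 0 < r \<and> r < e \<and> x \<in> cball c r \<and> ?E \<inter> cball c r \<subseteq> U \<and> U \<in> lmeasurable \<and>
      measure lebesgue U \<le> a / b * measure lebesgue (cball c r)"
    using \<rho> xc by (intro exI[of _ c] exI[of _ \<rho>] exI[of _ "?V \<union> ?N"]) simp
qed

text \<open>\<open>Sup P\<close> is the lower limit. If \<open>\<phi>\<close> exceeded it noticeably
  at arbitrarily small arguments, two rationals just above it would be separating. The lower bound 1
  makes these rationals positive.\<close>

lemma tendsto_of_not_separated:
  fixes \<phi> :: "real \<Rightarrow> real"
  assumes bnd: "\<And>t. t \<noteq> 0 \<Longrightarrow> 1 \<le> \<phi> t \<and> \<phi> t \<le> B"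
    and sep: "\<And>a b. a \<in> \<rat> \<Longrightarrow> b \<in> \<rat> \<Longrightarrow> 0 < a \<Longrightarrow> a < b \<Longrightarrow>
      \<not> ((\<forall>e>0. \<exists>t. t \<noteq> 0 \<and> \<bar>t\<bar> < e \<and> \<phi> t < a) \<and> (\<forall>e>0. \<exists>t. t \<noteq> 0 \<and> \<bar>t\<bar> < e \<and> \<phi> t > b))"
  shows "\<exists>l. (\<phi> \<longlongrightarrow> l) (at 0)"
proof -
  define P where "P = {a. \<exists>e>0. \<forall>t. t \<noteq> 0 \<and> \<bar>t\<bar> < e \<longrightarrow> a \<le> \<phi> t}"
  have P1: "1 \<in> P" unfolding P_def using bnd by (auto intro!: exI[of _ 1])
  have PB: "a \<le> B" if aP: "a \<in> P" for a
  proof -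
    obtain e where e: "e > 0" "\<And>t. t \<noteq> 0 \<Longrightarrow> \<bar>t\<bar> < e \<Longrightarrow> a \<le> \<phi> t" using aP by (auto simp: P_def)
    have "a \<le> \<phi> (e/2)" using e by (intro e(2)) auto
    then show ?thesis using bnd[of "e/2"] e(1) by linarith
  qed
  have bdd: "bdd_above P" using PB by (rule bdd_aboveI)
  define s where "s = Sup P"
  have s1: "1 \<le> s" unfolding s_def using P1 bdd by (rule cSup_upper)
  have "(\<phi> \<longlongrightarrow> s) (at 0)"
  proof (rule tendstoI)
    fix e :: real assume e: "e > 0"
    obtain a where a: "a \<in> P" "s - e < a" using less_cSupE[of "s - e" P] e P1 by (auto simp: s_def)
    obtain d1 where d1: "d1 > 0" "\<And>t. t \<noteq> 0 \<Longrightarrow> \<bar>t\<bar> < d1 \<Longrightarrow> a \<le> \<phi> t" using a by (auto simp: P_def)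
    obtain q1 where q1: "q1 \<in> \<rat>" "s < q1" "q1 < s + e" using Rats_dense_in_real[of s "s + e"] e by auto
    obtain q2 where q2: "q2 \<in> \<rat>" "q1 < q2" "q2 < s + e" using Rats_dense_in_real[of q1 "s + e"] q1 by auto
    have "q1 \<notin> P" using q1 cSup_upper[OF _ bdd] by (fastforce simp: s_def)
    then have "\<forall>e>0. \<exists>t. t \<noteq> 0 \<and> \<bar>t\<bar> < e \<and> \<phi> t < q1" by (auto simp: P_def not_le)
    then have "\<not> (\<forall>e>0. \<exists>t. t \<noteq> 0 \<and> \<bar>t\<bar> < e \<and> \<phi> t > q2)" using sep[of q1 q2] q1 q2 s1 by auto
    then obtain d2 where d2: "d2 > 0" "\<And>t. t \<noteq> 0 \<Longrightarrow> \<bar>t\<bar> < d2 \<Longrightarrow> \<phi> t \<le> q2" by (meson not_less)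
    show "\<forall>\<^sub>F x in at 0. dist (\<phi> x) s < e"
      unfolding eventually_at
    proof (intro exI[of _ "min d1 d2"] conjI ballI impI)
      fix t :: real assume "t \<noteq> 0 \<and> dist t 0 < min d1 d2"
      then show "dist (\<phi> t) s < e" using d1(2)[of t] d2(2)[of t] a q2 by (auto simp: dist_real_def)
    qed (use d1 d2 in auto)
  qed
  then show ?thesis ..
qed

text \<open>Adding \<open>(L + 1) * x\<close> makes the function increasing with difference
  quotients between 1 and \<open>2 * L + 1\<close>, so the monotone case applies; the exceptional
  set is a countable union over pairs of positive rationals.\<close>

lemma lipschitz_real_differentiable_ae:
  fixes h :: "real \<Rightarrow> real"
  assumes lip: "L-lipschitz_on UNIV h"
  shows "negligible {x. \<not> (\<exists>l. ((\<lambda>t. (h (x + t) - h x) / t) \<longlongrightarrow> l) (at 0))}"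
proof -
  define g where "g x = h x + (L + 1) * x" for x
  have hb: "\<bar>h x - h y\<bar> \<le> L * \<bar>x - y\<bar>" for x y
    using lipschitz_onD[OF lip, of x y] by (simp add: dist_real_def)
  have gq: "(g (x + t) - g x) / t = (h (x + t) - h x) / t + (L + 1)" if "t \<noteq> 0" for x t
    using that by (simp add: g_def field_simps)
  have hq: "\<bar>(h (x + t) - h x) / t\<bar> \<le> L" if "t \<noteq> 0" for x t
    using hb[of "x + t" x] that by (simp add: abs_divide divide_le_eq)
  have "mono g"
  proof (rule monoI)
    fix x y :: real assume "x \<le> y"
    then have "L * (y - x) + h y - h x \<ge> 0" using hb[of y x] by (auto simp: abs_if split: if_splits)
    then show "g x \<le> g y" using \<open>x \<le> y\<close> by (simp add: g_def algebra_simps)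
  qed
  have cont: "continuous_on UNIV g"
    unfolding g_def by (intro continuous_intros lipschitz_on_continuous_on[OF lip])
  let ?E = "\<lambda>a b. {x. (\<forall>e>0. \<exists>t. t \<noteq> 0 \<and> \<bar>t\<bar> < e \<and> (g (x + t) - g x) / t < a) \<and>
    (\<forall>e>0. \<exists>t. t \<noteq> 0 \<and> \<bar>t\<bar> < e \<and> (g (x + t) - g x) / t > b)}"
  define Q where "Q = {(a, b). a \<in> \<rat> \<and> b \<in> \<rat> \<and> 0 < a \<and> a < (b::real)}"
  have cQ: "countable Q"
    by (rule countable_subset[of _ "\<rat> \<times> \<rat>"]) (auto simp: Q_def intro!: countable_SIGMA countable_rat)
  have neg: "negligible (\<Union>q\<in>Q. ?E (fst q) (snd q))"
  proof (rule negligible_countable_Union)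
    fix X assume "X \<in> (\<lambda>q. ?E (fst q) (snd q)) ` Q"
    then obtain q where "q \<in> Q" "X = ?E (fst q) (snd q)" by auto
    then show "negligible X"
      using negligible_derivates_separated[OF \<open>mono g\<close> cont, of "fst q" "snd q"] by (auto simp: Q_def)
  qed (use cQ in auto)
  show ?thesis
  proof (rule negligible_subset[OF neg], rule subsetI, rule ccontr)
    fix x assume x: "x \<in> {x. \<not> (\<exists>l. ((\<lambda>t. (h (x + t) - h x) / t) \<longlongrightarrow> l) (at 0))}"
      and nx: "x \<notin> (\<Union>q\<in>Q. ?E (fst q) (snd q))"
    have "\<exists>l. ((\<lambda>t. (g (x + t) - g x) / t) \<longlongrightarrow> l) (at 0)"
    proof (rule tendsto_of_not_separated)
      fix t :: real assume t: "t \<noteq> 0"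
      show "1 \<le> (g (x + t) - g x) / t \<and> (g (x + t) - g x) / t \<le> 2 * L + 1"
        using hq[OF t, of x] unfolding gq[OF t] by linarith
    next
      fix a b :: real assume "a \<in> \<rat>" "b \<in> \<rat>" "0 < a" "a < b"
      then have "(a, b) \<in> Q" by (auto simp: Q_def)
      then show "\<not> ((\<forall>e>0. \<exists>t. t \<noteq> 0 \<and> \<bar>t\<bar> < e \<and> (g (x + t) - g x) / t < a) \<and>
        (\<forall>e>0. \<exists>t. t \<noteq> 0 \<and> \<bar>t\<bar> < e \<and> (g (x + t) - g x) / t > b))"
        using nx by (simp add: Q_def)
    qed
    then obtain l where "((\<lambda>t. (g (x + t) - g x) / t) \<longlongrightarrow> l) (at 0)" by blast
    then have "((\<lambda>t. (g (x + t) - g x) / t - (L + 1)) \<longlongrightarrow> l - (L + 1)) (at 0)"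
      by (intro tendsto_intros)
    moreover have "\<forall>\<^sub>F t in at 0. (g (x + t) - g x) / t - (L + 1) = (h (x + t) - h x) / t"
      using gq by (auto simp: eventually_at intro!: exI[of _ 1])
    ultimately have "((\<lambda>t. (h (x + t) - h x) / t) \<longlongrightarrow> l - (L + 1)) (at 0)"
      using tendsto_cong by fast
    then show False using x by blast
  qed
qed


section \<open>Differentiability in several variables\<close>

text \<open>Averaging over translates: the shifts of \<open>A\<close> by
  \<open>- t *\<^sub>R v\<close> all have the same volume, and by Fubini the integral of these
  volumes over t in [0,1] is an integral of lengths along lines, all of them 0. The space is never
  decomposed along \<open>v\<close>.\<close>

lemma negligible_of_negligible_lines:
  fixes A :: "'a::euclidean_space set"
  assumes A: "A \<in> sets borel" and lines: "\<And>x. negligible {t::real. x + t *\<^sub>R v \<in> A}"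
  shows "negligible A"
proof -
  let ?f = "\<lambda>(x::'a, t::real). indicator A (x + t *\<^sub>R v) * indicator {0..1} t :: ennreal"
  have m: "?f \<in> borel_measurable (lborel \<Otimes>\<^sub>M lborel)"
  proof -
    have "(\<lambda>z::'a \<times> real. fst z + snd z *\<^sub>R v) \<in> borel_measurable borel"
      by (intro borel_measurable_continuous_onI continuous_intros)
    then have "(\<lambda>z::'a \<times> real. fst z + snd z *\<^sub>R v) \<in> borel_measurable (lborel \<Otimes>\<^sub>M lborel)"
      by (simp add: lborel_prod)
    then have "(\<lambda>z. indicator A (fst z + snd z *\<^sub>R v) :: ennreal) \<in> borel_measurable (lborel \<Otimes>\<^sub>M (lborel :: real measure))"
      using A by (intro measurable_compose[OF _ borel_measurable_indicator]) auto
    moreover have "(\<lambda>z. indicator {0..1::real} (snd z) :: ennreal) \<in> borel_measurable ((lborel :: 'a measure) \<Otimes>\<^sub>M lborel)"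
      by measurable
    ultimately show ?thesis by (auto simp: split_beta')
  qed
  have inner: "(\<integral>\<^sup>+t. ?f (x, t) \<partial>lborel) = 0" for x
  proof -
    have "{t. x + t *\<^sub>R v \<in> A} \<in> sets lborel"
    proof -
      have "(\<lambda>t::real. x + t *\<^sub>R v) \<in> borel_measurable borel"
        by (intro borel_measurable_continuous_onI continuous_intros)
      then show ?thesis using A measurable_sets[of "\<lambda>t::real. x + t *\<^sub>R v" borel borel A] by (simp add: vimage_def)
    qed
    then have "{t. x + t *\<^sub>R v \<in> A} \<in> null_sets lborel"
      using lines[of x] by (simp add: negligible_iff_null_sets null_sets_completion_iff)
    then have "AE t in lborel. x + t *\<^sub>R v \<notin> A" by (rule AE_I'[where N="{t. x + t *\<^sub>R v \<in> A}"]) auto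
    then have "AE t in lborel. ?f (x, t) = 0" by eventually_elim (auto simp: indicator_def)
    then show ?thesis by (subst nn_integral_0_iff_AE) (use m in \<open>auto intro: measurable_Pair2\<close>)
  qed
  have "emeasure lborel A = (\<integral>\<^sup>+t. emeasure lborel A * indicator {0..1} t \<partial>(lborel :: real measure))"
    by (simp add: nn_integral_cmult_indicator)
  also have "\<dots> = (\<integral>\<^sup>+t. (\<integral>\<^sup>+x. ?f (x, t) \<partial>lborel) \<partial>lborel)"
  proof (intro nn_integral_cong)
    fix t :: real
    have "(\<integral>\<^sup>+x. ?f (x, t) \<partial>lborel) = (\<integral>\<^sup>+x. indicator A (t *\<^sub>R v + x) \<partial>lborel) * indicator {0..1} t"
      using A by (subst nn_integral_multc[symmetric])
        (auto simp: add.commute intro!: measurable_compose[OF _ borel_measurable_indicator])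
    also have "(\<integral>\<^sup>+x. indicator A (t *\<^sub>R v + x) \<partial>lborel) = (\<integral>\<^sup>+x. indicator A x \<partial>(distr lborel borel ((+) (t *\<^sub>R v))))"
      using A by (subst nn_integral_distr) auto
    also have "\<dots> = emeasure lborel A" using A by (simp add: lborel_distr_plus)
    finally show "emeasure lborel A * indicator {0..1} t = (\<integral>\<^sup>+x. ?f (x, t) \<partial>lborel)" by simp
  qed
  also have "\<dots> = (\<integral>\<^sup>+x. (\<integral>\<^sup>+t. ?f (x, t) \<partial>lborel) \<partial>lborel)"
    using lborel_pair.Fubini'[OF m] by simp
  also have "\<dots> = 0" using inner by simp
  finally have "A \<in> null_sets lborel" using A by auto
  then show ?thesis by (simp add: negligible_iff_null_sets null_sets_completionI)
qed

text \<open>Difference quotients satisfying the Cauchy criterion rather than converging: in this form the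
  set is visibly Borel.\<close>

definition dirdiff_set :: "('a::euclidean_space \<Rightarrow> real) \<Rightarrow> 'a \<Rightarrow> 'a set" where
  "dirdiff_set f b = (\<Inter>m. \<Union>q\<in>\<rat>. \<Union>k. {x. \<forall>t. \<bar>t\<bar> < 1 / real (Suc k) \<longrightarrow>
     \<bar>f (x + t *\<^sub>R b) - f x - t * q\<bar> \<le> \<bar>t\<bar> / real (Suc m)})"

lemma mem_dirdiff_set:
  "x \<in> dirdiff_set f b \<longleftrightarrow> (\<forall>m. \<exists>q\<in>\<rat>. \<exists>k. \<forall>t. \<bar>t\<bar> < 1 / real (Suc k) \<longrightarrow>
     \<bar>f (x + t *\<^sub>R b) - f x - t * q\<bar> \<le> \<bar>t\<bar> / real (Suc m))"
  by (simp add: dirdiff_set_def)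

text \<open>On each line in direction \<open>b\<close> the function is Lipschitz in one variable.
  Borel measurability, which the passage from lines to space needs, holds because for fixed slope,
  radius and tolerance the conditions over all \<open>t\<close> define a closed set.\<close>

lemma negligible_not_dirdiff:
  fixes f :: "'a::euclidean_space \<Rightarrow> real"
  assumes lip: "L-lipschitz_on UNIV f" and b: "norm b = 1"
  shows "negligible (- dirdiff_set f b)"
proof (rule negligible_of_negligible_lines)
  have cf: "continuous_on UNIV f" by (rule lipschitz_on_continuous_on[OF lip])
  have "closed {x. \<forall>t. \<bar>t\<bar> < c \<longrightarrow> \<bar>f (x + t *\<^sub>R b) - f x - t * q\<bar> \<le> \<bar>t\<bar> / d}" for c q d
  proof -
    have "{x. \<forall>t. \<bar>t\<bar> < c \<longrightarrow> \<bar>f (x + t *\<^sub>R b) - f x - t * q\<bar> \<le> \<bar>t\<bar> / d} =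
      (\<Inter>t\<in>{t. \<bar>t\<bar> < c}. {x. \<bar>f (x + t *\<^sub>R b) - f x - t * q\<bar> \<le> \<bar>t\<bar> / d})" by auto
    moreover have "closed {x. \<bar>f (x + t *\<^sub>R b) - f x - t * q\<bar> \<le> \<bar>t\<bar> / d}" for t
      by (intro closed_Collect_le continuous_intros continuous_on_compose2[OF cf]) auto
    ultimately show ?thesis by (auto intro!: closed_INT)
  qed
  then have "(\<Union>k. {x. \<forall>t. \<bar>t\<bar> < 1 / real (Suc k) \<longrightarrow>
     \<bar>f (x + t *\<^sub>R b) - f x - t * q\<bar> \<le> \<bar>t\<bar> / real (Suc m)}) \<in> sets borel" for q m
    by (intro sets.countable_UN) (auto intro: borel_closed)
  then have "(\<Union>q\<in>\<rat>. \<Union>k. {x. \<forall>t. \<bar>t\<bar> < 1 / real (Suc k) \<longrightarrow>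
     \<bar>f (x + t *\<^sub>R b) - f x - t * q\<bar> \<le> \<bar>t\<bar> / real (Suc m)}) \<in> sets borel" for m
    by (intro sets.countable_UN'[OF countable_rat]) blast
  then have "dirdiff_set f b \<in> sets borel"
    unfolding dirdiff_set_def by (intro sets.countable_INT) blast+
  then show "- dirdiff_set f b \<in> sets borel" by (rule borel_comp)
next
  fix x
  define h where "h t = f (x + t *\<^sub>R b)" for t
  have "L-lipschitz_on UNIV h"
  proof (rule lipschitz_onI)
    fix s t :: real
    have "dist (h s) (h t) \<le> L * dist (x + s *\<^sub>R b) (x + t *\<^sub>R b)"
      unfolding h_def by (intro lipschitz_onD[OF lip]) auto
    also have "dist (x + s *\<^sub>R b) (x + t *\<^sub>R b) = dist s t"
      using b by (simp add: dist_norm scaleR_left_diff_distrib[symmetric] del: scaleR_left_diff_distrib)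
    finally show "dist (h s) (h t) \<le> L * dist s t" .
  qed (use lip lipschitz_on_nonneg in blast)
  then have neg: "negligible {s. \<not> (\<exists>l. ((\<lambda>t. (h (s + t) - h s) / t) \<longlongrightarrow> l) (at 0))}"
    by (rule lipschitz_real_differentiable_ae)
  show "negligible {s. x + s *\<^sub>R b \<in> - dirdiff_set f b}"
  proof (rule negligible_subset[OF neg], rule subsetI, rule ccontr)
    fix s assume s: "s \<in> {s. x + s *\<^sub>R b \<in> - dirdiff_set f b}"
      and "s \<notin> {s. \<not> (\<exists>l. ((\<lambda>t. (h (s + t) - h s) / t) \<longlongrightarrow> l) (at 0))}"
    then obtain l where l: "((\<lambda>t. (h (s + t) - h s) / t) \<longlongrightarrow> l) (at 0)" by blast
    have "\<exists>q\<in>\<rat>. \<exists>k. \<forall>t. \<bar>t\<bar> < 1 / real (Suc k) \<longrightarrow>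
      \<bar>f ((x + s *\<^sub>R b) + t *\<^sub>R b) - f (x + s *\<^sub>R b) - t * q\<bar> \<le> \<bar>t\<bar> / real (Suc m)" for m
    proof -
      \<comment> \<open>Half of the tolerance pays for the convergence of the quotients, half for
        replacing \<open>l\<close> by a rational.\<close>
      define e where "e = 1 / (2 * real (Suc m))"
      have e: "e > 0" "2 * e = 1 / real (Suc m)" by (auto simp: e_def field_simps)
      obtain q where q: "q \<in> \<rat>" "l < q" "q < l + e" using Rats_dense_in_real[of l "l + e"] e by auto
      obtain d where d: "d > 0" "\<And>t. t \<noteq> 0 \<Longrightarrow> \<bar>t\<bar> < d \<Longrightarrow> \<bar>(h (s + t) - h s) / t - l\<bar> < e"
        using tendstoD[OF l e(1)] by (auto simp: eventually_at dist_real_def)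
      obtain k where k: "1 / real (Suc k) < d" using d(1) nat_approx_posE by blast
      have "\<bar>f ((x + s *\<^sub>R b) + t *\<^sub>R b) - f (x + s *\<^sub>R b) - t * q\<bar> \<le> \<bar>t\<bar> / real (Suc m)"
        if t: "\<bar>t\<bar> < 1 / real (Suc k)" for t
      proof (cases "t = 0")
        case False
        have "\<bar>(h (s + t) - h s) / t - l\<bar> < e" using d(2)[OF False] t k by auto
        then have "\<bar>(h (s + t) - h s) / t - q\<bar> \<le> 2 * e" using q by (auto simp: abs_if split: if_splits)
        then have "\<bar>t\<bar> * \<bar>(h (s + t) - h s) / t - q\<bar> \<le> \<bar>t\<bar> * (2 * e)" by (intro mult_left_mono) auto
        also have "\<bar>t\<bar> * \<bar>(h (s + t) - h s) / t - q\<bar> = \<bar>t * ((h (s + t) - h s) / t - q)\<bar>"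
          by (simp only: abs_mult)
        also have "t * (D / t - q) = D - t * q" for D using False by (simp add: field_simps)
        finally show ?thesis using e(2) by (simp add: h_def scaleR_add_left add.assoc)
      qed auto
      then show ?thesis using q(1) by blast
    qed
    then have "x + s *\<^sub>R b \<in> dirdiff_set f b"
      unfolding mem_dirdiff_set by blast
    then show False using s by simp
  qed
qed

text \<open>The hole of radius \<open>c * r\<close> lies in the ball of radius \<open>2 * r\<close>
  about \<open>x\<close>, because \<open>c \<le> 1\<close>, and occupies the fraction
  \<open>(c / 2) ^ DIM('a)\<close> of it. Hence the outer density stays below 1.\<close>

lemma negligible_porous:
  fixes S :: "'a::euclidean_space set"
  assumes c: "0 < c" "c \<le> 1"
  shows "negligible {x\<in>S. \<forall>e>0. \<exists>z r. 0 < r \<and> r < e \<and> dist x z \<le> r \<and> ball z (c * r) \<inter> S = {}}"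
    (is "negligible ?P")
proof (rule negligible_of_density_less_one)
  let ?\<theta> = "1 - (c / 2) ^ DIM('a)"
  have "(c / 2) ^ DIM('a) \<le> 1" using c by (intro power_le_one) auto
  moreover have "(c / 2) ^ DIM('a) > 0" using c by simp
  ultimately show "0 \<le> ?\<theta>" "?\<theta> < 1" by auto
  fix x and e :: real assume x: "x \<in> ?P" and "0 < e"
  then have "0 < e/2" by simp
  then obtain z r where zr: "0 < r" "r < e/2" "dist x z \<le> r" "ball z (c * r) \<inter> S = {}" using x by blast
  let ?U = "cball x (2 * r) - ball z (c * r)"
  have cr: "c * r \<le> r" using c zr by simp
  have sub: "ball z (c * r) \<subseteq> cball x (2 * r)"
  proof
    fix y assume "y \<in> ball z (c * r)"
    then show "y \<in> cball x (2 * r)"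
      using dist_triangle[of x y z] zr cr unfolding mem_ball mem_cball by linarith
  qed
  have "measure lebesgue ?U = measure lebesgue (cball x (2 * r)) - measure lebesgue (ball z (c * r))"
    using sub by (intro measurable_measure_Diff) auto
  also have "measure lebesgue (ball z (c * r)) = (c / 2) ^ DIM('a) * measure lebesgue (cball x (2 * r))"
    using c zr content_ball_conv_unit_ball[of "c * r" z] content_ball_conv_unit_ball[of "2 * r" x]
    by (simp add: content_cball_conv_ball power_mult_distrib power_divide)
  finally have "measure lebesgue ?U \<le> ?\<theta> * measure lebesgue (cball x (2 * r))" by (simp add: algebra_simps)
  moreover have "?P \<inter> cball x (2 * r) \<subseteq> ?U" using zr(4) by auto
  moreover have "?U \<in> lmeasurable" by (intro fmeasurable.Diff) auto
  ultimately show "\<exists>a r U. 0 < r \<and> r < e \<and> x \<in> cball a r \<and> ?P \<inter> cball a r \<subseteq> U \<and> U \<in> lmeasurable \<and>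
      measure lebesgue U \<le> ?\<theta> * measure lebesgue (cball a r)"
    using zr by (intro exI[of _ x] exI[of _ "2 * r"] exI[of _ ?U] conjI) auto
qed


text \<open>The approximating gradient may change with the tolerance. Two of them compete on a
  common ball, so they differ by at most the sum of their tolerances; they form a Cauchy sequence,
  whose limit is the gradient.\<close>

lemma differentiable_of_approx:
  fixes f :: "'a::euclidean_space \<Rightarrow> real"
  assumes approx: "\<And>e. e > 0 \<Longrightarrow> \<exists>q. \<exists>d>0. \<forall>h. norm h < d \<longrightarrow> \<bar>f (x + h) - f x - h \<bullet> q\<bar> \<le> e * norm h"
  shows "f differentiable (at x)"
proof -
  have "\<forall>m. \<exists>q. \<exists>d>0. \<forall>h. norm h < d \<longrightarrow> \<bar>f (x + h) - f x - h \<bullet> q\<bar> \<le> 1 / real (Suc m) * norm h"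
    by (intro allI approx) simp
  then obtain v where v: "\<And>m. \<exists>d>0. \<forall>h. norm h < d \<longrightarrow> \<bar>f (x + h) - f x - h \<bullet> v m\<bar> \<le> 1 / real (Suc m) * norm h"
    by metis
  have diff: "norm (v m - v n) \<le> 1 / real (Suc m) + 1 / real (Suc n)" for m n
  proof (cases "v m = v n")
    case False
    define w where "w = v m - v n"
    have w: "norm w > 0" using False by (simp add: w_def)
    obtain d1 where d1: "d1 > 0" "\<And>h. norm h < d1 \<Longrightarrow> \<bar>f (x + h) - f x - h \<bullet> v m\<bar> \<le> 1 / real (Suc m) * norm h"
      using v[of m] by blast
    obtain d2 where d2: "d2 > 0" "\<And>h. norm h < d2 \<Longrightarrow> \<bar>f (x + h) - f x - h \<bullet> v n\<bar> \<le> 1 / real (Suc n) * norm h"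
      using v[of n] by blast
    \<comment> \<open>The test vector points along the difference of the two gradients and is short
      enough for both approximations.\<close>
    define t where "t = min d1 d2 / (2 * norm w)"
    have t: "t > 0" using d1 d2 w by (simp add: t_def)
    have nh: "norm (t *\<^sub>R w) = t * norm w" using t by simp
    have "t * norm w < d1" "t * norm w < d2" using d1 d2 w by (auto simp: t_def)
    then have "\<bar>(t *\<^sub>R w) \<bullet> v m - (t *\<^sub>R w) \<bullet> v n\<bar> \<le> 1 / real (Suc m) * norm (t *\<^sub>R w) + 1 / real (Suc n) * norm (t *\<^sub>R w)"
      using d1(2)[of "t *\<^sub>R w"] d2(2)[of "t *\<^sub>R w"] unfolding nh by linarith
    also have "\<dots> = (t * norm w) * (1 / real (Suc m) + 1 / real (Suc n))" unfolding nh by (simp add: algebra_simps)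
    also have "(t *\<^sub>R w) \<bullet> v m - (t *\<^sub>R w) \<bullet> v n = t * (w \<bullet> w)" by (simp add: w_def inner_diff_right right_diff_distrib)
    also have "\<bar>t * (w \<bullet> w)\<bar> = (t * norm w) * norm w"
      using t by (simp add: abs_mult dot_square_norm power2_eq_square)
    finally show ?thesis using t w by (simp add: w_def)
  qed simp
  have "Cauchy v"
  proof (rule metric_CauchyI)
    fix e :: real assume e: "e > 0"
    obtain N where N: "1 / real (Suc N) < e / 2" using e nat_approx_posE half_gt_zero by blast
    have "dist (v m) (v n) < e" if mn: "m \<ge> N" "n \<ge> N" for m n
    proof -
      have "1 / real (Suc m) \<le> 1 / real (Suc N)" "1 / real (Suc n) \<le> 1 / real (Suc N)"
        using mn by (auto intro!: divide_left_mono)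
      then show ?thesis using diff[of m n] N unfolding dist_norm by linarith
    qed
    then show "\<exists>M. \<forall>m\<ge>M. \<forall>n\<ge>M. dist (v m) (v n) < e" by blast
  qed
  then obtain q where q: "v \<longlonglongrightarrow> q" using Cauchy_convergent convergentD by blast
  have "(f has_derivative (\<lambda>h. h \<bullet> q)) (at x)"
    unfolding has_derivative_at_alt
  proof (intro conjI allI impI bounded_linear_inner_left)
    fix e :: real assume e: "e > 0"
    obtain N where N: "1 / real (Suc N) < e / 2" using e nat_approx_posE half_gt_zero by blast
    obtain N' where N': "\<And>n. n \<ge> N' \<Longrightarrow> norm (v n - q) < e / 2" using LIMSEQ_D[OF q, of "e/2"] e by auto
    define m where "m = max N N'"
    have "1 / real (Suc m) \<le> 1 / real (Suc N)" by (auto simp: m_def intro!: divide_left_mono)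
    then have m: "1 / real (Suc m) \<le> e / 2" "norm (v m - q) \<le> e / 2" using N N'[of m] by (auto simp: m_def)
    obtain d where d: "d > 0" "\<And>h. norm h < d \<Longrightarrow> \<bar>f (x + h) - f x - h \<bullet> v m\<bar> \<le> 1 / real (Suc m) * norm h"
      using v[of m] by blast
    have "norm (f y - f x - (y - x) \<bullet> q) \<le> e * norm (y - x)" if y: "norm (y - x) < d" for y
    proof -
      have "\<bar>f y - f x - (y - x) \<bullet> v m\<bar> \<le> 1 / real (Suc m) * norm (y - x)" using d(2)[OF y] by simp
      also have "\<dots> \<le> e / 2 * norm (y - x)" using m by (intro mult_right_mono) auto
      finally have 1: "\<bar>f y - f x - (y - x) \<bullet> v m\<bar> \<le> e / 2 * norm (y - x)" .
      have "\<bar>(y - x) \<bullet> (v m - q)\<bar> \<le> norm (y - x) * norm (v m - q)" by (rule Cauchy_Schwarz_ineq2)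
      also have "\<dots> \<le> norm (y - x) * (e / 2)" using m by (intro mult_left_mono) auto
      finally have 2: "\<bar>(y - x) \<bullet> v m - (y - x) \<bullet> q\<bar> \<le> e / 2 * norm (y - x)"
        by (simp add: inner_diff_right mult.commute)
      have "e * norm (y - x) = e / 2 * norm (y - x) + e / 2 * norm (y - x)" by simp
      then show ?thesis using 1 2 unfolding real_norm_def by linarith
    qed
    then show "\<exists>d>0. \<forall>y. norm (y - x) < d \<longrightarrow> norm (f y - f x - (y - x) \<bullet> q) \<le> e * norm (y - x)"
      using d(1) by blast
  qed
  then show ?thesis unfolding differentiable_def by blast
qed

text \<open>Partial differentiability upgrades to total differentiability wherever the level sets of
  approximate partial derivatives are not porous: one walks from \<open>x\<close> to \<open>x + h\<close> along the coordinate
  axes, replacing each corner by a nearby point of the level set.\<close>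

lemma approx_of_not_porous:
  fixes f :: "'a::euclidean_space \<Rightarrow> real" and q :: "'a \<Rightarrow> real"
  assumes lip: "L-lipschitz_on UNIV f" and \<epsilon>: "\<epsilon> \<ge> 0"
    and S: "\<And>x b t. x \<in> S \<Longrightarrow> b \<in> Basis \<Longrightarrow> \<bar>t\<bar> < \<delta> \<Longrightarrow> \<bar>f (x + t *\<^sub>R b) - f x - t * q b\<bar> \<le> \<epsilon> * \<bar>t\<bar>"
    and np: "\<And>z r. 0 < r \<Longrightarrow> r < e \<Longrightarrow> dist x z \<le> r \<Longrightarrow> ball z (\<epsilon> * r) \<inter> S \<noteq> {}"
    and h: "norm h < \<delta>" "norm h < e"
  shows "\<bar>f (x + h) - f x - (\<Sum>b\<in>Basis. (h \<bullet> b) * q b)\<bar> \<le> DIM('a) * (\<epsilon> * (1 + 2 * L) * norm h)"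
proof (cases "h = 0")
  case False
  have L0: "L \<ge> 0" using lip lipschitz_on_nonneg by blast
  have "\<bar>f (x + (\<Sum>b\<in>B. (h \<bullet> b) *\<^sub>R b)) - f x - (\<Sum>b\<in>B. (h \<bullet> b) * q b)\<bar> \<le> card B * (\<epsilon> * (1 + 2 * L) * norm h)"
    if "finite B" "B \<subseteq> Basis" for B
    using that
  proof (induction B)
    case (insert b B)
    define z where "z = x + (\<Sum>b\<in>B. (h \<bullet> b) *\<^sub>R b)"
    have bB: "b \<in> Basis" "B \<subseteq> Basis" using insert by auto
    have "norm (\<Sum>b\<in>B. (h \<bullet> b) *\<^sub>R b) \<le> norm h"
    proof (rule norm_le_componentwise)
      fix c :: 'a assume c: "c \<in> Basis"
      have "(\<Sum>b\<in>B. (h \<bullet> b) *\<^sub>R b) \<bullet> c = (\<Sum>b\<in>B. if b = c then h \<bullet> c else 0)"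
        unfolding inner_sum_left using bB c by (intro sum.cong) (auto simp: inner_Basis subset_eq)
      also have "\<dots> = (if c \<in> B then h \<bullet> c else 0)" using insert(1) by simp
      finally show "\<bar>(\<Sum>b\<in>B. (h \<bullet> b) *\<^sub>R b) \<bullet> c\<bar> \<le> \<bar>h \<bullet> c\<bar>" by simp
    qed
    then have "dist x z \<le> norm h" by (simp add: z_def dist_norm)
    \<comment> \<open>Non-porosity at scale \<open>norm h\<close> supplies a point of
      \<open>S\<close> close to the corner \<open>z\<close>.\<close>
    then obtain y where y: "y \<in> S" "dist z y < \<epsilon> * norm h"
      using np[of "norm h" z] h False by fastforce
    have hb: "\<bar>h \<bullet> b\<bar> \<le> norm h" using Basis_le_norm bB by blast
    have 1: "\<bar>f (y + (h \<bullet> b) *\<^sub>R b) - f y - (h \<bullet> b) * q b\<bar> \<le> \<epsilon> * norm h"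
      using S[OF y(1) bB(1), of "h \<bullet> b"] hb h mult_left_mono[OF hb \<epsilon>] by linarith
    have le: "L * dist z y \<le> L * (\<epsilon> * norm h)" using y L0 by (intro mult_left_mono) auto
    have 2: "\<bar>f z - f y\<bar> \<le> L * (\<epsilon> * norm h)"
      using lipschitz_onD[OF lip, of z y] le unfolding dist_real_def by simp
    have "dist (z + (h \<bullet> b) *\<^sub>R b) (y + (h \<bullet> b) *\<^sub>R b) = dist z y" by simp
    then have 3: "\<bar>f (z + (h \<bullet> b) *\<^sub>R b) - f (y + (h \<bullet> b) *\<^sub>R b)\<bar> \<le> L * (\<epsilon> * norm h)"
      using lipschitz_onD[OF lip, of "z + (h \<bullet> b) *\<^sub>R b" "y + (h \<bullet> b) *\<^sub>R b"] le unfolding dist_real_def by simp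
    have IH: "\<bar>f z - f x - (\<Sum>b\<in>B. (h \<bullet> b) * q b)\<bar> \<le> card B * (\<epsilon> * (1 + 2 * L) * norm h)"
      using insert bB by (simp add: z_def)
    have zz: "x + (\<Sum>b\<in>insert b B. (h \<bullet> b) *\<^sub>R b) = z + (h \<bullet> b) *\<^sub>R b"
      using insert by (simp add: z_def)
    have qq: "(\<Sum>b\<in>insert b B. (h \<bullet> b) * q b) = (h \<bullet> b) * q b + (\<Sum>b\<in>B. (h \<bullet> b) * q b)" using insert by simp
    \<comment> \<open>Each coordinate costs the increment error at \<open>y\<close> and two
      Lipschitz errors, one between \<open>z\<close> and \<open>y\<close>, one between their
      translates.\<close>
    have cc: "real (card (insert b B)) * (\<epsilon> * (1 + 2 * L) * norm h) =
      card B * (\<epsilon> * (1 + 2 * L) * norm h) + (\<epsilon> * norm h + 2 * (L * (\<epsilon> * norm h)))"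
      using insert by (simp add: algebra_simps)
    show ?case unfolding zz qq cc using 1 2 3 IH by linarith
  qed simp
  from this[of Basis] show ?thesis by (simp add: euclidean_representation)
qed simp

text \<open>Off a countable union of null sets, the partial difference quotients converge and no
  level set \<open>S q k m\<close> is porous at those of its points. Rational slopes and reciprocal
  radii and tolerances keep the union countable.\<close>

theorem rademacher_real:
  fixes f :: "'a::euclidean_space \<Rightarrow> real"
  assumes lip: "L-lipschitz_on UNIV f"
  shows "negligible {x. \<not> f differentiable (at x)}"
proof -
  have L0: "L \<ge> 0" using lip lipschitz_on_nonneg by blast
  define S where "S q k m = {x. \<forall>b\<in>Basis. \<forall>t. \<bar>t\<bar> < 1 / real (Suc k) \<longrightarrow>
     \<bar>f (x + t *\<^sub>R b) - f x - t * q b\<bar> \<le> 1 / real (Suc m) * \<bar>t\<bar>}" for q :: "'a \<Rightarrow> real" and k m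
  define P where "P q k m = {x\<in>S q k m. \<forall>e>0. \<exists>z r. 0 < r \<and> r < e \<and> dist x z \<le> r \<and>
     ball z (1 / real (Suc m) * r) \<inter> S q k m = {}}" for q k m
  \<comment> \<open>Slope functions are extensional on \<open>Basis\<close>; with arbitrary values
    elsewhere they would be uncountably many.\<close>
  let ?I = "(Basis \<rightarrow>\<^sub>E (\<rat> :: real set)) \<times> (UNIV :: nat set) \<times> (UNIV :: nat set)"
  let ?N = "(\<Union>b\<in>Basis. - dirdiff_set f b) \<union> (\<Union>(q, k, m)\<in>?I. P q k m)"
  have cI: "countable ?I" by (intro countable_SIGMA countable_PiE countable_rat) auto
  have "negligible (P q k m)" for q k m
    unfolding P_def by (rule negligible_porous) (auto simp: field_simps)
  then have "negligible (\<Union>(q, k, m)\<in>?I. P q k m)"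
    using cI by (intro negligible_countable_Union) auto
  moreover have "negligible (\<Union>b\<in>Basis. - dirdiff_set f b)"
    using negligible_not_dirdiff[OF lip] by (intro negligible_Union) auto
  ultimately have N: "negligible ?N" by (rule negligible_Un[rotated])
  show ?thesis
  proof (rule negligible_subset[OF N], rule subsetI, rule ccontr)
    fix x assume nd: "x \<in> {x. \<not> f differentiable (at x)}" and x: "x \<notin> ?N"
    have "\<exists>q. \<exists>d>0. \<forall>h. norm h < d \<longrightarrow> \<bar>f (x + h) - f x - h \<bullet> q\<bar> \<le> e * norm h" if e: "e > 0" for e
    proof -
      have "e / (DIM('a) * (1 + 2 * L)) > 0" using e L0 by (intro divide_pos_pos mult_pos_pos) auto
      then obtain m where m: "1 / real (Suc m) < e / (DIM('a) * (1 + 2 * L))" using nat_approx_posE by blast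
      have "\<forall>b\<in>Basis. \<exists>q\<in>\<rat>. \<exists>k. \<forall>t. \<bar>t\<bar> < 1 / real (Suc k) \<longrightarrow>
          \<bar>f (x + t *\<^sub>R b) - f x - t * q\<bar> \<le> \<bar>t\<bar> / real (Suc m)"
      proof
        fix b :: 'a assume "b \<in> Basis"
        then have "x \<in> dirdiff_set f b" using x by blast
        then show "\<exists>q\<in>\<rat>. \<exists>k. \<forall>t. \<bar>t\<bar> < 1 / real (Suc k) \<longrightarrow>
          \<bar>f (x + t *\<^sub>R b) - f x - t * q\<bar> \<le> \<bar>t\<bar> / real (Suc m)" unfolding mem_dirdiff_set by blast
      qed
      then obtain q k where qk: "\<And>b. b \<in> Basis \<Longrightarrow> q b \<in> \<rat>"
        "\<And>b t. b \<in> Basis \<Longrightarrow> \<bar>t\<bar> < 1 / real (Suc (k b)) \<Longrightarrow> \<bar>f (x + t *\<^sub>R b) - f x - t * q b\<bar> \<le> \<bar>t\<bar> / real (Suc m)"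
        by metis
      define q' where "q' = restrict q Basis"
      \<comment> \<open>Each direction comes with its own \<open>k b\<close>; the largest one gives
        a radius valid for all.\<close>
      define K where "K = Max (k ` Basis)"
      have "x \<in> S q' K m"
        unfolding S_def
      proof (intro CollectI ballI allI impI)
        fix b :: 'a and t assume b: "b \<in> Basis" and t: "\<bar>t\<bar> < 1 / real (Suc K)"
        have "k b \<le> K" unfolding K_def using b by (intro Max_ge) auto
        then have "1 / real (Suc K) \<le> 1 / real (Suc (k b))" by (intro divide_left_mono) auto
        then show "\<bar>f (x + t *\<^sub>R b) - f x - t * q' b\<bar> \<le> 1 / real (Suc m) * \<bar>t\<bar>"
          using qk(2)[OF b, of t] t b by (simp add: q'_def)
      qed
      moreover have "(q', K, m) \<in> ?I" using qk(1) by (auto simp: q'_def)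
      then have "x \<notin> P q' K m" using x by blast
      ultimately obtain d where d: "d > 0"
        "\<And>z r. 0 < r \<Longrightarrow> r < d \<Longrightarrow> dist x z \<le> r \<Longrightarrow> ball z (1 / real (Suc m) * r) \<inter> S q' K m \<noteq> {}"
        unfolding P_def by blast
      define v where "v = (\<Sum>b\<in>Basis. q' b *\<^sub>R b)"
      have "\<bar>f (x + h) - f x - h \<bullet> v\<bar> \<le> e * norm h" if h: "norm h < min d (1 / real (Suc K))" for h
      proof -
        have "\<bar>f (x + h) - f x - (\<Sum>b\<in>Basis. (h \<bullet> b) * q' b)\<bar> \<le> DIM('a) * (1 / real (Suc m) * (1 + 2 * L) * norm h)"
        proof (rule approx_of_not_porous[OF lip, where S="S q' K m" and \<delta>="1 / real (Suc K)" and e=d])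
          show "ball z (1 / real (Suc m) * r) \<inter> S q' K m \<noteq> {}" if "0 < r" "r < d" "dist x z \<le> r" for z r
            using d(2) that by blast
        qed (use h in \<open>auto simp: S_def\<close>)
        also have "\<dots> = (1 / real (Suc m)) * (DIM('a) * (1 + 2 * L)) * norm h" by (simp add: algebra_simps)
        also have "\<dots> \<le> e * norm h"
        proof (intro mult_right_mono)
          show "(1 / real (Suc m)) * (DIM('a) * (1 + 2 * L)) \<le> e"
            using m L0 by (subst (asm) pos_less_divide_eq) (auto intro!: mult_pos_pos)
        qed simp
        finally show ?thesis by (simp add: v_def inner_sum_right mult.commute)
      qed
      then show ?thesis using d(1) by (intro exI[of _ v] exI[of _ "min d (1 / real (Suc K))"]) auto
    qed
    then have "f differentiable (at x)" by (rule differentiable_of_approx)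
    then show False using nd by simp
  qed
qed

section \<open>Lipschitz extension and vector-valued maps\<close>

text \<open>McShane's formula, an infimum of cones \<open>f a + L * dist x a\<close>. Each cone is
  \<open>L\<close>-Lipschitz, and at a point of \<open>S\<close> the cone based there is the
  lowest.\<close>

lemma lipschitz_extension_real:
  fixes f :: "'a::metric_space \<Rightarrow> real"
  assumes lip: "L-lipschitz_on S f"
  obtains g where "L-lipschitz_on UNIV g" "\<And>x. x \<in> S \<Longrightarrow> g x = f x"
proof (cases "S = {}")
  case True
  then show ?thesis using that[of "\<lambda>_. 0"] lip lipschitz_on_nonneg
    by (metis empty_iff lipschitz_on_constant lipschitz_on_mono subset_UNIV order_refl)
next
  case False
  have L0: "L \<ge> 0" using lip lipschitz_on_nonneg by blast
  define g where "g x = (INF a\<in>S. f a + L * dist x a)" for x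
  have lo: "f b - L * dist x b \<le> f a + L * dist x a" if "a \<in> S" "b \<in> S" for a b x
  proof -
    have "f b - f a \<le> L * dist b a" using lipschitz_onD[OF lip, of b a] that by (auto simp: dist_real_def)
    also have "\<dots> \<le> L * (dist x b + dist x a)" using L0 dist_triangle3[of b a x] by (intro mult_left_mono) auto
    finally show ?thesis by (simp add: algebra_simps)
  qed
  obtain b where b: "b \<in> S" using False by blast
  have bdd: "bdd_below ((\<lambda>a. f a + L * dist x a) ` S)" for x
    using lo[OF _ b] by (rule bdd_belowI2)
  show ?thesis
  proof (rule that[of g])
    fix x assume x: "x \<in> S"
    have "g x \<le> f x + L * dist x x" unfolding g_def using x bdd by (intro cINF_lower)
    moreover have "f x \<le> g x"
      unfolding g_def using False lo[OF _ x, of _ x] by (intro cINF_greatest) auto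
    ultimately show "g x = f x" by simp
  next
    have le: "g x \<le> g y + L * dist x y" for x y
    proof -
      have "g x - L * dist x y \<le> g y"
        unfolding g_def[of y]
      proof (intro cINF_greatest False)
        fix a assume a: "a \<in> S"
        have "g x \<le> f a + L * dist x a" unfolding g_def using a bdd by (intro cINF_lower)
        moreover have "L * dist x a \<le> L * (dist x y + dist y a)"
          using L0 dist_triangle by (intro mult_left_mono) auto
        ultimately show "g x - L * dist x y \<le> f a + L * dist y a" by (simp add: algebra_simps)
      qed
      then show ?thesis by simp
    qed
    show "L-lipschitz_on UNIV g"
    proof (rule lipschitz_onI)
      fix x y
      show "dist (g x) (g y) \<le> L * dist x y"
        using le[of x y] le[of y x] by (auto simp: dist_real_def dist_commute abs_if)
    qed (rule L0)
  qed
qed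

text \<open>Components are extended one by one, since the scalar theorem concerns functions on the
  whole space; openness of \<open>S\<close> returns differentiability from the extensions to
  \<open>f\<close>.\<close>

theorem rademacher:
  fixes f :: "'a::euclidean_space \<Rightarrow> 'b::euclidean_space"
  assumes "open S" and lip: "L-lipschitz_on S f"
  shows "negligible {x\<in>S. \<not> f differentiable (at x)}"
proof -
  have "\<exists>g. L-lipschitz_on UNIV g \<and> (\<forall>x\<in>S. g x = f x \<bullet> b)" if b: "b \<in> Basis" for b
  proof -
    have "L-lipschitz_on S (\<lambda>x. f x \<bullet> b)"
    proof (rule lipschitz_onI)
      fix x y assume xy: "x \<in> S" "y \<in> S"
      have "dist (f x \<bullet> b) (f y \<bullet> b) \<le> dist (f x) (f y)"
        using Basis_le_norm[OF b, of "f x - f y"] by (simp add: dist_norm inner_diff_left)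
      also have "\<dots> \<le> L * dist x y" using lipschitz_onD[OF lip] xy by blast
      finally show "dist (f x \<bullet> b) (f y \<bullet> b) \<le> L * dist x y" .
    qed (use lip lipschitz_on_nonneg in blast)
    then show ?thesis by (rule lipschitz_extension_real) blast
  qed
  then obtain g where g: "\<And>b. b \<in> Basis \<Longrightarrow> L-lipschitz_on UNIV (g b)"
    "\<And>b x. b \<in> Basis \<Longrightarrow> x \<in> S \<Longrightarrow> g b x = f x \<bullet> b" by metis
  have "negligible (\<Union>b\<in>Basis. {x. \<not> g b differentiable (at x)})"
    using rademacher_real[OF g(1)] by (intro negligible_Union) auto
  moreover have "{x\<in>S. \<not> f differentiable (at x)} \<subseteq> (\<Union>b\<in>Basis. {x. \<not> g b differentiable (at x)})"
  proof (rule subsetI, rule ccontr)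
    fix x assume x: "x \<in> {x\<in>S. \<not> f differentiable (at x)}"
      and nx: "x \<notin> (\<Union>b\<in>Basis. {x. \<not> g b differentiable (at x)})"
    have "(\<lambda>y. f y \<bullet> b) differentiable (at x)" if b: "b \<in> Basis" for b
    proof -
      have "g b differentiable (at x)" using nx b by blast
      then obtain D where "(g b has_derivative D) (at x)" unfolding differentiable_def by blast
      then have "((\<lambda>y. f y \<bullet> b) has_derivative D) (at x)"
        by (rule has_derivative_transform_within_open[OF _ \<open>open S\<close>]) (use x b g(2) in auto)
      then show ?thesis unfolding differentiable_def by blast
    qed
    then have "f differentiable (at x)" by (subst differentiable_componentwise_within) auto
    then show False using x by simp
  qed
  ultimately show ?thesis by (rule negligible_subset)
qed

section \<open>Exterior powers and echelon bases\<close>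

text \<open>\<open>wedge\<close> for sequences instead of lists, so that vectors can be reindexed by
  permutations and choice functions without regard to list lengths.\<close>

definition wedge_fun :: "nat \<Rightarrow> (nat \<Rightarrow> 'a::euclidean_space) \<Rightarrow> (nat \<Rightarrow> 'a) \<Rightarrow> real" where
  "wedge_fun p v w = (\<Sum>\<sigma> | \<sigma> permutes {..<p}. of_int (sign \<sigma>) * (\<Prod>i<p. v (\<sigma> i) \<bullet> w i))"

lemma permutes_lessThan: "\<sigma> permutes {..<p} \<Longrightarrow> i < p \<Longrightarrow> \<sigma> i < (p::nat)"
  using permutes_in_image[of \<sigma> "{..<p}" i] by auto

lemma wedge_eq_wedge_fun: "wedge vs w = wedge_fun (length vs) ((!) vs) w"
  by (simp add: wedge_def wedge_fun_def)

lemma wedge_fun_cong: "(\<And>i. i < p \<Longrightarrow> v i = v' i) \<Longrightarrow> wedge_fun p v w = wedge_fun p v' w"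
  unfolding wedge_fun_def
  by (intro sum.cong refl arg_cong2[of _ _ _ _ "(*)"] prod.cong) (auto simp: permutes_lessThan)

text \<open>Multilinearity. The product is reindexed by the inverse permutation so that the choice
  \<open>J i\<close> belongs to the vector \<open>v i\<close>, whatever \<open>\<sigma>\<close> is;
  only then can the two sums be exchanged.\<close>

lemma wedge_fun_expand:
  assumes "finite K" "\<And>i. i < p \<Longrightarrow> v i = (\<Sum>k\<in>K. a i k *\<^sub>R Y k)"
  shows "wedge_fun p v w = (\<Sum>J\<in>{..<p} \<rightarrow>\<^sub>E K. (\<Prod>i<p. a i (J i)) * wedge_fun p (\<lambda>i. Y (J i)) w)"
proof -
  have eq: "(\<Prod>i<p. v (\<sigma> i) \<bullet> w i) = (\<Sum>J\<in>{..<p} \<rightarrow>\<^sub>E K. (\<Prod>i<p. a i (J i)) * (\<Prod>i<p. Y (J (\<sigma> i)) \<bullet> w i))"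
    if \<sigma>: "\<sigma> permutes {..<p}" for \<sigma>
  proof -
    have io: "inv \<sigma> (\<sigma> i) = i" for i using \<sigma> by (simp add: permutes_inverses)
    have "(\<Prod>i<p. v (\<sigma> i) \<bullet> w i) = (\<Prod>i<p. \<Sum>k\<in>K. a (\<sigma> i) k * (Y k \<bullet> w i))"
      using \<sigma> assms by (intro prod.cong) (auto simp: permutes_lessThan inner_sum_left)
    also have "\<dots> = (\<Prod>i<p. \<Sum>k\<in>K. a i k * (Y k \<bullet> w (inv \<sigma> i)))"
      using prod.permute[OF \<sigma>, of "\<lambda>i. \<Sum>k\<in>K. a i k * (Y k \<bullet> w (inv \<sigma> i))"] by (simp add: io)
    also have "\<dots> = (\<Sum>J\<in>{..<p} \<rightarrow>\<^sub>E K. \<Prod>i<p. a i (J i) * (Y (J i) \<bullet> w (inv \<sigma> i)))"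
      using assms by (intro prod_sum_PiE) auto
    also have "\<dots> = (\<Sum>J\<in>{..<p} \<rightarrow>\<^sub>E K. (\<Prod>i<p. a i (J i)) * (\<Prod>i<p. Y (J i) \<bullet> w (inv \<sigma> i)))"
      by (simp add: prod.distrib)
    also have "\<dots> = (\<Sum>J\<in>{..<p} \<rightarrow>\<^sub>E K. (\<Prod>i<p. a i (J i)) * (\<Prod>i<p. Y (J (\<sigma> i)) \<bullet> w i))"
      using prod.permute[OF \<sigma>, of "\<lambda>i. Y (J i) \<bullet> w (inv \<sigma> i)" for J] by (simp add: io)
    finally show ?thesis .
  qed
  have "wedge_fun p v w = (\<Sum>\<sigma> | \<sigma> permutes {..<p}. \<Sum>J\<in>{..<p} \<rightarrow>\<^sub>E K.
      (\<Prod>i<p. a i (J i)) * (of_int (sign \<sigma>) * (\<Prod>i<p. Y (J (\<sigma> i)) \<bullet> w i)))"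
    unfolding wedge_fun_def using eq by (intro sum.cong) (auto simp: sum_distrib_left mult_ac)
  also have "\<dots> = (\<Sum>J\<in>{..<p} \<rightarrow>\<^sub>E K. \<Sum>\<sigma> | \<sigma> permutes {..<p}.
      (\<Prod>i<p. a i (J i)) * (of_int (sign \<sigma>) * (\<Prod>i<p. Y (J (\<sigma> i)) \<bullet> w i)))"
    by (rule sum.swap)
  also have "\<dots> = (\<Sum>J\<in>{..<p} \<rightarrow>\<^sub>E K. (\<Prod>i<p. a i (J i)) * wedge_fun p (\<lambda>i. Y (J i)) w)"
    by (simp add: wedge_fun_def sum_distrib_left)
  finally show ?thesis .
qed

lemma wedge_fun_permute:
  assumes \<tau>: "\<tau> permutes {..<p}"
  shows "wedge_fun p (\<lambda>i. v (\<tau> i)) w = of_int (sign \<tau>) * wedge_fun p v w"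
proof -
  have "wedge_fun p v w = (\<Sum>\<sigma> | \<sigma> permutes {..<p}. of_int (sign (\<tau> \<circ> \<sigma>)) * (\<Prod>i<p. v ((\<tau> \<circ> \<sigma>) i) \<bullet> w i))"
    unfolding wedge_fun_def by (rule setum_permutations_compose_left[OF \<tau>])
  also have "\<dots> = (\<Sum>\<sigma> | \<sigma> permutes {..<p}. of_int (sign \<tau>) * (of_int (sign \<sigma>) * (\<Prod>i<p. v (\<tau> (\<sigma> i)) \<bullet> w i)))"
  proof (intro sum.cong refl)
    fix \<sigma> assume "\<sigma> \<in> {\<sigma>. \<sigma> permutes {..<p}}"
    then have "permutation \<sigma>" "permutation \<tau>" using \<tau> permutation_permutes by blast+
    then show "of_int (sign (\<tau> \<circ> \<sigma>)) * (\<Prod>i<p. v ((\<tau> \<circ> \<sigma>) i) \<bullet> w i) =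
       of_int (sign \<tau>) * (of_int (sign \<sigma>) * (\<Prod>i<p. v (\<tau> (\<sigma> i)) \<bullet> w i))"
      by (simp add: sign_compose)
  qed
  also have "\<dots> = of_int (sign \<tau>) * wedge_fun p (\<lambda>i. v (\<tau> i)) w"
    by (simp add: wedge_fun_def sum_distrib_left)
  finally have W: "wedge_fun p v w = of_int (sign \<tau>) * wedge_fun p (\<lambda>i. v (\<tau> i)) w" .
  have "real_of_int (sign \<tau>) * of_int (sign \<tau>) = 1" by (metis of_int_1 of_int_mult sign_idempotent)
  then show ?thesis by (simp add: W mult.assoc[symmetric])
qed

lemma wedge_fun_eq_0:
  assumes "i < p" "j < p" "i \<noteq> j" "v i = v j"
  shows "wedge_fun p v w = 0"
proof -
  have "(\<lambda>k. v (Transposition.transpose i j k)) = v"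
  proof
    fix k show "v (Transposition.transpose i j k) = v k"
      using assms by (cases "k = i"; cases "k = j") auto
  qed
  then show ?thesis
    using wedge_fun_permute[of "Transposition.transpose i j" p v w] assms
      permutes_swap_id[of i "{..<p}" j] by (simp add: sign_swap_id)
qed

lemma multi_indices_nth:
  assumes "\<alpha> \<in> multi_indices n p"
  shows "length \<alpha> = p" "distinct \<alpha>" "sorted \<alpha>" "set \<alpha> \<subseteq> {1..n}" "card (set \<alpha>) = p"
    "inj_on ((!) \<alpha>) {..<p}" "(!) \<alpha> ` {..<p} = set \<alpha>"
proof -
  show 1: "length \<alpha> = p" "distinct \<alpha>" "sorted \<alpha>" "set \<alpha> \<subseteq> {1..n}"
    using assms by (auto simp: multi_indices_def strict_sorted_iff)
  show "card (set \<alpha>) = p" using 1 distinct_card by blast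
  show "inj_on ((!) \<alpha>) {..<p}" using 1 by (auto simp: inj_on_def nth_eq_iff_index_eq)
  show "(!) \<alpha> ` {..<p} = set \<alpha>" using 1 by (auto simp: set_conv_nth)
qed

lemma sorted_list_in_multi_indices:
  assumes "A \<subseteq> {1..n}" "card A = p"
  shows "sorted_list_of_set A \<in> multi_indices n p" "set (sorted_list_of_set A) = A"
  using assms finite_subset[OF assms(1)] by (auto simp: multi_indices_def)

lemma multi_indices_eqI:
  "\<alpha> \<in> multi_indices n p \<Longrightarrow> \<beta> \<in> multi_indices n p \<Longrightarrow> set \<alpha> = set \<beta> \<Longrightarrow> \<alpha> = \<beta>"
  using multi_indices_nth by (metis sorted_distinct_set_unique)

lemma finite_multi_indices [simp]: "finite (multi_indices n p)"
  by (rule finite_subset[OF _ finite_lists_length_eq[of "{1..n}" p]]) (auto simp: multi_indices_def)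

text \<open>A repeated index gives 0 by alternation; distinct indices are a rearrangement of an
  increasing list and cost only a sign.\<close>

lemma wedge_fun_in_span:
  assumes J: "\<And>i. i < p \<Longrightarrow> J i \<in> {1..n}"
  shows "\<exists>c. \<forall>w. wedge_fun p (\<lambda>i. Y (J i)) w = (\<Sum>\<alpha>\<in>multi_indices n p. c \<alpha> * wedge (map Y \<alpha>) w)"
proof (cases "inj_on J {..<p}")
  case False
  then obtain i j where "i < p" "j < p" "i \<noteq> j" "J i = J j" by (auto simp: inj_on_def)
  then have "wedge_fun p (\<lambda>i. Y (J i)) w = 0" for w by (intro wedge_fun_eq_0[of i p j]) auto
  then show ?thesis by (intro exI[of _ "\<lambda>_. 0"]) simp
next
  case True
  define \<alpha> where "\<alpha> = sorted_list_of_set (J ` {..<p})"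
  have "J ` {..<p} \<subseteq> {1..n}" "card (J ` {..<p}) = p" using J True by (auto simp: card_image)
  then have \<alpha>: "\<alpha> \<in> multi_indices n p" "set \<alpha> = J ` {..<p}"
    unfolding \<alpha>_def by (rule sorted_list_in_multi_indices)+
  note \<alpha>' = multi_indices_nth[OF \<alpha>(1)]
  have bij\<alpha>: "bij_betw ((!) \<alpha>) {..<p} (J ` {..<p})" using \<alpha> \<alpha>' by (auto simp: bij_betw_def)
  have bijJ: "bij_betw J {..<p} (J ` {..<p})" using True by (simp add: bij_betw_def)
  \<comment> \<open>Being the identity beyond \<open>p\<close> is part of what
    \<open>permutes\<close> demands.\<close>
  define \<tau> where "\<tau> i = (if i < p then the_inv_into {..<p} ((!) \<alpha>) (J i) else i)" for i
  have "bij_betw (the_inv_into {..<p} ((!) \<alpha>) \<circ> J) {..<p} {..<p}"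
    using bij_betw_trans[OF bijJ bij_betw_the_inv_into[OF bij\<alpha>]] .
  then have "bij_betw \<tau> {..<p} {..<p}" by (rule bij_betw_cong[THEN iffD1, rotated]) (simp add: \<tau>_def)
  then have \<tau>: "\<tau> permutes {..<p}" by (rule bij_imp_permutes) (simp add: \<tau>_def)
  have eq: "J i = \<alpha> ! \<tau> i" if "i < p" for i
    using that bij\<alpha> f_the_inv_into_f_bij_betw[OF bij\<alpha>, of "J i"] by (auto simp: \<tau>_def)
  have "wedge_fun p (\<lambda>i. Y (J i)) w = of_int (sign \<tau>) * wedge (map Y \<alpha>) w" for w
  proof -
    have "wedge_fun p (\<lambda>i. Y (J i)) w = wedge_fun p (\<lambda>i. Y (\<alpha> ! \<tau> i)) w"
      by (intro wedge_fun_cong) (simp add: eq)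
    also have "\<dots> = of_int (sign \<tau>) * wedge_fun p (\<lambda>i. Y (\<alpha> ! i)) w"
      using wedge_fun_permute[OF \<tau>, of "\<lambda>i. Y (\<alpha> ! i)" w] by simp
    also have "wedge_fun p (\<lambda>i. Y (\<alpha> ! i)) w = wedge (map Y \<alpha>) w"
      unfolding wedge_eq_wedge_fun using \<alpha>' by (auto intro!: wedge_fun_cong)
    finally show ?thesis .
  qed
  moreover have "(\<Sum>\<beta>\<in>multi_indices n p. (if \<beta> = \<alpha> then of_int (sign \<tau>) else 0) * wedge (map Y \<beta>) w) =
     of_int (sign \<tau>) * wedge (map Y \<alpha>) w" for w
    using \<alpha>(1) by (simp add: if_distrib[of "\<lambda>x. x * _"] if_distribR cong: if_cong)
  ultimately show ?thesis by (intro exI[of _ "\<lambda>\<beta>. if \<beta> = \<alpha> then of_int (sign \<tau>) else 0"]) simp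
qed

lemma wedge_in_span:
  assumes "length ts = p" "\<And>t. t \<in> set ts \<Longrightarrow> t = (\<Sum>k\<in>{1..n}. a t k *\<^sub>R Y k)"
  shows "\<exists>c. wedge ts = (\<lambda>w. \<Sum>\<alpha>\<in>multi_indices n p. c \<alpha> * wedge (map Y \<alpha>) w)"
proof -
  let ?F = "{..<p} \<rightarrow>\<^sub>E {1..n}"
  have "\<forall>J\<in>?F. \<exists>c. \<forall>w. wedge_fun p (\<lambda>i. Y (J i)) w = (\<Sum>\<alpha>\<in>multi_indices n p. c \<alpha> * wedge (map Y \<alpha>) w)"
  proof
    fix J assume "J \<in> ?F"
    then show "\<exists>c. \<forall>w. wedge_fun p (\<lambda>i. Y (J i)) w = (\<Sum>\<alpha>\<in>multi_indices n p. c \<alpha> * wedge (map Y \<alpha>) w)"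
      by (intro wedge_fun_in_span PiE_mem[of J "{..<p}"]) auto
  qed
  then obtain c where c: "\<And>J w. J \<in> ?F \<Longrightarrow>
      wedge_fun p (\<lambda>i. Y (J i)) w = (\<Sum>\<alpha>\<in>multi_indices n p. c J \<alpha> * wedge (map Y \<alpha>) w)"
    by metis
  define A where "A J = (\<Prod>i<p. a (ts ! i) (J i))" for J
  have "wedge ts w = (\<Sum>\<alpha>\<in>multi_indices n p. (\<Sum>J\<in>?F. A J * c J \<alpha>) * wedge (map Y \<alpha>) w)" for w
  proof -
    have "wedge ts w = (\<Sum>J\<in>?F. A J * wedge_fun p (\<lambda>i. Y (J i)) w)"
      unfolding wedge_eq_wedge_fun assms(1) A_def
      by (rule wedge_fun_expand) (use assms in auto)
    also have "\<dots> = (\<Sum>J\<in>?F. \<Sum>\<alpha>\<in>multi_indices n p. A J * c J \<alpha> * wedge (map Y \<alpha>) w)"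
      using c by (intro sum.cong) (auto simp: sum_distrib_left mult.assoc)
    also have "\<dots> = (\<Sum>\<alpha>\<in>multi_indices n p. \<Sum>J\<in>?F. A J * c J \<alpha> * wedge (map Y \<alpha>) w)" by (rule sum.swap)
    finally show ?thesis by (simp add: sum_distrib_right)
  qed
  then show ?thesis by (intro exI[of _ "\<lambda>\<alpha>. \<Sum>J\<in>?F. A J * c J \<alpha>"]) auto
qed

text \<open>A determinant of Kronecker symbols. A nonzero term needs
  \<open>\<beta> ! \<sigma> i = \<alpha> ! i\<close> throughout, which forces equal index sets,
  hence equal increasing lists, and then \<open>\<sigma> = id\<close>.\<close>

lemma wedge_dual:
  assumes \<alpha>: "\<alpha> \<in> multi_indices n p" and \<beta>: "\<beta> \<in> multi_indices n p"
    and dual: "\<And>k l. k \<in> {1..n} \<Longrightarrow> l \<in> {1..n} \<Longrightarrow> Y k \<bullet> u l = (if k = l then 1 else 0)"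
  shows "wedge (map Y \<beta>) (\<lambda>i. u (\<alpha> ! i)) = (if \<alpha> = \<beta> then 1 else 0)"
proof -
  note a = multi_indices_nth[OF \<alpha>] and b = multi_indices_nth[OF \<beta>]
  have ab: "\<alpha> ! i \<in> {1..n}" "\<beta> ! i \<in> {1..n}" if "i < p" for i
    using that a b nth_mem by (metis subsetD)+
  have eq: "wedge (map Y \<beta>) (\<lambda>i. u (\<alpha> ! i)) =
    (\<Sum>\<sigma> | \<sigma> permutes {..<p}. of_int (sign \<sigma>) * (\<Prod>i<p. if \<beta> ! \<sigma> i = \<alpha> ! i then 1 else 0))"
  proof -
    have len: "length (map Y \<beta>) = p" using b(1) by simp
    have "map Y \<beta> ! \<sigma> i \<bullet> u (\<alpha> ! i) = (if \<beta> ! \<sigma> i = \<alpha> ! i then 1 else 0)"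
      if "\<sigma> permutes {..<p}" "i < p" for \<sigma> i
      using dual[OF ab(2) ab(1)] permutes_lessThan[OF that] that(2) b(1) by simp
    then show ?thesis unfolding wedge_def len by (intro sum.cong arg_cong2[of _ _ _ _ "(*)"] prod.cong) auto
  qed
  have z: "(\<Prod>i<p. if \<beta> ! \<sigma> i = \<alpha> ! i then 1 else (0::real)) = (if \<alpha> = \<beta> \<and> \<sigma> = id then 1 else 0)"
    if \<sigma>: "\<sigma> permutes {..<p}" for \<sigma>
  proof (cases "\<forall>i<p. \<beta> ! \<sigma> i = \<alpha> ! i")
    case True
    have "set \<alpha> \<subseteq> set \<beta>"
      using a b True permutes_lessThan[OF \<sigma>] by (metis in_set_conv_nth subsetI)
    then have "set \<alpha> = set \<beta>" using a b by (intro card_subset_eq) auto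
    then have e: "\<alpha> = \<beta>" using multi_indices_eqI[OF \<alpha> \<beta>] by simp
    have "\<sigma> i = i" for i
    proof (cases "i < p")
      case True
      then show ?thesis using \<open>\<forall>i<p. \<beta> ! \<sigma> i = \<alpha> ! i\<close> e a permutes_lessThan[OF \<sigma>]
        by (metis nth_eq_iff_index_eq)
    qed (use \<sigma> in \<open>auto simp: permutes_not_in\<close>)
    then have "\<sigma> = id" by auto
    then show ?thesis using e by simp
  next
    case False
    then obtain i where i: "i < p" "\<beta> ! \<sigma> i \<noteq> \<alpha> ! i" by auto
    then have "(\<Prod>i<p. if \<beta> ! \<sigma> i = \<alpha> ! i then 1 else (0::real)) = 0"
      by (intro prod_zero) auto
    moreover have "\<not> (\<alpha> = \<beta> \<and> \<sigma> = id)" using i by auto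
    ultimately show ?thesis by simp
  qed
  have "wedge (map Y \<beta>) (\<lambda>i. u (\<alpha> ! i)) =
    (\<Sum>\<sigma> | \<sigma> permutes {..<p}. if \<sigma> = id then (if \<alpha> = \<beta> then 1 else 0) else 0)"
    unfolding eq using z by (intro sum.cong) (auto simp: sign_id)
  then show ?thesis by (simp add: finite_permutations permutes_id)
qed

text \<open>Evaluation at dual vectors recovers the coefficients, so they depend on
  \<open>ts\<close> alone and not on the expansion chosen.\<close>

lemma wedge_coefficient:
  assumes \<alpha>: "\<alpha> \<in> multi_indices n p"
    and dual: "\<And>k l. k \<in> {1..n} \<Longrightarrow> l \<in> {1..n} \<Longrightarrow> Y k \<bullet> u l = (if k = l then 1 else 0)"
    and c: "wedge ts = (\<lambda>w. \<Sum>\<alpha>\<in>multi_indices n p. c \<alpha> * wedge (map Y \<alpha>) w)"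
  shows "wedge ts (\<lambda>i. u (\<alpha> ! i)) = c \<alpha>"
proof -
  have "wedge ts (\<lambda>i. u (\<alpha> ! i)) = (\<Sum>\<beta>\<in>multi_indices n p. c \<beta> * (if \<alpha> = \<beta> then 1 else 0))"
    unfolding c using wedge_dual[OF \<alpha> _ dual] by (intro sum.cong) auto
  also have "\<dots> = c \<alpha>" using \<alpha> by (simp add: if_distrib cong: if_cong)
  finally show ?thesis .
qed

text \<open>Were the value 0, expanding the dual vectors \<open>E i\<close> in \<open>ts\<close>
  would give \<open>wedge_fun p E u = 0\<close>, yet this is the determinant of the identity
  matrix.\<close>

lemma wedge_nonzero:
  assumes ts: "length ts = p" "distinct ts"
    and E: "\<And>i. i < p \<Longrightarrow> E i \<in> span (set ts)"
    and dual: "\<And>i j. i < p \<Longrightarrow> j < p \<Longrightarrow> E i \<bullet> u j = (if i = j then 1 else 0)"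
  shows "wedge ts u \<noteq> 0"
proof
  assume z: "wedge ts u = 0"
  have "\<exists>a. E i = (\<Sum>k<p. a k *\<^sub>R ts ! k)" if i: "i < p" for i
  proof -
    obtain b where b: "E i = (\<Sum>t\<in>set ts. b t *\<^sub>R t)" using E[OF i] by (auto simp: span_finite)
    have "bij_betw ((!) ts) {..<p} (set ts)" using ts bij_betw_nth[of ts "{..<p}" "set ts"] by auto
    then have "(\<Sum>t\<in>set ts. b t *\<^sub>R t) = (\<Sum>k<p. b (ts ! k) *\<^sub>R ts ! k)"
      by (rule sum.reindex_bij_betw[symmetric])
    then show ?thesis using b by (intro exI[of _ "\<lambda>k. b (ts ! k)"]) simp
  qed
  then obtain a where a: "\<And>i. i < p \<Longrightarrow> E i = (\<Sum>k\<in>{..<p}. a i k *\<^sub>R ts ! k)" by metis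
  have "wedge_fun p (\<lambda>i. ts ! J i) u = 0" if J: "J \<in> {..<p} \<rightarrow>\<^sub>E {..<p}" for J
  proof (cases "inj_on J {..<p}")
    case False
    then obtain i j where "i < p" "j < p" "i \<noteq> j" "J i = J j" by (auto simp: inj_on_def)
    then show ?thesis by (intro wedge_fun_eq_0[of i p j]) auto
  next
    case True
    define \<tau> where "\<tau> i = (if i < p then J i else i)" for i
    have "J ` {..<p} = {..<p}" using True J by (intro card_subset_eq) (auto simp: card_image)
    then have "bij_betw J {..<p} {..<p}" using True by (simp add: bij_betw_def)
    then have "bij_betw \<tau> {..<p} {..<p}" by (rule bij_betw_cong[THEN iffD1, rotated]) (simp add: \<tau>_def)
    then have \<tau>: "\<tau> permutes {..<p}" by (rule bij_imp_permutes) (simp add: \<tau>_def)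
    have "wedge_fun p (\<lambda>i. ts ! J i) u = wedge_fun p (\<lambda>i. ts ! \<tau> i) u"
      by (intro wedge_fun_cong) (simp add: \<tau>_def)
    also have "\<dots> = of_int (sign \<tau>) * wedge ts u"
      using wedge_fun_permute[OF \<tau>, of "(!) ts" u] ts by (simp add: wedge_eq_wedge_fun)
    finally show ?thesis using z by simp
  qed
  then have "wedge_fun p E u = 0" using wedge_fun_expand[of "{..<p}" p E a "(!) ts" u] a by simp
  moreover have "wedge_fun p E u = 1"
  proof -
    have z: "(\<Prod>i<p. E (\<sigma> i) \<bullet> u i) = (if \<sigma> = id then 1 else 0)" if \<sigma>: "\<sigma> permutes {..<p}" for \<sigma>
    proof (cases "\<sigma> = id")
      case False
      then obtain i where i: "\<sigma> i \<noteq> i" by (metis eq_id_iff)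
      then have "i < p" using \<sigma> permutes_not_in by fastforce
      then have "(\<Prod>i<p. E (\<sigma> i) \<bullet> u i) = 0"
        using i dual[OF permutes_lessThan[OF \<sigma>]] by (intro prod_zero) auto
      then show ?thesis using False by simp
    qed (simp add: dual)
    have "wedge_fun p E u = (\<Sum>\<sigma> | \<sigma> permutes {..<p}. if \<sigma> = id then 1 else 0)"
      unfolding wedge_fun_def using z by (intro sum.cong) (auto simp: sign_id)
    then show ?thesis by (simp add: finite_permutations permutes_id)
  qed
  ultimately show False by simp
qed

section \<open>Coordinates that determine the points of a subspace\<close>

text \<open>For \<open>card A = dim T\<close> and independent \<open>u j\<close> this expresses that
  the Pluecker coordinate of \<open>T\<close> with index set \<open>A\<close> is nonzero, by kernels
  instead of minors.\<close>

definition coord_inj :: "(nat \<Rightarrow> 'a::euclidean_space) \<Rightarrow> nat set \<Rightarrow> 'a set \<Rightarrow> bool" where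
  "coord_inj u A T \<longleftrightarrow> (\<forall>t\<in>T. (\<forall>j\<in>A. t \<bullet> u j = 0) \<longrightarrow> t = 0)"

definition orthonormal_seq :: "(nat \<Rightarrow> 'a::euclidean_space) \<Rightarrow> bool" where
  "orthonormal_seq X \<longleftrightarrow> (\<forall>i\<in>{1..DIM('a)}. \<forall>j\<in>{1..DIM('a)}. X i \<bullet> X j = (if i = j then 1 else 0))"

lemma orthonormal_seq_facts:
  fixes X :: "nat \<Rightarrow> 'a::euclidean_space"
  assumes "orthonormal_seq X" and A: "A \<subseteq> {1..DIM('a)}"
  shows "inj_on X A" "independent (X ` A)" "dim (span (X ` A)) = card A"
    "k \<in> {1..DIM('a)} \<Longrightarrow> (\<Sum>j\<in>A. c j *\<^sub>R X j) \<bullet> X k = (if k \<in> A then c k else 0)"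
proof -
  have o: "X i \<bullet> X j = (if i = j then 1 else 0)" if "i \<in> {1..DIM('a)}" "j \<in> {1..DIM('a)}" for i j
    using assms that unfolding orthonormal_seq_def by blast
  have fA: "finite A" using A finite_subset by blast
  show inj: "inj_on X A"
  proof (rule inj_onI, rule ccontr)
    fix i j assume ij: "i \<in> A" "j \<in> A" "X i = X j" "i \<noteq> j"
    then have "i \<in> {1..DIM('a)}" "j \<in> {1..DIM('a)}" using A by blast+
    then have "X i \<bullet> X j = 0" "X i \<bullet> X i = 1" using o[of i j] o[of i i] ij(4) by simp_all
    then show False using ij by simp
  qed
  show sum: "(\<Sum>j\<in>A. c j *\<^sub>R X j) \<bullet> X k = (if k \<in> A then c k else 0)" if k: "k \<in> {1..DIM('a)}" for c k
  proof -
    have "(\<Sum>j\<in>A. c j *\<^sub>R X j) \<bullet> X k = (\<Sum>j\<in>A. if j = k then c k else 0)"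
      unfolding inner_sum_left using o[OF _ k] A by (intro sum.cong) (auto simp: subset_eq)
    then show ?thesis using fA by simp
  qed
  show ind: "independent (X ` A)"
  proof (rule pairwise_orthogonal_independent)
    show "pairwise orthogonal (X ` A)"
      unfolding pairwise_def orthogonal_def using o A by (auto simp: subset_eq)
    show "0 \<notin> X ` A" using o A by (force simp: subset_eq)
  qed
  show "dim (span (X ` A)) = card A"
    using ind inj by (simp add: dim_eq_card_independent card_image)
qed

lemma orthonormal_seq_expand:
  fixes X :: "nat \<Rightarrow> 'a::euclidean_space"
  assumes X: "orthonormal_seq X"
  shows "x = (\<Sum>j\<in>{1..DIM('a)}. (x \<bullet> X j) *\<^sub>R X j)"
proof -
  have "span (X ` {1..DIM('a)}) = UNIV"
    using orthonormal_seq_facts(3)[OF X order_refl] by (simp add: dim_eq_full)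
  then have x: "x \<in> span (X ` {1..DIM('a)})" by simp
  let ?y = "x - (\<Sum>j\<in>{1..DIM('a)}. (x \<bullet> X j) *\<^sub>R X j)"
  have "orthogonal ?y z" if "z \<in> X ` {1..DIM('a)}" for z
    using that orthonormal_seq_facts(4)[OF X order_refl] by (auto simp: orthogonal_def inner_diff_left)
  then have "orthogonal ?y ?y"
    using orthogonal_to_span[of ?y "X ` {1..DIM('a)}" ?y] \<open>span _ = UNIV\<close> by auto
  then show ?thesis by (simp add: orthogonal_def)
qed

text \<open>\<open>P\<close> places the coordinates \<open>t \<bullet> u j\<close> on the
  orthonormal vectors \<open>X j\<close>, which turns injectivity into a dimension count inside
  their span.\<close>

lemma coord_inj_projection:
  fixes T :: "'a::euclidean_space set" and X :: "nat \<Rightarrow> 'a"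
  assumes X: "orthonormal_seq X" and A: "A \<subseteq> {1..DIM('a)}" and T: "subspace T" and inj: "coord_inj u A T"
  obtains P where "\<And>t. P t = (\<Sum>j\<in>A. (t \<bullet> u j) *\<^sub>R X j)" "\<And>t k. k \<in> A \<Longrightarrow> P t \<bullet> X k = t \<bullet> u k"
    "subspace (P ` T)" "P ` T \<subseteq> span (X ` A)" "dim (P ` T) = dim T"
proof -
  define P where "P t = (\<Sum>j\<in>A. (t \<bullet> u j) *\<^sub>R X j)" for t
  have lin: "linear P"
    by (rule linearI) (simp_all add: P_def inner_add_left scaleR_add_left sum.distrib scaleR_sum_right)
  have Pk: "P t \<bullet> X k = t \<bullet> u k" if "k \<in> A" for t k
    using orthonormal_seq_facts(4)[OF X A, of k "\<lambda>j. t \<bullet> u j"] that A by (auto simp: P_def)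
  have "inj_on P T"
  proof (rule inj_onI)
    fix s t assume st: "s \<in> T" "t \<in> T" "P s = P t"
    have "(s - t) \<bullet> u k = 0" if "k \<in> A" for k
      using Pk[OF that, of s] Pk[OF that, of t] st(3) by (simp add: inner_diff_left)
    moreover have "s - t \<in> T" using st T by (simp add: subspace_diff)
    ultimately have "s - t = 0" using inj unfolding coord_inj_def by blast
    then show "s = t" by simp
  qed
  then have "dim (P ` T) = dim T" using T by (intro dim_image_eq[OF lin]) (simp add: span_eq_iff[THEN iffD2])
  moreover have "P ` T \<subseteq> span (X ` A)"
    unfolding P_def by (intro image_subsetI span_sum span_scale span_base imageI)
  ultimately show ?thesis using that P_def Pk linear_subspace_image[OF lin T] by blast
qed

text \<open>With as many coordinates as dimensions, \<open>P\<close> maps \<open>T\<close> onto the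
  span of the \<open>X j\<close>; the vector sought is the preimage of one of them.\<close>

lemma coord_inj_dual_basis:
  fixes T :: "'a::euclidean_space set" and X :: "nat \<Rightarrow> 'a"
  assumes X: "orthonormal_seq X" and A: "A \<subseteq> {1..DIM('a)}" "card A = dim T"
    and T: "subspace T" and inj: "coord_inj u A T" and j: "j \<in> A"
  shows "\<exists>e\<in>T. \<forall>k\<in>A. e \<bullet> u k = (if j = k then 1 else 0)"
proof -
  obtain P where Pk: "\<And>t k. k \<in> A \<Longrightarrow> P t \<bullet> X k = t \<bullet> u k"
    and P: "subspace (P ` T)" "P ` T \<subseteq> span (X ` A)" "dim (P ` T) = dim T"
    by (rule coord_inj_projection[OF X A(1) T inj], rule that)
  have "P ` T = span (X ` A)"
    using A(2) orthonormal_seq_facts(3)[OF X A(1)] P by (intro subspace_dim_equal) auto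
  then have "X j \<in> P ` T" using j by (simp add: span_base)
  then obtain e where e: "e \<in> T" "P e = X j" by auto
  have "e \<bullet> u k = (if j = k then 1 else 0)" if "k \<in> A" for k
  proof -
    have "j \<in> {1..DIM('a)}" "k \<in> {1..DIM('a)}" using A j that by blast+
    then have "X j \<bullet> X k = (if j = k then 1 else 0)" using X unfolding orthonormal_seq_def by blast
    then show ?thesis using Pk[OF that, of e] e(2) by simp
  qed
  then show ?thesis using e by blast
qed

text \<open>A coordinate set of least size has the right cardinality: if the image of
  \<open>T\<close> were a proper subspace, a vector orthogonal to it would express one coordinate by
  the others, and that one could be dropped.\<close>

lemma exists_coord_inj:
  fixes T :: "'a::euclidean_space set" and X :: "nat \<Rightarrow> 'a"
  assumes X: "orthonormal_seq X" and T: "subspace T"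
  shows "\<exists>A\<subseteq>{1..DIM('a)}. card A = dim T \<and> coord_inj X A T"
proof -
  have "coord_inj X {1..DIM('a)} T"
    unfolding coord_inj_def using orthonormal_seq_expand[OF X] by (metis (no_types, lifting) scale_zero_left sum.neutral)
  then obtain A where A: "A \<subseteq> {1..DIM('a)}" "coord_inj X A T"
    and min: "\<And>B. B \<subseteq> {1..DIM('a)} \<Longrightarrow> coord_inj X B T \<Longrightarrow> card A \<le> card B"
    using ex_has_least_nat[of "\<lambda>A. A \<subseteq> {1..DIM('a)} \<and> coord_inj X A T" "{1..DIM('a)}" card] by auto
  have fA: "finite A" using A finite_subset by blast
  note f = orthonormal_seq_facts[OF X A(1)]
  obtain P where P_def: "\<And>t. P t = (\<Sum>j\<in>A. (t \<bullet> X j) *\<^sub>R X j)"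
    and P: "subspace (P ` T)" "P ` T \<subseteq> span (X ` A)" "dim (P ` T) = dim T"
    by (rule coord_inj_projection[OF X A(1) T A(2)], rule that)
  have "P ` T = span (X ` A)"
  proof (rule ccontr)
    assume "P ` T \<noteq> span (X ` A)"
    then have "span (P ` T) \<subset> span (X ` A)"
      using P by (simp add: psubset_eq span_eq_iff[THEN iffD2])
    then obtain y where y: "y \<noteq> 0" "y \<in> span (X ` A)" "\<And>z. z \<in> span (P ` T) \<Longrightarrow> orthogonal y z"
      using orthogonal_to_subspace_exists_gen by blast
    have ye: "y = (\<Sum>j\<in>A. (y \<bullet> X j) *\<^sub>R X j)"
    proof -
      have "y \<in> span (X ` A)" by fact
      then obtain c where "y = (\<Sum>v\<in>X ` A. c v *\<^sub>R v)" using fA by (auto simp: span_finite)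
      then have yc: "y = (\<Sum>j\<in>A. c (X j) *\<^sub>R X j)" using f(1) by (simp add: sum.reindex)
      then have "y \<bullet> X j = c (X j)" if "j \<in> A" for j
        using f(4)[of j "\<lambda>j. c (X j)"] that A by auto
      then show ?thesis using yc by simp
    qed
    then obtain j where j: "j \<in> A" "y \<bullet> X j \<noteq> 0" using y(1) by (metis (no_types, lifting) scale_zero_left sum.neutral)
    have "coord_inj X (A - {j}) T"
      unfolding coord_inj_def
    proof (intro ballI impI)
      fix t assume t: "t \<in> T" "\<forall>k\<in>A - {j}. t \<bullet> X k = 0"
      have "y \<bullet> P t = 0" using y(3)[of "P t"] t by (simp add: span_base orthogonal_def)
      also have "y \<bullet> P t = (\<Sum>k\<in>A. (t \<bullet> X k) * (y \<bullet> X k))" by (simp add: P_def inner_sum_right)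
      also have "\<dots> = (t \<bullet> X j) * (y \<bullet> X j)"
        using t(2) j fA by (subst sum.remove[OF fA j(1)]) auto
      finally have "t \<bullet> X j = 0" using j by simp
      then have "\<forall>k\<in>A. t \<bullet> X k = 0" using t by auto
      then show "t = 0" using A(2) t unfolding coord_inj_def by blast
    qed
    then have "card A \<le> card (A - {j})" using A by (intro min) auto
    then show False using j fA by (metis card_Diff1_less leD)
  qed
  then have "card A = dim T" using P(3) f(3) by simp
  then show ?thesis using A by blast
qed

text \<open>The pivot set \<open>A\<close> is chosen of maximal total weight; exchanging \<open>j\<close> for \<open>k\<close> then shows that the
  basis vector with pivot \<open>j\<close> has no component of weight exceeding \<open>d j\<close>.\<close>

lemma weighted_echelon_basis:
  fixes T :: "'a::euclidean_space set" and X :: "nat \<Rightarrow> 'a" and d :: "nat \<Rightarrow> nat"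
  assumes X: "orthonormal_seq X" and T: "subspace T"
  obtains A e where "A \<subseteq> {1..DIM('a)}" "card A = dim T" "coord_inj X A T"
    "\<And>j. j \<in> A \<Longrightarrow> e j \<in> T" "\<And>j k. j \<in> A \<Longrightarrow> k \<in> A \<Longrightarrow> e j \<bullet> X k = (if j = k then 1 else 0)"
    "\<And>j k. j \<in> A \<Longrightarrow> k \<in> {1..DIM('a)} - A \<Longrightarrow> e j \<bullet> X k \<noteq> 0 \<Longrightarrow> d k \<le> d j"
    "\<And>t. t \<in> T \<Longrightarrow> t = (\<Sum>j\<in>A. (t \<bullet> X j) *\<^sub>R e j)"
proof -
  let ?\<P> = "{A. A \<subseteq> {1..DIM('a)} \<and> card A = dim T \<and> coord_inj X A T}"
  have fin: "finite ?\<P>" by (rule finite_subset[of _ "Pow {1..DIM('a)}"]) auto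
  moreover have ne: "?\<P> \<noteq> {}" using exists_coord_inj[OF X T] by blast
  ultimately have "Max (sum d ` ?\<P>) \<in> sum d ` ?\<P>" by (intro Max_in) auto
  then obtain A where A: "A \<subseteq> {1..DIM('a)}" "card A = dim T" "coord_inj X A T" "sum d A = Max (sum d ` ?\<P>)"
    by auto
  have max: "sum d B \<le> sum d A" if "B \<subseteq> {1..DIM('a)}" "card B = dim T" "coord_inj X B T" for B
    unfolding A(4) using fin that by (intro Max_ge) auto
  have fA: "finite A" using A finite_subset by blast
  have "\<forall>j\<in>A. \<exists>e\<in>T. \<forall>k\<in>A. e \<bullet> X k = (if j = k then 1 else 0)"
    using coord_inj_dual_basis[OF X A(1,2) T A(3)] by blast
  then obtain e where e: "\<And>j. j \<in> A \<Longrightarrow> e j \<in> T" "\<And>j k. j \<in> A \<Longrightarrow> k \<in> A \<Longrightarrow> e j \<bullet> X k = (if j = k then 1 else 0)"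
    by metis
  have exp: "t = (\<Sum>j\<in>A. (t \<bullet> X j) *\<^sub>R e j)" if t: "t \<in> T" for t
  proof -
    let ?s = "t - (\<Sum>j\<in>A. (t \<bullet> X j) *\<^sub>R e j)"
    have "?s \<in> T" using t e T by (intro subspace_diff subspace_sum subspace_scale) auto
    moreover have "?s \<bullet> X k = 0" if k: "k \<in> A" for k
    proof -
      have "(\<Sum>j\<in>A. (t \<bullet> X j) *\<^sub>R e j) \<bullet> X k = (\<Sum>j\<in>A. if j = k then t \<bullet> X k else 0)"
        unfolding inner_sum_left using e(2)[OF _ k] by (intro sum.cong) auto
      then show ?thesis using k fA by (simp add: inner_diff_left)
    qed
    ultimately have "?s = 0" using A(3) unfolding coord_inj_def by blast
    then show ?thesis by simp
  qed
  have "d k \<le> d j" if jk: "j \<in> A" "k \<in> {1..DIM('a)} - A" "e j \<bullet> X k \<noteq> 0" for j k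
  proof -
    let ?B = "insert k (A - {j})"
    \<comment> \<open>If the coordinates in \<open>?B\<close> vanish, only a multiple of
      \<open>e j\<close> is left, and the nonzero \<open>k\<close>-coordinate of \<open>e j\<close>
      makes this multiple 0.\<close>
    have "coord_inj X ?B T"
      unfolding coord_inj_def
    proof (intro ballI impI)
      fix t assume t: "t \<in> T" "\<forall>i\<in>?B. t \<bullet> X i = 0"
      have "t = (t \<bullet> X j) *\<^sub>R e j + (\<Sum>i\<in>A - {j}. (t \<bullet> X i) *\<^sub>R e i)"
        using exp[OF t(1)] sum.remove[OF fA jk(1), of "\<lambda>i. (t \<bullet> X i) *\<^sub>R e i"] by simp
      also have "(\<Sum>i\<in>A - {j}. (t \<bullet> X i) *\<^sub>R e i) = 0" using t(2) by (intro sum.neutral) auto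
      finally have te: "t = (t \<bullet> X j) *\<^sub>R e j" by simp
      then have "t \<bullet> X k = (t \<bullet> X j) * (e j \<bullet> X k)" by (metis inner_scaleR_left)
      then have "t \<bullet> X j = 0" using t(2) jk by simp
      then show "t = 0" using te by simp
    qed
    moreover have "card ?B = card A" using jk fA by (simp add: card_gt_0_iff) (metis Suc_pred card_gt_0_iff empty_iff)
    ultimately have "sum d ?B \<le> sum d A" using A jk by (intro max) auto
    moreover have "sum d ?B = d k + sum d (A - {j})" using jk fA by simp
    moreover have "sum d A = d j + sum d (A - {j})" using jk fA by (simp add: sum.remove)
    ultimately show ?thesis by simp
  qed
  then show ?thesis using that[of A e] A e exp by blast
qed

lemma multi_degree_eq_sum: "\<alpha> \<in> multi_indices n p \<Longrightarrow> multi_degree V \<alpha> = sum (index_degree V) (set \<alpha>)"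
  unfolding multi_degree_def using multi_indices_nth(2) by (intro sum_list_distinct_conv_sum_set) blast

text \<open>Used in contraposition: at a point of low degree, no index set of full degree gives
  injective coordinates on the tangent plane. For every admissible basis and expansion, evaluation
  at the dual vectors shows that the coefficient of \<open>\<alpha>\<close> is nonzero; as no
  multi-index exceeds the maximal degree, the definite description has a single possible
  value.\<close>

lemma degree_at_eq_max_degree:
  fixes X :: "nat \<Rightarrow> 'a::euclidean_space"
  defines "n \<equiv> DIM('a)"
  assumes X: "orthonormal_seq X" and T: "subspace (tangent_cone S x)" "dim (tangent_cone S x) = p"
    and dual: "\<And>k l. k \<in> {1..n} \<Longrightarrow> l \<in> {1..n} \<Longrightarrow>
      left_inv_field mul (X k) x \<bullet> u l = (if k = l then 1 else 0)"
    and rep: "\<And>t. t = (\<Sum>k\<in>{1..n}. (t \<bullet> u k) *\<^sub>R left_inv_field mul (X k) x)"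
    and A: "A \<subseteq> {1..n}" "card A = p" "coord_inj u A (tangent_cone S x)"
    and deg: "sum (index_degree V) A = max_degree V p"
  shows "degree_at mul V X p S x = max_degree V p"
proof -
  let ?T = "tangent_cone S x" and ?Y = "\<lambda>j. left_inv_field mul (X j) x"
  define \<alpha> where "\<alpha> = sorted_list_of_set A"
  have \<alpha>: "\<alpha> \<in> multi_indices n p" "set \<alpha> = A"
    unfolding \<alpha>_def using A sorted_list_in_multi_indices[of A n p] by auto
  note \<alpha>' = multi_indices_nth[OF \<alpha>(1)]
  have m\<alpha>: "multi_degree V \<alpha> = max_degree V p"
    using multi_degree_eq_sum[OF \<alpha>(1), of V] deg unfolding \<alpha>(2) by simp
  have "\<forall>i\<in>{..<p}. \<exists>e\<in>?T. \<forall>k\<in>A. e \<bullet> u k = (if \<alpha> ! i = k then 1 else 0)"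
  proof
    fix i assume "i \<in> {..<p}"
    then have "\<alpha> ! i \<in> A" using \<alpha>(2) \<alpha>'(1) nth_mem[of i \<alpha>] by simp
    moreover have "card A = dim ?T" using A(2) T(2) by simp
    ultimately show "\<exists>e\<in>?T. \<forall>k\<in>A. e \<bullet> u k = (if \<alpha> ! i = k then 1 else 0)"
      using coord_inj_dual_basis[OF X A(1)[unfolded n_def] _ T(1) A(3)] by blast
  qed
  then obtain E where E: "\<And>i. i < p \<Longrightarrow> E i \<in> ?T"
    "\<And>i k. i < p \<Longrightarrow> k \<in> A \<Longrightarrow> E i \<bullet> u k = (if \<alpha> ! i = k then 1 else 0)" by (metis lessThan_iff)
  have key: "k = max_degree V p"
    if ts: "length ts = p" "distinct ts" "span (set ts) = ?T"
      and c: "wedge ts = (\<lambda>w. \<Sum>\<alpha>\<in>multi_indices n p. c \<alpha> * wedge (map ?Y \<alpha>) w)"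
      and k: "k = Max {multi_degree V \<alpha> | \<alpha>. \<alpha> \<in> multi_indices n p \<and> c \<alpha> \<noteq> (0::real)}" for ts c k
  proof -
    have "wedge ts (\<lambda>i. u (\<alpha> ! i)) = c \<alpha>" by (rule wedge_coefficient[OF \<alpha>(1) dual c])
    moreover have "wedge ts (\<lambda>i. u (\<alpha> ! i)) \<noteq> 0"
    proof (rule wedge_nonzero[OF ts(1,2)])
      show "E i \<in> span (set ts)" if "i < p" for i using E that ts by simp
      show "E i \<bullet> u (\<alpha> ! j) = (if i = j then 1 else 0)" if "i < p" "j < p" for i j
        using E(2)[of i "\<alpha> ! j"] that \<alpha> \<alpha>' nth_eq_iff_index_eq[of \<alpha> i j] nth_mem[of j \<alpha>] by auto
    qed
    ultimately have c\<alpha>: "c \<alpha> \<noteq> 0" by simp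
    have "k = Max (multi_degree V ` {\<alpha>\<in>multi_indices n p. c \<alpha> \<noteq> 0})"
      unfolding k by (rule arg_cong[of _ _ Max]) auto
    also have "\<dots> = multi_degree V \<alpha>"
    proof (rule Max_eqI)
      fix y assume "y \<in> multi_degree V ` {\<alpha>\<in>multi_indices n p. c \<alpha> \<noteq> 0}"
      then have "y \<le> max_degree V p" unfolding max_degree_def n_def by (intro Max_ge) auto
      then show "y \<le> multi_degree V \<alpha>" using m\<alpha> by simp
    qed (use \<alpha> c\<alpha> in auto)
    finally show ?thesis using m\<alpha> by simp
  qed
  \<comment> \<open>The description also needs a witness: a basis of the tangent plane, listed in
    any order.\<close>
  obtain B where B: "B \<subseteq> ?T" "independent B" "?T \<subseteq> span B" "card B = p" using basis_exists[of ?T] T(2) by auto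
  have spB: "span B = ?T" using B T(1) by (simp add: subset_antisym span_minimal)
  obtain ts where ts: "set ts = B" "distinct ts"
    using finite_distinct_list[of B] B(2) finiteI_independent by blast
  have len: "length ts = p" using ts B distinct_card by metis
  obtain c where c: "wedge ts = (\<lambda>w. \<Sum>\<alpha>\<in>multi_indices n p. c \<alpha> * wedge (map ?Y \<alpha>) w)"
    using wedge_in_span[OF len, where n=n and a="\<lambda>t k. t \<bullet> u k" and Y="?Y"] rep by blast
  show ?thesis
    unfolding degree_at_def
  proof (rule the_equality)
    show "\<exists>ts c. length ts = p \<and> distinct ts \<and> independent (set ts) \<and> span (set ts) = ?T \<and>
        wedge ts = (\<lambda>w. \<Sum>\<alpha>\<in>multi_indices DIM('a) p. c \<alpha> * wedge (map ?Y \<alpha>) w) \<and>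
        max_degree V p = Max {multi_degree V \<alpha> | \<alpha>. \<alpha> \<in> multi_indices DIM('a) p \<and> c \<alpha> \<noteq> (0::real)}"
      using len ts B spB c key[OF len ts(2) _ c refl] unfolding n_def
      by (intro exI[of _ ts] exI[of _ c]) auto
  next
    fix k assume "\<exists>ts c. length ts = p \<and> distinct ts \<and> independent (set ts) \<and> span (set ts) = ?T \<and>
        wedge ts = (\<lambda>w. \<Sum>\<alpha>\<in>multi_indices DIM('a) p. c \<alpha> * wedge (map ?Y \<alpha>) w) \<and>
        k = Max {multi_degree V \<alpha> | \<alpha>. \<alpha> \<in> multi_indices DIM('a) p \<and> c \<alpha> \<noteq> (0::real)}"
    then show "k = max_degree V p" using key unfolding n_def by blast
  qed
qed

section \<open>Degrees of multi-indices\<close>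

lemma prod_power_quotient:
  fixes s r :: real
  assumes "finite B"
  shows "(\<Prod>k\<in>B. s / r ^ d k) = s ^ card B / r ^ sum d B"
  using assms by (simp add: prod_dividef power_sum)

lemma quotient_power_cases:
  fixes r M :: real and d m :: nat
  assumes r: "0 < r" "r \<le> 1" and M: "1 \<le> M"
  shows "d < m \<Longrightarrow> M * r ^ m / r ^ d \<le> M * r" "d = m \<Longrightarrow> M * r ^ m / r ^ d = M"
    "d > m \<Longrightarrow> M / r \<le> M * r ^ m / r ^ d"
proof -
  show "d = m \<Longrightarrow> M * r ^ m / r ^ d = M" using r by simp
  show "M * r ^ m / r ^ d \<le> M * r" if "d < m"
  proof -
    have "r ^ m / r ^ d = r ^ (m - d)" using that r by (simp add: power_diff)
    also have "\<dots> \<le> r ^ 1" using that r by (intro power_decreasing) auto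
    finally have "M * (r ^ m / r ^ d) \<le> M * r" using M by (intro mult_left_mono) auto
    then show ?thesis by simp
  qed
  show "M / r \<le> M * r ^ m / r ^ d" if "d > m"
  proof -
    have "r ^ d = r ^ m * r ^ (d - m)" using that by (simp add: power_add[symmetric])
    then have e: "M * r ^ m / r ^ d = M / r ^ (d - m)" using r by simp
    have "r ^ (d - m) \<le> r ^ 1" using that r by (intro power_decreasing) auto
    then show ?thesis unfolding e using r M by (intro divide_left_mono) auto
  qed
qed

text \<open>As \<open>r \<le> 1\<close>, a quotient can exceed 1 only for \<open>d k > m\<close>,
  hence only inside \<open>B\<close>; the quotients over \<open>B\<close> multiply to
  \<open>(r ^ m) ^ card B / r ^ sum d B\<close>.\<close>

lemma prod_quotients_le:
  fixes d :: "nat \<Rightarrow> nat" and r :: real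
  assumes N: "finite N" and B: "B \<subseteq> N"
    and big: "\<And>j. j \<in> B \<Longrightarrow> m \<le> d j" and small: "\<And>k. k \<in> N - B \<Longrightarrow> d k \<le> m"
    and r: "0 < r" "r \<le> 1"
  shows "(\<Prod>k\<in>N. max 1 (r ^ m / r ^ d k)) * r ^ sum d B \<le> (r ^ m) ^ card B"
proof -
  have fB: "finite B" using N B finite_subset by blast
  have "(\<Prod>k\<in>N. max 1 (r ^ m / r ^ d k)) \<le> (\<Prod>k\<in>N. if k \<in> B then r ^ m / r ^ d k else 1)"
  proof (intro prod_mono conjI)
    fix k assume k: "k \<in> N"
    show "max 1 (r ^ m / r ^ d k) \<le> (if k \<in> B then r ^ m / r ^ d k else 1)"
    proof (cases "k \<in> B")
      case True
      have "r ^ d k \<le> r ^ m" using big[OF True] r by (intro power_decreasing) auto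
      then show ?thesis using True r by simp
    next
      case False
      then have "r ^ m \<le> r ^ d k" using small[of k] k r by (intro power_decreasing) auto
      then show ?thesis using False r by simp
    qed
  qed (simp add: max_def)
  also have "\<dots> = (\<Prod>k\<in>B. r ^ m / r ^ d k)"
    using N B by (simp add: prod.If_cases Int_absorb1)
  also have "\<dots> = (r ^ m) ^ card B / r ^ sum d B" by (rule prod_power_quotient[OF fB])
  finally show ?thesis using r by (simp add: pos_le_divide_eq)
qed

text \<open>The size \<open>s = M r^m\<close> makes the quotients with \<open>d k = m\<close> equal to \<open>M\<close>, those with
  \<open>d k < m\<close> small and those with \<open>d k > m\<close> large. A factor \<open>\<epsilon>\<close> is gained if \<open>A\<close> misses an index of
  the last kind; otherwise \<open>A\<close> has fewer indices of degree \<open>m\<close> than \<open>B\<close>, which gains \<open>1 / M\<close>.\<close>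

lemma prod_quotients_small:
  fixes d :: "nat \<Rightarrow> nat"
  assumes N: "finite N" and B: "B \<subseteq> N" and A: "A \<subseteq> N" "card A = card B"
    and big: "\<And>j. j \<in> B \<Longrightarrow> m \<le> d j" and small: "\<And>k. k \<in> N - B \<Longrightarrow> d k \<le> m"
    and less: "sum d A < sum d B" and \<eta>: "\<eta> > 0"
  obtains M \<epsilon> r0 where "1 \<le> M" "0 < \<epsilon>" "\<epsilon> \<le> 1" "0 < r0" "r0 \<le> 1"
    "\<And>r::real. 0 < r \<Longrightarrow> r < r0 \<Longrightarrow>
      (\<Prod>k\<in>N. max 1 ((if k \<in> A then M * r ^ m else \<epsilon> * (M * r ^ m)) / r ^ d k)) * r ^ sum d B
        \<le> \<eta> * (M * r ^ m) ^ card B"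
proof -
  have fin: "finite A" "finite B" using N A B finite_subset by blast+
  \<comment> \<open>One spare power of \<open>1 / M\<close> is then worth at least the factor
    \<open>\<eta>\<close>.\<close>
  define M where "M = max 1 (1 / \<eta>)"
  have M: "1 \<le> M" "1 / \<eta> \<le> M" by (auto simp: M_def)
  \<comment> \<open>The bound \<open>1 / M\<close> keeps the factors of degree \<open>m\<close>
    outside \<open>A\<close> at 1; the other bound lets a single \<open>\<epsilon>\<close> outweigh
    every power of \<open>M\<close> that can occur.\<close>
  define \<epsilon> where "\<epsilon> = min (1 / M) (\<eta> / M ^ card N)"
  have \<epsilon>: "0 < \<epsilon>" "\<epsilon> \<le> 1 / M" "\<epsilon> \<le> \<eta> / M ^ card N" "\<epsilon> \<le> 1"
    using M \<eta> by (auto simp: \<epsilon>_def min_le_iff_disj)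
  then have \<epsilon>M: "\<epsilon> * M \<le> 1" "\<epsilon> * M ^ card N \<le> \<eta>"
    using M by (auto simp: pos_le_divide_eq)
  \<comment> \<open>For \<open>r < \<epsilon>\<close> the quotients of degree below \<open>m\<close>
    are at most \<open>M * \<epsilon> \<le> 1\<close>, and those of degree above \<open>m\<close>
    are at least \<open>1 / \<epsilon>\<close>; this settles every \<open>max\<close>.\<close>
  define r0 where "r0 = \<epsilon>"
  have r0: "0 < r0" "r0 \<le> 1" using \<epsilon> by (auto simp: r0_def)
  define a where "a = card {k\<in>A. d k = m}"
  define b where "b = card {k\<in>B. d k = m}"
  define g where "g = card {k\<in>N. d k > m \<and> k \<notin> A}"
  \<comment> \<open>Bookkeeping factor by factor against the product over \<open>B\<close>:
    \<open>A\<close> collects \<open>M\<close> at its indices of degree \<open>m\<close> and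
    \<open>\<epsilon>\<close> at the indices of higher degree that it misses. \<open>M ^ b\<close>
    stands on the left to avoid a division.\<close>
  have main: "(\<Prod>k\<in>N. max 1 ((if k \<in> A then M * r ^ m else \<epsilon> * (M * r ^ m)) / r ^ d k)) * M ^ b
      = (\<Prod>k\<in>B. M * r ^ m / r ^ d k) * (\<epsilon> ^ g * M ^ a)" if r: "0 < r" "r < r0" for r
  proof -
    let ?q = "\<lambda>k. M * r ^ m / r ^ d k"
    let ?f = "\<lambda>k. max 1 ((if k \<in> A then M * r ^ m else \<epsilon> * (M * r ^ m)) / r ^ d k)"
    let ?h = "\<lambda>k. if k \<in> B then ?q k else 1"
    let ?\<beta> = "\<lambda>k. if d k = m \<and> k \<in> B then M else 1"
    let ?\<alpha> = "\<lambda>k. if d k = m \<and> k \<in> A then M else 1"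
    let ?\<gamma> = "\<lambda>k. if d k > m \<and> k \<notin> A then \<epsilon> else 1"
    have r1: "0 < r" "r \<le> 1" using r r0 by auto
    have f: "?f k = max 1 (if k \<in> A then ?q k else \<epsilon> * ?q k)" for k by simp
    have max1: "max 1 (if P then Q else \<epsilon> * Q) = 1" if "Q \<le> 1" "\<epsilon> * Q \<le> 1" for P Q
      using that by (auto simp: max_def)
    have max2: "max 1 (if P then Q else \<epsilon> * Q) = (if P then Q else \<epsilon> * Q)" if "1 / \<epsilon> \<le> Q" for P Q
    proof -
      have "1 \<le> \<epsilon> * Q" using that \<epsilon> by (simp add: pos_divide_le_eq mult.commute)
      moreover have "1 \<le> 1 / \<epsilon>" using \<epsilon> by simp
      then have "1 \<le> Q" using that by linarith
      ultimately show ?thesis by (auto simp: max_def)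
    qed
    have pt: "?f k * ?\<beta> k = ?h k * (?\<gamma> k * ?\<alpha> k)" if k: "k \<in> N" for k
    proof (cases "d k" m rule: linorder_cases)
      case less
      have "?q k \<le> M * r" using quotient_power_cases(1)[OF r1 M(1) less] .
      also have "\<dots> \<le> M * \<epsilon>" using r M by (intro mult_left_mono) (auto simp: r0_def)
      finally have q: "?q k \<le> 1" using \<epsilon>M by (simp add: mult.commute)
      have "0 \<le> ?q k" using r1 M by simp
      then have "\<epsilon> * ?q k \<le> 1" using q \<epsilon> by (meson mult_le_one less_imp_le)
      then have "?f k = 1" unfolding f using q by (intro max1)
      moreover have "k \<notin> B" using big[of k] less by auto
      ultimately show ?thesis using less by simp
    next
      case equal
      have q: "?q k = M" using quotient_power_cases(2)[OF r1 M(1) equal] .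
      have "?f k = (if k \<in> A then M else 1)" unfolding f q using M \<epsilon>M by (auto simp: max_def)
      then show ?thesis using equal q by simp
    next
      case greater
      have q: "M / r \<le> ?q k" using quotient_power_cases(3)[OF r1 M(1) greater] .
      have "1 / \<epsilon> \<le> M / r" using r M \<epsilon> by (intro frac_le) (auto simp: r0_def)
      then have "?f k = (if k \<in> A then ?q k else \<epsilon> * ?q k)"
        unfolding f using q by (intro max2) linarith
      moreover have "k \<in> B" using small[of k] greater k by auto
      ultimately show ?thesis using greater by simp
    qed
    have "(\<Prod>k\<in>N. ?f k) * (\<Prod>k\<in>N. ?\<beta> k) = (\<Prod>k\<in>N. ?h k) * ((\<Prod>k\<in>N. ?\<gamma> k) * (\<Prod>k\<in>N. ?\<alpha> k))"
      unfolding prod.distrib[symmetric] by (rule prod.cong[OF refl pt])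
    moreover have "(\<Prod>k\<in>N. ?\<beta> k) = M ^ b"
    proof -
      have "(\<Prod>k\<in>N. ?\<beta> k) = M ^ card (N \<inter> {k. d k = m \<and> k \<in> B})" using N by (simp add: prod.If_cases)
      also have "N \<inter> {k. d k = m \<and> k \<in> B} = {k\<in>B. d k = m}" using B by auto
      finally show ?thesis by (simp add: b_def)
    qed
    moreover have "(\<Prod>k\<in>N. ?\<alpha> k) = M ^ a"
    proof -
      have "(\<Prod>k\<in>N. ?\<alpha> k) = M ^ card (N \<inter> {k. d k = m \<and> k \<in> A})" using N by (simp add: prod.If_cases)
      also have "N \<inter> {k. d k = m \<and> k \<in> A} = {k\<in>A. d k = m}" using A by auto
      finally show ?thesis by (simp add: a_def)
    qed
    moreover have "(\<Prod>k\<in>N. ?\<gamma> k) = \<epsilon> ^ g"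
    proof -
      have "(\<Prod>k\<in>N. ?\<gamma> k) = \<epsilon> ^ card (N \<inter> {k. d k > m \<and> k \<notin> A})" using N by (simp add: prod.If_cases)
      also have "N \<inter> {k. d k > m \<and> k \<notin> A} = {k\<in>N. d k > m \<and> k \<notin> A}" by auto
      finally show ?thesis by (simp add: g_def)
    qed
    moreover have "(\<Prod>k\<in>N. ?h k) = (\<Prod>k\<in>B. ?q k)" using N B by (simp add: prod.If_cases Int_absorb1)
    ultimately show ?thesis by simp
  qed
  have ratio: "\<epsilon> ^ g * M ^ a \<le> \<eta> * M ^ b"
  proof (cases "g = 0")
    case False
    have "\<epsilon> ^ g \<le> \<epsilon> ^ 1" using False \<epsilon> by (intro power_decreasing) auto
    moreover have "a \<le> card N" unfolding a_def using A N by (intro card_mono) auto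
    then have "M ^ a \<le> M ^ card N" using M by (intro power_increasing)
    ultimately have "\<epsilon> ^ g * M ^ a \<le> \<epsilon> * M ^ card N" using \<epsilon> M by (intro mult_mono) auto
    also have "\<dots> \<le> \<eta> * 1" using \<epsilon>M by simp
    also have "\<dots> \<le> \<eta> * M ^ b" using M \<eta> by (intro mult_left_mono one_le_power) auto
    finally show ?thesis .
  next
    case True
    have "{k\<in>N. d k > m \<and> k \<notin> A} = {}" using True N unfolding g_def by simp
    then have GA: "{k\<in>A. d k > m} = {k\<in>B. d k > m}" using A B small by fastforce
    \<comment> \<open>Above \<open>m\<close> the two sets agree and \<open>B\<close> has nothing
      below \<open>m\<close>. Were \<open>a \<ge> b\<close>, equal cardinality would leave
      \<open>A\<close> nothing below \<open>m\<close> either, and the degree sums would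
      coincide.\<close>
    have "a < b"
    proof (rule ccontr)
      assume ab: "\<not> a < b"
      have split: "card C = card {k\<in>C. d k < m} + card {k\<in>C. d k = m} + card {k\<in>C. d k > m}"
        "sum d C = sum d {k\<in>C. d k < m} + m * card {k\<in>C. d k = m} + sum d {k\<in>C. d k > m}"
        if "finite C" for C
      proof -
        have C: "C = {k\<in>C. d k < m} \<union> {k\<in>C. d k = m} \<union> {k\<in>C. d k > m}" by auto
        have "card C = card ({k\<in>C. d k < m} \<union> {k\<in>C. d k = m} \<union> {k\<in>C. d k > m})" using C by simp
        also have "\<dots> = card ({k\<in>C. d k < m} \<union> {k\<in>C. d k = m}) + card {k\<in>C. d k > m}"
          using that by (intro card_Un_disjoint) auto
        also have "card ({k\<in>C. d k < m} \<union> {k\<in>C. d k = m}) = card {k\<in>C. d k < m} + card {k\<in>C. d k = m}"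
          using that by (intro card_Un_disjoint) auto
        finally show "card C = card {k\<in>C. d k < m} + card {k\<in>C. d k = m} + card {k\<in>C. d k > m}" .
        have "sum d C = sum d ({k\<in>C. d k < m} \<union> {k\<in>C. d k = m} \<union> {k\<in>C. d k > m})" using C by simp
        also have "\<dots> = sum d ({k\<in>C. d k < m} \<union> {k\<in>C. d k = m}) + sum d {k\<in>C. d k > m}"
          using that by (intro sum.union_disjoint) auto
        also have "sum d ({k\<in>C. d k < m} \<union> {k\<in>C. d k = m}) = sum d {k\<in>C. d k < m} + sum d {k\<in>C. d k = m}"
          using that by (intro sum.union_disjoint) auto
        also have "sum d {k\<in>C. d k = m} = m * card {k\<in>C. d k = m}" by simp
        finally show "sum d C = sum d {k\<in>C. d k < m} + m * card {k\<in>C. d k = m} + sum d {k\<in>C. d k > m}" .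
      qed
      have B0: "{k\<in>B. d k < m} = {}" using big by force
      have cA: "card {k\<in>A. d k < m} + a = b"
        using split(1)[OF fin(1)] split(1)[OF fin(2)] A(2) GA B0 by (simp add: a_def b_def)
      then have "card {k\<in>A. d k < m} = 0" "a = b" using ab by auto
      then have A0: "{k\<in>A. d k < m} = {}" using fin by simp
      have "sum d A = sum d B"
        using split(2)[OF fin(1)] split(2)[OF fin(2)] \<open>a = b\<close>
        unfolding a_def b_def GA B0 A0 by simp
      then show False using less by simp
    qed
    have "1 \<le> \<eta> * M" using M(2) \<eta> by (simp add: pos_divide_le_eq mult.commute)
    then have "M ^ a \<le> (\<eta> * M) * M ^ a" using M by (simp add: mult_le_cancel_right1)
    also have "\<dots> = \<eta> * M ^ Suc a" by simp
    also have "\<dots> \<le> \<eta> * M ^ b" using \<open>a < b\<close> M \<eta> by (intro mult_left_mono power_increasing) auto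
    finally show ?thesis using True by simp
  qed
  show ?thesis
  proof (rule that[OF M(1) \<epsilon>(1,4) r0])
    fix r :: real assume r: "0 < r" "r < r0"
    let ?F = "\<Prod>k\<in>N. max 1 ((if k \<in> A then M * r ^ m else \<epsilon> * (M * r ^ m)) / r ^ d k)"
    let ?H = "\<Prod>k\<in>B. M * r ^ m / r ^ d k"
    have H0: "?H \<ge> 0" using r M by (intro prod_nonneg) auto
    have "?F * M ^ b \<le> ?H * (\<eta> * M ^ b)" unfolding main[OF r] using ratio H0 by (intro mult_left_mono)
    then have "?F * M ^ b \<le> (\<eta> * ?H) * M ^ b" by (simp add: mult_ac)
    then have "?F \<le> \<eta> * ?H" using M by (simp add: mult_le_cancel_right)
    also have "?H = (M * r ^ m) ^ card B / r ^ sum d B" by (rule prod_power_quotient[OF fin(2)])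
    finally show "?F * r ^ sum d B \<le> \<eta> * (M * r ^ m) ^ card B" using r by (simp add: pos_le_divide_eq)
  qed
qed

lemma sum_degree_le_max_degree:
  fixes V :: "nat \<Rightarrow> 'a::euclidean_space set"
  assumes A: "A \<subseteq> {1..DIM('a)}" "card A = p"
  shows "sum (index_degree V) A \<le> max_degree V p"
proof -
  note s = sorted_list_in_multi_indices[OF A]
  have "multi_degree V (sorted_list_of_set A) \<le> max_degree V p"
    unfolding max_degree_def using s by (intro Max_ge) auto
  then show ?thesis using multi_degree_eq_sum[OF s(1), of V] s(2) by simp
qed

text \<open>Exchange argument: replacing an index of least degree \<open>m\<close> in a maximiser by
  an outside index cannot raise the sum, so every outside degree is at most
  \<open>m\<close>.\<close>

lemma max_degree_attained:
  fixes V :: "nat \<Rightarrow> 'a::euclidean_space set"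
  assumes p: "1 \<le> p" "p \<le> DIM('a)"
  obtains B m where "B \<subseteq> {1..DIM('a)}" "card B = p" "sum (index_degree V) B = max_degree V p"
    "m \<in> index_degree V ` B" "\<And>j. j \<in> B \<Longrightarrow> m \<le> index_degree V j"
    "\<And>k. k \<in> {1..DIM('a)} - B \<Longrightarrow> index_degree V k \<le> m"
proof -
  let ?n = "DIM('a)" and ?d = "index_degree V"
  have "multi_indices ?n p \<noteq> {}"
    using sorted_list_in_multi_indices(1)[of "{1..p}" ?n p] p by auto
  then have "max_degree V p \<in> multi_degree V ` multi_indices ?n p"
    unfolding max_degree_def by (intro Max_in) auto
  then obtain \<alpha> where \<alpha>: "\<alpha> \<in> multi_indices ?n p" "multi_degree V \<alpha> = max_degree V p" by auto
  note a = multi_indices_nth[OF \<alpha>(1)]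
  define B where "B = set \<alpha>"
  have B: "B \<subseteq> {1..?n}" "card B = p" "sum ?d B = max_degree V p" "finite B"
    using a \<alpha> multi_degree_eq_sum[OF \<alpha>(1), of V] by (auto simp: B_def)
  have Bne: "B \<noteq> {}" using B p by auto
  define m where "m = Min (?d ` B)"
  have l: "m \<in> ?d ` B" unfolding m_def using B Bne by (intro Min_in) auto
  then obtain j where j: "j \<in> B" "?d j = m" by auto
  have "?d k \<le> m" if k: "k \<in> {1..?n} - B" for k
  proof -
    let ?B = "insert k (B - {j})"
    have "card ?B = p" using B(2,4) k card_Suc_Diff1[OF B(4) j(1)] by simp
    then have "sum ?d ?B \<le> sum ?d B" using sum_degree_le_max_degree[of ?B p V] B k by auto
    moreover have "sum ?d ?B = ?d k + sum ?d (B - {j})" using k B by simp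
    moreover have "sum ?d B = ?d j + sum ?d (B - {j})" using j B by (simp add: sum.remove)
    ultimately show ?thesis using j by simp
  qed
  then show ?thesis using that[of B m] B l unfolding m_def by simp
qed

text \<open>\<open>index_degree\<close> is a definite description, so a layer has to be exhibited.
  Bases of the layers together span the space, hence \<open>DIM('a)\<close> is at most
  \<open>layer_sum V \<iota>\<close>; monotone partial sums then single out one layer.\<close>

lemma index_degree_ge_1:
  fixes V :: "nat \<Rightarrow> 'a::euclidean_space set"
  assumes strat: "stratified_group mul V \<iota>" and j: "j \<in> {1..DIM('a)}"
  shows "1 \<le> index_degree V j"
proof -
  have sub: "subspace (V i)" if "i \<in> {1..\<iota>}" for i using strat that unfolding stratified_group_def by blast
  have "\<forall>i. \<exists>B. B \<subseteq> V i \<and> independent B \<and> V i \<subseteq> span B \<and> card B = dim (V i)"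
    using basis_exists by metis
  then obtain b where b: "\<And>i. b i \<subseteq> V i" "\<And>i. independent (b i)" "\<And>i. V i \<subseteq> span (b i)" "\<And>i. card (b i) = dim (V i)"
    by metis
  have "UNIV \<subseteq> span (\<Union>i\<in>{1..\<iota>}. b i)"
  proof
    fix x :: 'a
    obtain v where v: "v \<in> (\<Pi>\<^sub>E i\<in>{1..\<iota>}. V i)" "x = (\<Sum>i=1..\<iota>. v i)"
      using strat unfolding stratified_group_def by metis
    have "v i \<in> span (\<Union>i\<in>{1..\<iota>}. b i)" if "i \<in> {1..\<iota>}" for i
    proof -
      have "v i \<in> span (b i)" using v(1) that b(3) by (meson PiE_mem subsetD)
      moreover have "span (b i) \<subseteq> span (\<Union>i\<in>{1..\<iota>}. b i)" using that by (intro span_mono) auto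
      ultimately show ?thesis by blast
    qed
    then show "x \<in> span (\<Union>i\<in>{1..\<iota>}. b i)" unfolding v(2) by (rule span_sum)
  qed
  then have "DIM('a) \<le> card (\<Union>i\<in>{1..\<iota>}. b i)"
    using dim_le_card[of "UNIV :: 'a set" "\<Union>i\<in>{1..\<iota>}. b i"] b(2) finiteI_independent by auto
  also have "\<dots> \<le> (\<Sum>i\<in>{1..\<iota>}. card (b i))" by (intro card_UN_le) auto
  also have "\<dots> = layer_sum V \<iota>" using b by (simp add: layer_sum_def)
  finally have n: "DIM('a) \<le> layer_sum V \<iota>" .
  have mono: "layer_sum V i \<le> layer_sum V k" if "i \<le> k" for i k
    unfolding layer_sum_def using that by (intro sum_mono2) auto
  define k where "k = (LEAST k. j \<le> layer_sum V k)"
  have jk: "j \<le> layer_sum V k" unfolding k_def by (rule LeastI[of _ \<iota>]) (use n j in auto)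
  have k1: "1 \<le> k"
  proof (rule ccontr)
    assume "\<not> 1 \<le> k"
    then have "layer_sum V k = 0" by (simp add: layer_sum_def)
    then show False using jk j by simp
  qed
  have kl: "layer_sum V (k - 1) < j"
    using not_less_Least[of "k - 1" "\<lambda>k. j \<le> layer_sum V k"] k1 unfolding k_def by simp
  have "index_degree V j = k"
    unfolding index_degree_def
  proof (rule the_equality)
    show "1 \<le> k \<and> layer_sum V (k - 1) < j \<and> j \<le> layer_sum V k" using k1 kl jk by blast
    fix i assume i: "1 \<le> i \<and> layer_sum V (i - 1) < j \<and> j \<le> layer_sum V i"
    show "i = k"
    proof (rule ccontr)
      assume "i \<noteq> k"
      then consider "i \<le> k - 1" | "k \<le> i - 1" by linarith
      then show False using mono[of i "k - 1"] mono[of k "i - 1"] i kl jk by cases auto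
    qed
  qed
  then show ?thesis using k1 by simp
qed

section \<open>Exponential groups and boxes\<close>

text \<open>\<open>Ck_map\<close> gives continuity of the derivative in each fixed direction;
  summing over \<open>Basis\<close> controls its operator norm, and a small derivative on a ball
  means a small Lipschitz constant there.\<close>

lemma C1_lipschitz_remainder:
  fixes F :: "'a::euclidean_space \<Rightarrow> 'b::euclidean_space"
  assumes F: "smooth_map F" and \<epsilon>: "\<epsilon> > 0"
  obtains \<rho> where "\<rho> > 0" "\<epsilon>-lipschitz_on (ball z0 \<rho>) (\<lambda>z. F z - frechet_derivative F (at z0) z)"
proof -
  let ?D = "\<lambda>z. frechet_derivative F (at z)"
  have C1: "Ck_map (Suc 0) F" using F unfolding smooth_map_def by blast
  have diff: "(F has_derivative ?D z) (at z)" for z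
    using C1 by (simp add: frechet_derivative_works[symmetric])
  have cont: "continuous_on UNIV (\<lambda>z. ?D z v)" for v using C1 by simp
  have lin: "linear (?D z)" for z using diff has_derivative_linear by blast
  have "continuous_on UNIV (\<lambda>z. \<Sum>b\<in>Basis. norm (?D z b - ?D z0 b))"
    by (intro continuous_intros cont)
  then have "isCont (\<lambda>z. \<Sum>b\<in>Basis. norm (?D z b - ?D z0 b)) z0"
    by (simp add: continuous_on_eq_continuous_at)
  then have "\<exists>\<rho>>0. \<forall>z. dist z z0 < \<rho> \<longrightarrow> dist (\<Sum>b\<in>Basis. norm (?D z b - ?D z0 b)) (\<Sum>b\<in>Basis. norm (?D z0 b - ?D z0 b)) < \<epsilon>"
    using \<epsilon> unfolding continuous_at_eps_delta by blast
  then obtain \<rho> where \<rho>: "\<rho> > 0" "\<And>z. dist z z0 < \<rho> \<Longrightarrow> (\<Sum>b\<in>Basis. norm (?D z b - ?D z0 b)) < \<epsilon>"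
    by (auto simp: dist_real_def abs_of_nonneg[OF sum_nonneg])
  have "\<epsilon>-lipschitz_on (ball z0 \<rho>) (\<lambda>z. F z - ?D z0 z)"
  proof (rule bounded_derivative_imp_lipschitz)
    fix z assume z: "z \<in> ball z0 \<rho>"
    show "((\<lambda>z. F z - ?D z0 z) has_derivative (\<lambda>h. ?D z h - ?D z0 h)) (at z within ball z0 \<rho>)"
      using diff[of z] linear_imp_has_derivative[OF lin[of z0]]
      by (intro has_derivative_diff) (auto intro: has_derivative_at_withinI)
    show "onorm (\<lambda>h. ?D z h - ?D z0 h) \<le> \<epsilon>"
    proof (rule onorm_le)
      fix h :: 'a
      have e: "?D z h - ?D z0 h = (\<Sum>b\<in>Basis. (h \<bullet> b) *\<^sub>R (?D z b - ?D z0 b))"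
      proof -
        have "?D w h = (\<Sum>b\<in>Basis. (h \<bullet> b) *\<^sub>R ?D w b)" for w
          using linear_sum[OF lin, of w "\<lambda>b. (h \<bullet> b) *\<^sub>R b" Basis]
          by (simp add: euclidean_representation linear_cmul[OF lin])
        then show ?thesis by (simp add: sum_subtractf scaleR_diff_right)
      qed
      have "norm (?D z h - ?D z0 h) \<le> (\<Sum>b\<in>Basis. norm ((h \<bullet> b) *\<^sub>R (?D z b - ?D z0 b)))"
        unfolding e by (rule norm_sum)
      also have "\<dots> \<le> (\<Sum>b\<in>Basis. norm h * norm (?D z b - ?D z0 b))"
        by (intro sum_mono) (auto intro!: mult_right_mono Basis_le_norm)
      also have "\<dots> = (\<Sum>b\<in>Basis. norm (?D z b - ?D z0 b)) * norm h"
        by (simp add: sum_distrib_left mult.commute)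
      also have "\<dots> \<le> \<epsilon> * norm h" using \<rho>(2)[of z] z by (intro mult_right_mono) (auto simp: dist_commute)
      finally show "norm (?D z h - ?D z0 h) \<le> \<epsilon> * norm h" .
    qed
  qed (use \<epsilon> in auto)
  then show ?thesis using that \<rho> by blast
qed

locale exp_group =
  fixes mul :: "'a::euclidean_space \<Rightarrow> 'a \<Rightarrow> 'a"
  assumes exp_coord: "exp_coord_lie_group mul"
begin

lemma group_mul: "Groups.group mul 0 uminus"
  and smooth_mul: "smooth_map (\<lambda>(x, y). mul x y)"
  using exp_coord unfolding exp_coord_lie_group_def by auto

lemma mul_laws [simp]:
  "mul 0 x = x" "mul x 0 = x" "mul (- x) x = 0" "mul x (- x) = 0"
  "mul (- x) (mul x y) = y" "mul x (mul (- x) y) = y"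
  and mul_assoc: "mul (mul x y) z = mul x (mul y z)"
proof -
  interpret G: Groups.group mul 0 uminus by (rule group_mul)
  show 1: "mul 0 x = x" "mul x 0 = x" "mul (- x) x = 0" "mul x (- x) = 0" for x by auto
  show "mul (mul x y) z = mul x (mul y z)" by (rule G.assoc)
  show "mul (- x) (mul x y) = y" "mul x (mul (- x) y) = y" by (simp_all add: G.assoc[symmetric] 1)
qed

lemma mul_differentiable: "(\<lambda>(x, y). mul x y) differentiable (at z)"
proof -
  have "Ck_map (Suc 0) (\<lambda>(x, y). mul x y)" using smooth_mul unfolding smooth_map_def by blast
  then show ?thesis unfolding Ck_map.simps by blast
qed

lemma mul_left_differentiable: "mul x differentiable (at y)"
proof -
  obtain D where D: "((\<lambda>(x, y). mul x y) has_derivative D) (at (x, y))"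
    using mul_differentiable unfolding differentiable_def by blast
  have "((\<lambda>y::'a. (x, y)) has_derivative (\<lambda>h. (0, h))) (at y)" by (auto intro!: derivative_eq_intros)
  then have "((\<lambda>y. (\<lambda>(x, y). mul x y) (x, y)) has_derivative (\<lambda>h. D (0, h))) (at y)"
    using has_derivative_compose[of "\<lambda>y. (x, y)" "\<lambda>h. (0, h)" y UNIV "\<lambda>(x, y). mul x y" D] D by simp
  then show ?thesis unfolding differentiable_def by auto
qed

lemma continuous_mul_left: "continuous_on S (mul x)"
  by (meson continuous_at_imp_continuous_on differentiable_imp_continuous_within mul_left_differentiable)

text \<open>The derivative of the group law at the pair of units is addition, so
  \<open>mul z u - z - u\<close> has a small Lipschitz constant nearby. It vanishes for
  \<open>z = 0\<close>, which is why the first bound involves \<open>norm z\<close> alone; the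
  second bound makes left translations nearly isometric.\<close>

lemma mul_remainder:
  assumes \<epsilon>: "\<epsilon> > 0"
  obtains \<rho> where "\<rho> > 0"
    "\<And>z u. norm z < \<rho> \<Longrightarrow> norm u < \<rho> \<Longrightarrow> norm (mul z u - z - u) \<le> \<epsilon> * norm z"
    "\<And>z u u'. norm z < \<rho> \<Longrightarrow> norm u < \<rho> \<Longrightarrow> norm u' < \<rho> \<Longrightarrow>
      norm ((mul z u - u) - (mul z u' - u')) \<le> \<epsilon> * norm (u - u')"
proof -
  let ?F = "\<lambda>(x, y). mul x y"
  let ?D = "frechet_derivative ?F (at (0, 0))"
  have D: "(?F has_derivative ?D) (at (0, 0))" using mul_differentiable by (simp add: frechet_derivative_works[symmetric])
  have lin: "linear ?D" using D has_derivative_linear by blast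
  have D1: "?D (h, 0) = h" for h
  proof -
    have "((\<lambda>x::'a. (x, 0::'a)) has_derivative (\<lambda>h. (h, 0))) (at 0)" by (auto intro!: derivative_eq_intros)
    then have "((\<lambda>x. ?F (x, 0)) has_derivative (\<lambda>h. ?D (h, 0))) (at 0)"
      using has_derivative_compose[of "\<lambda>x. (x, 0::'a)" "\<lambda>h. (h, 0)" 0 UNIV ?F ?D] D by simp
    then have "((\<lambda>x. x) has_derivative (\<lambda>h. ?D (h, 0))) (at 0)" by simp
    then show ?thesis using has_derivative_unique[OF _ has_derivative_ident] by metis
  qed
  have D2: "?D (0, h) = h" for h
  proof -
    have "((\<lambda>x::'a. (0::'a, x)) has_derivative (\<lambda>h. (0, h))) (at 0)" by (auto intro!: derivative_eq_intros)
    then have "((\<lambda>x. ?F (0, x)) has_derivative (\<lambda>h. ?D (0, h))) (at 0)"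
      using has_derivative_compose[of "\<lambda>x. (0::'a, x)" "\<lambda>h. (0, h)" 0 UNIV ?F ?D] D by simp
    then have "((\<lambda>x. x) has_derivative (\<lambda>h. ?D (0, h))) (at 0)" by simp
    then show ?thesis using has_derivative_unique[OF _ has_derivative_ident] by metis
  qed
  have D12: "?D (h, k) = h + k" for h k
    using linear_add[OF lin, of "(h, 0)" "(0, k)"] by (simp add: D1 D2)
  obtain \<rho> where \<rho>: "\<rho> > 0" "\<epsilon>-lipschitz_on (ball (0, 0) \<rho>) (\<lambda>z. ?F z - ?D z)"
    using C1_lipschitz_remainder[OF smooth_mul \<epsilon>] by blast
  have inb: "(z, u) \<in> ball (0, 0) \<rho>" if "norm z < \<rho> / 2" "norm u < \<rho> / 2" for z u :: 'a
    using norm_Pair_le[of z u] that by (simp add: zero_prod_def[symmetric])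
  show ?thesis
  proof (rule that[of "\<rho> / 2"])
    show "\<rho> / 2 > 0" using \<rho> by simp
  next
    fix z u :: 'a assume zu: "norm z < \<rho> / 2" "norm u < \<rho> / 2"
    then have "norm ((?F (z, u) - ?D (z, u)) - (?F (0, u) - ?D (0, u))) \<le> \<epsilon> * norm ((z, u) - (0, u))"
      using \<rho>(1) by (intro lipschitz_on_normD[OF \<rho>(2)] inb) auto
    then show "norm (mul z u - z - u) \<le> \<epsilon> * norm z" by (simp add: D12 algebra_simps)
  next
    fix z u u' :: 'a assume zu: "norm z < \<rho> / 2" "norm u < \<rho> / 2" "norm u' < \<rho> / 2"
    then have "norm ((?F (z, u) - ?D (z, u)) - (?F (z, u') - ?D (z, u'))) \<le> \<epsilon> * norm ((z, u) - (z, u'))"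
      by (intro lipschitz_on_normD[OF \<rho>(2)] inb) auto
    then show "norm ((mul z u - u) - (mul z u' - u')) \<le> \<epsilon> * norm (u - u')" by (simp add: D12 algebra_simps)
  qed
qed

end

section \<open>Volumes of boxes in an orthonormal frame\<close>

definition xbox :: "(nat \<Rightarrow> 'a::euclidean_space) \<Rightarrow> (nat \<Rightarrow> real) \<Rightarrow> 'a set" where
  "xbox X a = {u. \<forall>j\<in>{1..DIM('a)}. \<bar>u \<bullet> X j\<bar> < a j}"

text \<open>The volume formula is at hand for boxes along \<open>Basis\<close>. The change of
  orthonormal frame \<open>S Y Z\<close> is 1-Lipschitz in both directions and transfers it to the
  frame \<open>X\<close>.\<close>

lemma xbox_eq_isometric_image:
  fixes X :: "nat \<Rightarrow> 'a::euclidean_space"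
  assumes X: "orthonormal_seq X" and a: "\<And>j. j \<in> {1..DIM('a)} \<Longrightarrow> 0 < a j"
  obtains f g :: "'a \<Rightarrow> 'a" and c :: 'a where "1-lipschitz_on UNIV f" "1-lipschitz_on UNIV g"
    "f ` box (- c) c = xbox X a" "g ` xbox X a = box (- c) c"
    "measure lebesgue (box (- c) c) = (\<Prod>j\<in>{1..DIM('a)}. 2 * a j)"
proof -
  let ?N = "{1..DIM('a)}"
  obtain b where b: "bij_betw b ?N (Basis :: 'a set)"
    using ex_bij_betw_nat_finite_1[OF finite_Basis] by blast
  have ob: "orthonormal_seq b"
    unfolding orthonormal_seq_def
  proof (intro ballI)
    fix i j assume ij: "i \<in> ?N" "j \<in> ?N"
    then have "b i \<in> Basis" "b j \<in> Basis" using b bij_betwE by blast+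
    moreover have "b i = b j \<longleftrightarrow> i = j" using b ij by (metis bij_betw_inv_into_left)
    ultimately show "b i \<bullet> b j = (if i = j then 1 else 0)" by (simp add: inner_Basis)
  qed
  define S where "S Y Z x = (\<Sum>j\<in>?N. (x \<bullet> Y j) *\<^sub>R Z j)" for Y Z :: "nat \<Rightarrow> 'a" and x
  have Sk: "S Y Z x \<bullet> Z k = x \<bullet> Y k" if "orthonormal_seq Z" "k \<in> ?N" for Y Z x k
    using orthonormal_seq_facts(4)[OF that(1) order_refl that(2)] that by (simp add: S_def)
  have SS: "S Z Y (S Y Z x) = x" if "orthonormal_seq Y" "orthonormal_seq Z" for Y Z x
  proof -
    have "S Z Y (S Y Z x) = (\<Sum>j\<in>?N. (x \<bullet> Y j) *\<^sub>R Y j)"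
      unfolding S_def[of Z Y] using Sk[OF that(2)] by (intro sum.cong) auto
    then show ?thesis using orthonormal_seq_expand[OF that(1), of x] by simp
  qed
  have nS: "norm (S Y Z x) = norm x" if o: "orthonormal_seq Y" "orthonormal_seq Z" for Y Z x
  proof -
    have n2: "(norm y)\<^sup>2 = (\<Sum>j\<in>?N. (y \<bullet> Z j)\<^sup>2)" if "orthonormal_seq Z" for y and Z :: "nat \<Rightarrow> 'a"
    proof -
      have "(norm y)\<^sup>2 = y \<bullet> (\<Sum>j\<in>?N. (y \<bullet> Z j) *\<^sub>R Z j)"
        using orthonormal_seq_expand[OF that, of y] by (simp add: dot_square_norm[symmetric])
      then show ?thesis by (simp add: inner_sum_right power2_eq_square)
    qed
    have "(norm (S Y Z x))\<^sup>2 = (norm x)\<^sup>2"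
      unfolding n2[OF o(2), of "S Y Z x"] n2[OF o(1), of x] using Sk[OF o(2)] by (intro sum.cong) auto
    then show ?thesis by (simp add: power2_eq_iff_nonneg)
  qed
  have lip: "1-lipschitz_on UNIV (S Y Z)" if o: "orthonormal_seq Y" "orthonormal_seq Z" for Y Z
  proof (rule lipschitz_onI)
    fix x y
    have "S Y Z x - S Y Z y = S Y Z (x - y)"
      by (simp add: S_def inner_diff_left scaleR_diff_left sum_subtractf)
    then show "dist (S Y Z x) (S Y Z y) \<le> 1 * dist x y" using nS[OF o] by (simp add: dist_norm)
  qed simp
  define c where "c = (\<Sum>j\<in>?N. a j *\<^sub>R b j)"
  have ck: "c \<bullet> b k = a k" if "k \<in> ?N" for k
    using orthonormal_seq_facts(4)[OF ob order_refl that] that by (simp add: c_def)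
  have Bq: "(\<forall>i\<in>Basis. P i) \<longleftrightarrow> (\<forall>j\<in>?N. P (b j))" for P
  proof
    assume "\<forall>i\<in>Basis. P i"
    then show "\<forall>j\<in>?N. P (b j)" using bij_betwE[OF b] by blast
  next
    assume P: "\<forall>j\<in>?N. P (b j)"
    show "\<forall>i\<in>Basis. P i"
    proof
      fix i :: 'a assume "i \<in> Basis"
      then have "i \<in> b ` ?N" using bij_betw_imp_surj_on[OF b] by simp
      then show "P i" using P by blast
    qed
  qed
  have boxb: "box (- c) c = xbox b a"
  proof -
    have "box (- c) c = {x. \<forall>j\<in>?N. - a j < x \<bullet> b j \<and> x \<bullet> b j < a j}"
      unfolding box_def Bq using ck by auto
    then show ?thesis unfolding xbox_def by (auto simp: abs_less_iff)
  qed
  have sub: "S Y Z ` xbox Y a \<subseteq> xbox Z a" if "orthonormal_seq Z" for Y Z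
    using Sk[OF that] by (auto simp: xbox_def)
  have img: "S Y Z ` xbox Y a = xbox Z a" if o: "orthonormal_seq Y" "orthonormal_seq Z" for Y Z
  proof
    show "xbox Z a \<subseteq> S Y Z ` xbox Y a"
      using sub[OF o(1), of Z] SS[OF o(2) o(1)] by (metis image_subset_iff rev_image_eqI subsetI)
  qed (rule sub[OF o(2)])
  have "measure lebesgue (box (- c) c) = (\<Prod>i\<in>Basis. c \<bullet> i - (- c) \<bullet> i)"
  proof -
    have "\<forall>i\<in>Basis. (- c) \<bullet> i \<le> c \<bullet> i"
      unfolding Bq using ck a by (auto simp: less_imp_le)
    then have "measure lborel (box (- c) c) = (\<Prod>i\<in>Basis. (c - (- c)) \<bullet> i)"
      by (intro measure_lborel_box) blast
    then show ?thesis by (simp only: inner_diff_left) (simp add: measure_completion)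
  qed
  also have "\<dots> = (\<Prod>j\<in>?N. 2 * a j)"
    using prod.reindex_bij_betw[OF b, of "\<lambda>i. c \<bullet> i - (- c) \<bullet> i"] ck by simp
  finally have m: "measure lebesgue (box (- c) c) = (\<Prod>j\<in>?N. 2 * a j)" .
  show ?thesis
    by (rule that[OF lip[OF ob X] lip[OF X ob] _ _ m]) (simp_all add: boxb img[OF ob X] img[OF X ob])
qed

text \<open>Neither of the two mutually inverse 1-Lipschitz maps can increase volume, so the boxes
  have equal volume.\<close>

lemma xbox_measure:
  fixes X :: "nat \<Rightarrow> 'a::euclidean_space"
  assumes X: "orthonormal_seq X" and a: "\<And>j. j \<in> {1..DIM('a)} \<Longrightarrow> 0 < a j"
  shows "open (xbox X a)" "xbox X a \<in> lmeasurable" "measure lebesgue (xbox X a) = (\<Prod>j\<in>{1..DIM('a)}. 2 * a j)"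
proof -
  have "xbox X a = (\<Inter>j\<in>{1..DIM('a)}. {u. \<bar>u \<bullet> X j\<bar> < a j})" by (auto simp: xbox_def)
  moreover have "open {u. \<bar>u \<bullet> X j\<bar> < a j}" for j by (intro open_Collect_less continuous_intros)
  ultimately show op: "open (xbox X a)" by (simp add: open_INT)
  obtain f g :: "'a \<Rightarrow> 'a" and c :: 'a where fg: "1-lipschitz_on UNIV f" "1-lipschitz_on UNIV g"
    "f ` box (- c) c = xbox X a" "g ` xbox X a = box (- c) c"
    "measure lebesgue (box (- c) c) = (\<Prod>j\<in>{1..DIM('a)}. 2 * a j)"
    by (rule xbox_eq_isometric_image[OF X a])
  obtain U where U: "U \<in> lmeasurable" "xbox X a \<subseteq> U" "measure lebesgue U \<le> measure lebesgue (box (- c) c)"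
    using lipschitz_image_measure[of "box (- c) c" 1 f] fg(1,3) lipschitz_on_subset[of 1 UNIV f]
    by (metis lmeasurable_box mult_1 open_box power_one top_greatest)
  show m: "xbox X a \<in> lmeasurable" using U op by (intro fmeasurableI2[OF U(1,2)]) auto
  obtain W where W: "W \<in> lmeasurable" "box (- c) c \<subseteq> W" "measure lebesgue W \<le> measure lebesgue (xbox X a)"
    using lipschitz_image_measure[OF op m lipschitz_on_subset[OF fg(2) subset_UNIV]] fg(4) by force
  have "measure lebesgue (xbox X a) \<le> measure lebesgue U" using U m by (intro measure_mono_fmeasurable) auto
  moreover have "measure lebesgue (box (- c) c) \<le> measure lebesgue W" using W by (intro measure_mono_fmeasurable) auto
  ultimately show "measure lebesgue (xbox X a) = (\<Prod>j\<in>{1..DIM('a)}. 2 * a j)" using U W fg(5) by linarith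
qed

section \<open>Counting separated sets\<close>

lemma xbox_norm_le:
  fixes X :: "nat \<Rightarrow> 'a::euclidean_space"
  assumes X: "orthonormal_seq X" and u: "u \<in> xbox X a"
  shows "norm u \<le> (\<Sum>j\<in>{1..DIM('a)}. a j)"
proof -
  have nX: "norm (X j) = 1" if "j \<in> {1..DIM('a)}" for j
    using X that unfolding orthonormal_seq_def by (simp add: norm_eq_sqrt_inner)
  have "norm u = norm (\<Sum>j\<in>{1..DIM('a)}. (u \<bullet> X j) *\<^sub>R X j)" using orthonormal_seq_expand[OF X, of u] by simp
  also have "\<dots> \<le> (\<Sum>j\<in>{1..DIM('a)}. norm ((u \<bullet> X j) *\<^sub>R X j))" by (rule norm_sum)
  also have "\<dots> \<le> (\<Sum>j\<in>{1..DIM('a)}. a j)"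
    using u nX by (intro sum_mono) (auto simp: xbox_def less_imp_le)
  finally show ?thesis .
qed

locale homogeneous_group =
  fixes mul :: "'a::euclidean_space \<Rightarrow> 'a \<Rightarrow> 'a" and V :: "nat \<Rightarrow> 'a set" and \<iota> :: nat
    and X :: "nat \<Rightarrow> 'a" and d :: "'a \<Rightarrow> 'a \<Rightarrow> real"
  assumes strat: "stratified_group mul V \<iota>" and basis: "graded_basis V \<iota> X"
    and hom: "homogeneous_distance mul V X d"

sublocale homogeneous_group \<subseteq> exp_group mul
  using strat by unfold_locales (auto simp: stratified_group_def)

context homogeneous_group
begin

abbreviation "deg \<equiv> index_degree V"

lemma X_orthonormal: "orthonormal_seq X"
  using basis unfolding graded_basis_def orthonormal_seq_def by blast

lemma deg_ge_1: "j \<in> {1..DIM('a)} \<Longrightarrow> 1 \<le> deg j"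
  using index_degree_ge_1[OF strat] .

lemma metric: "Metric_space UNIV d"
  and d_left: "d (mul z x) (mul z y) = d x y"
  and d_dilation: "r > 0 \<Longrightarrow> d (dilation V X r x) (dilation V X r y) = r * d x y"
  using hom unfolding homogeneous_distance_def by blast+

lemma d_sym: "d x y = d y x" and d_triangle: "d x z \<le> d x y + d y z" and d_nonneg: "0 \<le> d x y"
  and d_refl [simp]: "d x x = 0"
proof -
  interpret Metric_space UNIV d by (rule metric)
  show "d x y = d y x" by (rule commute)
  show "d x z \<le> d x y + d y z" by (rule triangle) auto
  show "0 \<le> d x y" by simp
  show "d x x = 0" by simp
qed

text \<open>The anisotropic box is the dilate of a fixed one; homogeneity of \<open>d\<close> then
  bounds the distance of its points from the unit by a multiple of \<open>r\<close>.\<close>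

lemma xbox_dilation:
  assumes r: "r > 0" and u: "u \<in> xbox X (\<lambda>j. \<kappa> * r ^ deg j)"
  shows "\<exists>v\<in>xbox X (\<lambda>j. \<kappa>). u = dilation V X r v"
proof -
  define v where "v = (\<Sum>j\<in>{1..DIM('a)}. ((u \<bullet> X j) / r ^ deg j) *\<^sub>R X j)"
  have vk: "v \<bullet> X k = (u \<bullet> X k) / r ^ deg k" if "k \<in> {1..DIM('a)}" for k
    unfolding v_def using orthonormal_seq_facts(4)[OF X_orthonormal order_refl that] that by simp
  have "v \<in> xbox X (\<lambda>j. \<kappa>)"
    using u r vk by (auto simp: xbox_def abs_divide pos_divide_less_eq)
  moreover have "dilation V X r v = (\<Sum>j\<in>{1..DIM('a)}. (u \<bullet> X j) *\<^sub>R X j)"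
    unfolding dilation_def using vk r by (intro sum.cong) auto
  then have "dilation V X r v = u" using orthonormal_seq_expand[OF X_orthonormal, of u] by simp
  ultimately show ?thesis by metis
qed

text \<open>A packing bound. The box lies within \<open>d\<close>-distance \<open>r / 2\<close> of
  the unit, so by left invariance its translates by an \<open>r\<close>-separated set are disjoint.
  In place of an invariant measure it suffices that left translations by small elements distort
  Euclidean volume near the unit by a bounded factor.\<close>

lemma separated_card_bound:
  obtains \<kappa> \<rho> where "0 < \<kappa>" "\<kappa> \<le> 1" "0 < \<rho>"
    "\<And>r F R. \<lbrakk>0 < r; r \<le> 1; finite F; F \<subseteq> ball 0 \<rho>; \<And>x y. x \<in> F \<Longrightarrow> y \<in> F \<Longrightarrow> x \<noteq> y \<Longrightarrow> r \<le> d x y;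
      R \<in> lmeasurable; \<And>z u. z \<in> F \<Longrightarrow> u \<in> xbox X (\<lambda>j. \<kappa> * r ^ deg j) \<Longrightarrow> mul z u \<in> R\<rbrakk> \<Longrightarrow>
      real (card F) * (\<kappa> ^ DIM('a) * (\<Prod>j\<in>{1..DIM('a)}. r ^ deg j)) \<le> measure lebesgue R"
proof -
  let ?N = "{1..DIM('a)}"
  obtain \<rho> where \<rho>: "\<rho> > 0"
    "\<And>z u u'. norm z < \<rho> \<Longrightarrow> norm u < \<rho> \<Longrightarrow> norm u' < \<rho> \<Longrightarrow>
      norm ((mul z u - u) - (mul z u' - u')) \<le> 1/2 * norm (u - u')"
    using mul_remainder[of "1/2"] by (metis half_gt_zero zero_less_one)
  have "continuous_on UNIV (\<lambda>y. d 0 y)"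
  proof -
    have "continuous_on UNIV (\<lambda>(x, y). d x y)" using hom unfolding homogeneous_distance_def by blast
    then have "continuous_on UNIV (\<lambda>y. (\<lambda>(x, y). d x y) (0, y))"
      by (rule continuous_on_compose2) (auto intro!: continuous_intros)
    then show ?thesis by simp
  qed
  then have "isCont (\<lambda>y. d 0 y) 0" by (simp add: continuous_on_eq_continuous_at)
  then have "\<exists>\<sigma>>0. \<forall>y. dist y 0 < \<sigma> \<longrightarrow> dist (d 0 y) (d 0 0) < 1/2"
    unfolding continuous_at_eps_delta by (meson half_gt_zero zero_less_one)
  then obtain \<sigma> where \<sigma>: "\<sigma> > 0" "\<And>y. norm y < \<sigma> \<Longrightarrow> d 0 y < 1/2"
    by (auto simp: dist_real_def d_nonneg)
  \<comment> \<open>Chosen so that the box with all half-sides \<open>\<kappa>\<close> stays within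
    norm \<open>\<rho>\<close>, for the translation estimate, and within norm
    \<open>\<sigma>\<close>, for the distance estimate.\<close>
  define \<kappa> where "\<kappa> = min 1 (min \<rho> \<sigma> / (2 * DIM('a)))"
  have \<kappa>: "0 < \<kappa>" "\<kappa> \<le> 1" "DIM('a) * \<kappa> < \<rho>" "DIM('a) * \<kappa> < \<sigma>"
  proof -
    show "0 < \<kappa>" "\<kappa> \<le> 1" using \<rho>(1) \<sigma>(1) by (auto simp: \<kappa>_def)
    have "DIM('a) * \<kappa> \<le> DIM('a) * (min \<rho> \<sigma> / (2 * DIM('a)))" by (intro mult_left_mono) (auto simp: \<kappa>_def)
    also have "\<dots> = min \<rho> \<sigma> / 2" by simp
    also have "\<dots> < min \<rho> \<sigma>"
    proof -
      have "0 < min \<rho> \<sigma>" using \<rho>(1) \<sigma>(1) by simp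
      then show ?thesis by linarith
    qed
    finally show "DIM('a) * \<kappa> < \<rho>" "DIM('a) * \<kappa> < \<sigma>" by auto
  qed
  show ?thesis
  proof (rule that[OF \<kappa>(1,2) \<rho>(1)])
    fix r F R
    assume r: "0 < r" "r \<le> 1" and F: "finite F" "F \<subseteq> ball 0 \<rho>"
      and sep: "\<And>x y. x \<in> F \<Longrightarrow> y \<in> F \<Longrightarrow> x \<noteq> y \<Longrightarrow> r \<le> d x y"
      and R: "R \<in> lmeasurable"
      and FR: "\<And>z u. z \<in> F \<Longrightarrow> u \<in> xbox X (\<lambda>j. \<kappa> * r ^ deg j) \<Longrightarrow> mul z u \<in> R"
    let ?B = "xbox X (\<lambda>j. \<kappa> * r ^ deg j)"
    have Bpos: "\<And>j. j \<in> ?N \<Longrightarrow> 0 < \<kappa> * r ^ deg j" using \<kappa> r by simp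
    note B = xbox_measure[OF X_orthonormal Bpos]
    have bd: "norm u < \<rho>" "d 0 u < r / 2" if u: "u \<in> ?B" for u
    proof -
      obtain v where v: "v \<in> xbox X (\<lambda>j. \<kappa>)" "u = dilation V X r v" using xbox_dilation[OF r(1) u] by blast
      have "r ^ deg j \<le> 1" for j using r by (intro power_le_one) auto
      then have "\<kappa> * r ^ deg j \<le> \<kappa>" for j using \<kappa>(1) by simp
      then have "u \<in> xbox X (\<lambda>j. \<kappa>)"
        using u unfolding xbox_def mem_Collect_eq by (meson less_le_trans)
      then have "norm u \<le> DIM('a) * \<kappa>" using xbox_norm_le[OF X_orthonormal, of u "\<lambda>j. \<kappa>"] by simp
      then show "norm u < \<rho>" using \<kappa> by linarith
      have "norm v \<le> DIM('a) * \<kappa>" using xbox_norm_le[OF X_orthonormal v(1)] by simp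
      then have "d 0 v < 1/2" using \<sigma>(2) \<kappa> by simp
      moreover have "dilation V X r 0 = 0" by (simp add: dilation_def)
      then have "d 0 u = r * d 0 v" using d_dilation[OF r(1), of 0 v] v by simp
      ultimately show "d 0 u < r / 2" using r by simp
    qed
    have zF: "norm z < \<rho>" if "z \<in> F" for z using F(2) that by auto
    define W where "W z = mul z ` ?B" for z
    have Weq: "W z = mul (- z) -` ?B" for z
      unfolding W_def by (auto simp: image_iff) (metis mul_laws(6))
    have Wopen: "open (W z)" for z
      unfolding Weq by (rule open_vimage[OF B(1) continuous_mul_left])
    have WR: "W z \<subseteq> R" if "z \<in> F" for z using FR[OF that] by (auto simp: W_def)
    have Wm: "W z \<in> lmeasurable" if "z \<in> F" for z
      using WR[OF that] R Wopen by (intro fmeasurableI2[OF R]) auto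
    have disj: "pairwise (\<lambda>z z'. disjnt (W z) (W z')) F"
      unfolding pairwise_def
    proof (intro ballI impI)
      fix z z' assume zz: "z \<in> F" "z' \<in> F" "z \<noteq> z'"
      show "disjnt (W z) (W z')"
        unfolding disjnt_def
      proof (rule ccontr)
        assume "W z \<inter> W z' \<noteq> {}"
        then obtain u u' where u: "u \<in> ?B" "u' \<in> ?B" "mul z u = mul z' u'" unfolding W_def by auto
        have "d z (mul z u) = d 0 u" "d (mul z u) z' = d 0 u'"
          using d_left[of z 0 u] d_left[of z' 0 u'] u(3) d_sym[of z'] by simp_all
        then have "d z z' < r"
          using d_triangle[of z z' "mul z u"] bd(2)[OF u(1)] bd(2)[OF u(2)] by linarith
        then show False using sep[OF zz] by simp
      qed
    qed
    \<comment> \<open>The inverse translation is 2-Lipschitz on \<open>W z\<close>; the resulting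
      loss \<open>2 ^ DIM('a)\<close> cancels because the box has full sides
      \<open>2 * \<kappa> * r ^ deg j\<close>.\<close>
    have low: "\<kappa> ^ DIM('a) * (\<Prod>j\<in>?N. r ^ deg j) \<le> measure lebesgue (W z)" if z: "z \<in> F" for z
    proof -
      have "2-lipschitz_on (W z) (mul (- z))"
      proof (rule lipschitz_onI)
        fix y y' assume "y \<in> W z" "y' \<in> W z"
        then obtain u u' where u: "u \<in> ?B" "u' \<in> ?B" "y = mul z u" "y' = mul z u'" unfolding W_def by blast
        have "norm ((y - u) - (y' - u')) \<le> 1/2 * norm (u - u')"
          unfolding u(3,4) by (intro \<rho>(2) zF z bd u)
        moreover have "norm (u - u') \<le> norm (y - y') + norm ((y - u) - (y' - u'))"
          using norm_triangle_ineq4[of "y - y'" "(y - u) - (y' - u')"] by (simp add: algebra_simps)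
        ultimately have "norm (u - u') \<le> 2 * norm (y - y')" by linarith
        then show "dist (mul (- z) y) (mul (- z) y') \<le> 2 * dist y y'" using u by (simp add: dist_norm)
      qed simp
      then obtain U where U: "U \<in> lmeasurable" "mul (- z) ` W z \<subseteq> U" "measure lebesgue U \<le> 2 ^ DIM('a) * measure lebesgue (W z)"
        using lipschitz_image_measure[OF Wopen Wm[OF z]] by blast
      have "?B \<subseteq> U" using U(2) unfolding W_def by (auto simp: image_image)
      then have "measure lebesgue ?B \<le> measure lebesgue U" using B U by (intro measure_mono_fmeasurable) auto
      moreover have "measure lebesgue ?B = 2 ^ DIM('a) * (\<kappa> ^ DIM('a) * (\<Prod>j\<in>?N. r ^ deg j))"
        using B(3) by (simp add: prod.distrib)
      ultimately have "2 ^ DIM('a) * (\<kappa> ^ DIM('a) * (\<Prod>j\<in>?N. r ^ deg j)) \<le> 2 ^ DIM('a) * measure lebesgue (W z)"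
        using U(3) by linarith
      then show ?thesis by simp
    qed
    have "real (card F) * (\<kappa> ^ DIM('a) * (\<Prod>j\<in>?N. r ^ deg j)) = (\<Sum>z\<in>F. \<kappa> ^ DIM('a) * (\<Prod>j\<in>?N. r ^ deg j))" by simp
    also have "\<dots> \<le> (\<Sum>z\<in>F. measure lebesgue (W z))" by (intro sum_mono low)
    also have "\<dots> \<le> measure lebesgue R" by (rule sum_measure_disjoint_le[OF F(1) Wm disj WR R])
    finally show "real (card F) * (\<kappa> ^ DIM('a) * (\<Prod>j\<in>?N. r ^ deg j)) \<le> measure lebesgue R" .
  qed
qed

text \<open>A separated set \<open>F\<close> of size \<open>s\<close> lying within \<open>\<epsilon> s\<close> of \<open>T\<close> is counted by the volume of the union
  of the translates of a box \<open>\<delta>\<^sub>r(xbox)\<close>. The shear \<open>y \<mapsto> y - (\<Sum>j\<in>A. (y \<bullet> X j) (e\<^sub>j - X\<^sub>j))\<close> maps \<open>T\<close>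
  into a coordinate plane and, since \<open>e\<^sub>j\<close> has no component of degree above \<open>deg j\<close>, distorts these
  boxes by a bounded factor only; hence all translates lie in the preimage of one box.\<close>

lemma separated_card_near_subspace:
  assumes T: "subspace T" and C1: "0 \<le> C1"
  obtains A K where "A \<subseteq> {1..DIM('a)}" "card A = dim T" "coord_inj X A T" "0 < K"
    "\<And>\<epsilon>. 0 < \<epsilon> \<Longrightarrow> \<epsilon> \<le> 1 \<Longrightarrow> \<exists>s0>0. \<exists>r0>0. \<forall>r s F. 0 < r \<longrightarrow> r < r0 \<longrightarrow> 0 < s \<longrightarrow> s < s0 \<longrightarrow> finite F \<longrightarrow>
      (\<forall>z\<in>F. norm z \<le> C1 * s \<and> (\<exists>t\<in>T. norm (z - t) \<le> \<epsilon> * s)) \<longrightarrow>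
      (\<forall>x\<in>F. \<forall>y\<in>F. x \<noteq> y \<longrightarrow> r \<le> d x y) \<longrightarrow>
      real (card F) \<le> K * (\<Prod>k\<in>{1..DIM('a)}. max 1 ((if k \<in> A then s else \<epsilon> * s) / r ^ deg k))"
proof -
  let ?N = "{1..DIM('a)}"
  obtain A e where A: "A \<subseteq> ?N" "card A = dim T" "coord_inj X A T"
    and e: "\<And>j. j \<in> A \<Longrightarrow> e j \<in> T" "\<And>j k. j \<in> A \<Longrightarrow> k \<in> A \<Longrightarrow> e j \<bullet> X k = (if j = k then 1 else 0)"
      "\<And>j k. j \<in> A \<Longrightarrow> k \<in> ?N - A \<Longrightarrow> e j \<bullet> X k \<noteq> 0 \<Longrightarrow> deg k \<le> deg j"
    and Texp: "\<And>t. t \<in> T \<Longrightarrow> t = (\<Sum>j\<in>A. (t \<bullet> X j) *\<^sub>R e j)"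
    by (rule weighted_echelon_basis[OF X_orthonormal T, where d=deg], rule that)
  have o: "X i \<bullet> X j = (if i = j then 1 else 0)" if "i \<in> ?N" "j \<in> ?N" for i j
    using X_orthonormal that unfolding orthonormal_seq_def by blast
  have nX: "norm (X j) = 1" if "j \<in> ?N" for j using o[OF that that] by (simp add: norm_eq_sqrt_inner)
  have inX: "\<bar>y \<bullet> X k\<bar> \<le> norm y" if "k \<in> ?N" for y k
    using Cauchy_Schwarz_ineq2[of y "X k"] nX[OF that] by simp
  define w where "w j = e j - X j" for j
  have wA: "w j \<bullet> X k = 0" if "j \<in> A" "k \<in> A" for j k
  proof -
    have "j \<in> ?N" "k \<in> ?N" using that A by blast+
    then show ?thesis using e(2)[OF that] o[of j k] by (simp add: w_def inner_diff_left)
  qed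
  have wN: "w j \<bullet> X k = e j \<bullet> X k" if "j \<in> A" "k \<in> ?N - A" for j k
    using o[of j k] that A by (auto simp: w_def inner_diff_left)
  define E where "E = (\<Sum>j\<in>A. norm (w j))"
  have E0: "0 \<le> E" by (simp add: E_def sum_nonneg)
  \<comment> \<open>\<open>\<Psi>\<close> is the shear and \<open>\<Phi>\<close> undoes it: the
    coordinates in \<open>A\<close> are unchanged, since \<open>w j\<close> has none.\<close>
  define \<Psi> where "\<Psi> y = y - (\<Sum>j\<in>A. (y \<bullet> X j) *\<^sub>R w j)" for y
  define \<Phi> where "\<Phi> y = y + (\<Sum>j\<in>A. (y \<bullet> X j) *\<^sub>R w j)" for y
  have \<Psi>A: "\<Psi> y \<bullet> X k = y \<bullet> X k" if "k \<in> A" for y k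
    using wA that by (simp add: \<Psi>_def inner_diff_left inner_sum_left)
  have \<Phi>\<Psi>: "\<Phi> (\<Psi> y) = y" for y
  proof -
    have "(\<Sum>j\<in>A. (\<Psi> y \<bullet> X j) *\<^sub>R w j) = (\<Sum>j\<in>A. (y \<bullet> X j) *\<^sub>R w j)" using \<Psi>A by (intro sum.cong) auto
    then show ?thesis by (simp add: \<Phi>_def) (simp add: \<Psi>_def)
  qed
  have sumE: "norm (\<Sum>j\<in>A. (y \<bullet> X j) *\<^sub>R w j) \<le> E * norm y" for y
  proof -
    have "norm (\<Sum>j\<in>A. (y \<bullet> X j) *\<^sub>R w j) \<le> (\<Sum>j\<in>A. norm ((y \<bullet> X j) *\<^sub>R w j))" by (rule norm_sum)
    also have "\<dots> \<le> (\<Sum>j\<in>A. norm y * norm (w j))"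
      using inX A by (intro sum_mono) (auto intro!: mult_right_mono)
    also have "\<dots> = norm y * E" by (simp add: E_def sum_distrib_left)
    finally show ?thesis by (simp add: mult.commute)
  qed
  have \<Phi>lip: "(1 + E)-lipschitz_on UNIV \<Phi>"
  proof (rule lipschitz_onI)
    fix x y
    have eq: "\<Phi> x - \<Phi> y = (x - y) + (\<Sum>j\<in>A. ((x - y) \<bullet> X j) *\<^sub>R w j)"
      by (simp add: \<Phi>_def inner_diff_left scaleR_diff_left sum_subtractf)
    have "norm (\<Phi> x - \<Phi> y) \<le> norm (x - y) + E * norm (x - y)"
      unfolding eq using norm_triangle_ineq[of "x - y"] sumE[of "x - y"] add_left_mono order_trans by blast
    then show "dist (\<Phi> x) (\<Phi> y) \<le> (1 + E) * dist x y" by (simp add: dist_norm algebra_simps)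
  qed (use E0 in simp)
  have \<Psi>add: "\<Psi> (x + y) = \<Psi> x + \<Psi> y" for x y
    by (simp add: \<Psi>_def inner_add_left scaleR_add_left sum.distrib)
  have \<Psi>n: "norm (\<Psi> y) \<le> (1 + E) * norm y" for y
    using norm_triangle_ineq4[of y "\<Sum>j\<in>A. (y \<bullet> X j) *\<^sub>R w j"] sumE[of y]
    by (simp add: \<Psi>_def algebra_simps)
  have \<Psi>T: "\<Psi> t \<bullet> X k = 0" if t: "t \<in> T" and k: "k \<in> ?N - A" for t k
  proof -
    have "\<Psi> t = (\<Sum>j\<in>A. (t \<bullet> X j) *\<^sub>R X j)"
      using Texp[OF t] by (simp add: \<Psi>_def w_def scaleR_diff_right sum_subtractf)
    then show ?thesis using orthonormal_seq_facts(4)[OF X_orthonormal A(1), of k "\<lambda>j. t \<bullet> X j"] k by simp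
  qed
  obtain \<kappa> \<rho> where \<kappa>: "0 < \<kappa>" "\<kappa> \<le> 1" "0 < \<rho>" and count:
    "\<And>r F R. \<lbrakk>0 < r; r \<le> 1; finite F; F \<subseteq> ball 0 \<rho>; \<And>x y. x \<in> F \<Longrightarrow> y \<in> F \<Longrightarrow> x \<noteq> y \<Longrightarrow> r \<le> d x y;
      R \<in> lmeasurable; \<And>z u. z \<in> F \<Longrightarrow> u \<in> xbox X (\<lambda>j. \<kappa> * r ^ deg j) \<Longrightarrow> mul z u \<in> R\<rbrakk> \<Longrightarrow>
      real (card F) * (\<kappa> ^ DIM('a) * (\<Prod>j\<in>{1..DIM('a)}. r ^ deg j)) \<le> measure lebesgue R"
    using separated_card_bound by blast
  \<comment> \<open>In a coordinate of \<open>A\<close> the contributions of \<open>u\<close>,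
    \<open>t\<close> and \<open>q\<close> add up to \<open>(3 + 2 * C1) * g k\<close>; one more
    \<open>g k\<close> gives the strict inequality of an open box. The factor \<open>1 + E\<close>
    bounds the shear.\<close>
  define C2 where "C2 = (1 + E) * (4 + 2 * C1)"
  have C2: "C2 > 0" using E0 C1 by (simp add: C2_def)
  define K where "K = ((1 + E) * (2 * C2) / \<kappa>) ^ DIM('a)"
  have K: "K > 0" using E0 C2 \<kappa> by (simp add: K_def)
  show ?thesis
  proof (rule that[OF A K])
    fix \<epsilon> :: real assume \<epsilon>: "0 < \<epsilon>" "\<epsilon> \<le> 1"
    obtain \<rho>' where \<rho>': "\<rho>' > 0"
      "\<And>z u. norm z < \<rho>' \<Longrightarrow> norm u < \<rho>' \<Longrightarrow> norm (mul z u - z - u) \<le> \<epsilon> * norm z"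
      using mul_remainder[OF \<epsilon>(1)] by metis
    \<comment> \<open>These thresholds keep \<open>z\<close> and \<open>u\<close> where the
      remainder estimate and the packing bound are valid.\<close>
    define s0 where "s0 = min \<rho> \<rho>' / (C1 + 1)"
    define r0 where "r0 = min 1 (\<rho>' / DIM('a))"
    have s0: "s0 > 0" using \<kappa> \<rho>' C1 by (simp add: s0_def)
    have r0: "r0 > 0" using \<rho>' by (simp add: r0_def)
    have main: "real (card F) \<le> K * (\<Prod>k\<in>?N. max 1 ((if k \<in> A then s else \<epsilon> * s) / r ^ deg k))"
      if r: "0 < r" "r < r0" and s: "0 < s" "s < s0" and F: "finite F"
        and near: "\<forall>z\<in>F. norm z \<le> C1 * s \<and> (\<exists>t\<in>T. norm (z - t) \<le> \<epsilon> * s)"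
        and sep: "\<forall>x\<in>F. \<forall>y\<in>F. x \<noteq> y \<longrightarrow> r \<le> d x y" for r s F
    proof -
      have r1: "r \<le> 1" using r by (simp add: r0_def)
      have "(C1 + 1) * s < min \<rho> \<rho>'" using s C1 by (simp add: s0_def pos_less_divide_eq mult.commute)
      then have C1s: "C1 * s < \<rho>" "C1 * s < \<rho>'" using s by (auto simp: algebra_simps)
      have F\<rho>: "F \<subseteq> ball 0 \<rho>" using near C1s by fastforce
      \<comment> \<open>Width of the region after the shear: the side of the box or the extent of
        the set, whichever is larger. The extent is \<open>s\<close> along \<open>A\<close> and
        \<open>\<epsilon> * s\<close> across.\<close>
      define g where "g k = max (r ^ deg k) (if k \<in> A then s else \<epsilon> * s)" for k
      have g: "0 < g k" "r ^ deg k \<le> g k" "(if k \<in> A then s else \<epsilon> * s) \<le> g k" for k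
        using r by (auto simp: g_def less_max_iff_disj)
      let ?B = "xbox X (\<lambda>j. C2 * g j)"
      have Bpos: "\<And>j. j \<in> ?N \<Longrightarrow> 0 < C2 * g j" using C2 g by simp
      note B = xbox_measure[OF X_orthonormal Bpos]
      obtain U where U: "U \<in> lmeasurable" "\<Phi> ` ?B \<subseteq> U" "measure lebesgue U \<le> (1 + E) ^ DIM('a) * measure lebesgue ?B"
        by (rule lipschitz_image_measure[OF B(1,2) lipschitz_on_subset[OF \<Phi>lip subset_UNIV]])
      have inU: "mul z u \<in> U" if z: "z \<in> F" and u: "u \<in> xbox X (\<lambda>j. \<kappa> * r ^ deg j)" for z u
      proof -
        have uk: "\<bar>u \<bullet> X k\<bar> \<le> r ^ deg k" if k: "k \<in> ?N" for k
        proof -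
          have "\<bar>u \<bullet> X k\<bar> < \<kappa> * r ^ deg k" using u k by (simp add: xbox_def)
          also have "\<dots> \<le> 1 * r ^ deg k" using \<kappa> r by (intro mult_right_mono) auto
          finally show ?thesis by simp
        qed
        have "norm u \<le> (\<Sum>j\<in>?N. \<kappa> * r ^ deg j)" by (rule xbox_norm_le[OF X_orthonormal u])
        also have "\<dots> \<le> (\<Sum>j\<in>?N. r)"
        proof (intro sum_mono)
          fix j assume "j \<in> ?N"
          then have "r ^ deg j \<le> r ^ 1" using deg_ge_1 r r1 by (intro power_decreasing) auto
          then show "\<kappa> * r ^ deg j \<le> r" using mult_mono[of \<kappa> 1 "r ^ deg j" r] \<kappa> r by simp
        qed
        also have "\<dots> < \<rho>'" using r by (simp add: r0_def pos_less_divide_eq mult.commute)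
        finally have nu: "norm u < \<rho>'" .
        obtain t where t: "t \<in> T" "norm (z - t) \<le> \<epsilon> * s" using near z by blast
        have nz: "norm z \<le> C1 * s" using near z by blast
        \<comment> \<open>\<open>q\<close> collects the error of the group law and the distance from
          \<open>T\<close>, both of order \<open>\<epsilon> * s\<close>.\<close>
        define q where "q = (mul z u - z - u) + (z - t)"
        have y: "mul z u = u + t + q" by (simp add: q_def)
        have "norm (mul z u - z - u) \<le> \<epsilon> * norm z" using nz C1s nu by (intro \<rho>'(2)) auto
        also have "\<dots> \<le> \<epsilon> * (C1 * s)" using nz \<epsilon> by (intro mult_left_mono) auto
        finally have "norm q \<le> \<epsilon> * (C1 * s) + \<epsilon> * s"
          using t(2) norm_triangle_ineq[of "mul z u - z - u" "z - t"] by (simp add: q_def)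
        then have q: "norm q \<le> (1 + C1) * (\<epsilon> * s)" by (simp add: algebra_simps)
        have \<epsilon>s: "\<epsilon> * s \<le> s" using \<epsilon> s by simp
        have nt: "norm t \<le> (1 + C1) * s"
          using norm_triangle_ineq4[of z "z - t"] nz t(2) \<epsilon>s by (simp add: algebra_simps)
        have "\<bar>\<Psi> (mul z u) \<bullet> X k\<bar> < C2 * g k" if k: "k \<in> ?N" for k
        proof (cases "k \<in> A")
          case True
          have "\<bar>mul z u \<bullet> X k\<bar> \<le> \<bar>u \<bullet> X k\<bar> + \<bar>t \<bullet> X k\<bar> + \<bar>q \<bullet> X k\<bar>" unfolding y by (simp add: inner_add_left)
          also have "\<dots> \<le> r ^ deg k + (1 + C1) * s + (1 + C1) * (\<epsilon> * s)"
            using uk[OF k] inX[OF k, of t] inX[OF k, of q] nt q by linarith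
          also have "\<dots> \<le> g k + (1 + C1) * g k + (1 + C1) * g k"
            using g(2)[of k] g(3)[of k] True \<epsilon>s C1 by (intro add_mono mult_left_mono) auto
          also have "\<dots> < (4 + 2 * C1) * g k" using g(1)[of k] by (simp add: algebra_simps)
          also have "\<dots> \<le> C2 * g k"
            unfolding C2_def using E0 C1 g(1)[of k] by (intro mult_right_mono) (auto simp: mult_le_cancel_right1)
          finally show ?thesis using \<Psi>A[OF True] by simp
        next
          case False
          \<comment> \<open>Across \<open>A\<close> the shear removes \<open>t\<close>. For
            \<open>u\<close>, a term with \<open>e j \<bullet> X k \<noteq> 0\<close> has
            \<open>deg k \<le> deg j\<close>, so its size \<open>r ^ deg j\<close> is at most
            \<open>r ^ deg k\<close>.\<close>
          then have kA: "k \<in> ?N - A" using k by blast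
          have "\<bar>\<Psi> u \<bullet> X k\<bar> \<le> \<bar>u \<bullet> X k\<bar> + \<bar>\<Sum>j\<in>A. (u \<bullet> X j) * (w j \<bullet> X k)\<bar>"
            by (simp add: \<Psi>_def inner_diff_left inner_sum_left)
          also have "\<bar>\<Sum>j\<in>A. (u \<bullet> X j) * (w j \<bullet> X k)\<bar> \<le> (\<Sum>j\<in>A. \<bar>(u \<bullet> X j) * (w j \<bullet> X k)\<bar>)" by (rule sum_abs)
          also have "\<dots> \<le> (\<Sum>j\<in>A. r ^ deg k * norm (w j))"
          proof (intro sum_mono)
            fix j assume j: "j \<in> A"
            show "\<bar>(u \<bullet> X j) * (w j \<bullet> X k)\<bar> \<le> r ^ deg k * norm (w j)"
            proof (cases "e j \<bullet> X k = 0")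
              case True
              then show ?thesis using wN[OF j kA] r by simp
            next
              case False
              then have "deg k \<le> deg j" using e(3)[OF j kA] by blast
              then have "r ^ deg j \<le> r ^ deg k" using r r1 by (intro power_decreasing) auto
              then have "\<bar>u \<bullet> X j\<bar> \<le> r ^ deg k" using uk[of j] j A by auto
              then show ?thesis unfolding abs_mult using inX[OF k, of "w j"] by (intro mult_mono) auto
            qed
          qed
          also have "\<dots> = r ^ deg k * E" by (simp add: E_def sum_distrib_left)
          finally have 1: "\<bar>\<Psi> u \<bullet> X k\<bar> \<le> (1 + E) * r ^ deg k" using uk[OF k] by (simp add: algebra_simps)
          have "\<bar>\<Psi> q \<bullet> X k\<bar> \<le> (1 + E) * norm q" using inX[OF k, of "\<Psi> q"] \<Psi>n[of q] by linarith
          also have "\<dots> \<le> (1 + E) * ((1 + C1) * (\<epsilon> * s))" using q E0 by (intro mult_left_mono) auto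
          finally have 2: "\<bar>\<Psi> q \<bullet> X k\<bar> \<le> (1 + E) * ((1 + C1) * (\<epsilon> * s))" .
          have "\<Psi> (mul z u) \<bullet> X k = \<Psi> u \<bullet> X k + \<Psi> q \<bullet> X k"
            unfolding y \<Psi>add inner_add_left using \<Psi>T[OF t(1) kA] by simp
          then have "\<bar>\<Psi> (mul z u) \<bullet> X k\<bar> \<le> (1 + E) * (r ^ deg k + (1 + C1) * (\<epsilon> * s))"
            using 1 2 by (simp add: distrib_left)
          also have "\<dots> \<le> (1 + E) * (g k + (1 + C1) * g k)"
            using g(2)[of k] g(3)[of k] False C1 E0 by (intro mult_left_mono add_mono) auto
          also have "\<dots> < (1 + E) * ((4 + 2 * C1) * g k)"
          proof -
            have "0 < (2 + C1) * g k" using C1 g(1)[of k] by simp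
            then have "g k + (1 + C1) * g k < (4 + 2 * C1) * g k" by (simp add: algebra_simps)
            then show ?thesis using E0 by simp
          qed
          finally show ?thesis by (simp add: C2_def mult.assoc)
        qed
        then have "\<Psi> (mul z u) \<in> ?B" by (simp add: xbox_def)
        then have "\<Phi> (\<Psi> (mul z u)) \<in> U" using U(2) by blast
        then show ?thesis by (simp add: \<Phi>\<Psi>)
      qed
      have "real (card F) * (\<kappa> ^ DIM('a) * (\<Prod>j\<in>?N. r ^ deg j)) \<le> measure lebesgue U"
        using sep by (intro count[OF r(1) r1 F F\<rho> _ U(1) inU]) auto
      also have "\<dots> \<le> (1 + E) ^ DIM('a) * (\<Prod>j\<in>?N. 2 * (C2 * g j))" using U(3) B(3) by simp
      also have "\<dots> = ((1 + E) * (2 * C2)) ^ DIM('a) * (\<Prod>j\<in>?N. g j)"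
        by (simp add: prod.distrib power_mult_distrib)
      finally have "real (card F) \<le> ((1 + E) * (2 * C2)) ^ DIM('a) * (\<Prod>j\<in>?N. g j) / (\<kappa> ^ DIM('a) * (\<Prod>j\<in>?N. r ^ deg j))"
        using \<kappa> r by (subst pos_le_divide_eq) (auto intro!: mult_pos_pos prod_pos)
      also have "\<dots> = K * (\<Prod>j\<in>?N. g j / r ^ deg j)"
        by (simp add: K_def prod_dividef power_divide)
      also have "(\<Prod>j\<in>?N. g j / r ^ deg j) = (\<Prod>k\<in>?N. max 1 ((if k \<in> A then s else \<epsilon> * s) / r ^ deg k))"
      proof (intro prod.cong refl)
        fix k
        have "max (r ^ deg k) b / r ^ deg k = max 1 (b / r ^ deg k)" for b
          using r by (auto simp: max_def field_simps)
        then show "g k / r ^ deg k = max 1 ((if k \<in> A then s else \<epsilon> * s) / r ^ deg k)" by (simp add: g_def)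
      qed
      finally show ?thesis .
    qed
    then show "\<exists>s0>0. \<exists>r0>0. \<forall>r s F. 0 < r \<longrightarrow> r < r0 \<longrightarrow> 0 < s \<longrightarrow> s < s0 \<longrightarrow> finite F \<longrightarrow>
      (\<forall>z\<in>F. norm z \<le> C1 * s \<and> (\<exists>t\<in>T. norm (z - t) \<le> \<epsilon> * s)) \<longrightarrow>
      (\<forall>x\<in>F. \<forall>y\<in>F. x \<noteq> y \<longrightarrow> r \<le> d x y) \<longrightarrow>
      real (card F) \<le> K * (\<Prod>k\<in>{1..DIM('a)}. max 1 ((if k \<in> A then s else \<epsilon> * s) / r ^ deg k))"
      using s0 r0 by blast
  qed
qed

end

section \<open>From separated sets to the Hausdorff premeasure\<close>

text \<open>The cover is padded with empty sets, which by convention contribute 0 even for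
  \<open>k = 0\<close>.\<close>

lemma hausdorff_premeasure_le_finite:
  assumes "finite I" "E \<subseteq> (\<Union>i\<in>I. B i)" "\<And>i. i \<in> I \<Longrightarrow> ediam d (B i) \<le> ennreal s" "s \<le> \<delta>" "0 \<le> s"
  shows "hausdorff_premeasure d k \<delta> E \<le> ennreal (real (card I) * s ^ k)"
proof -
  obtain f where f: "bij_betw f {..<card I} I" using ex_bij_betw_nat_finite[OF \<open>finite I\<close>] atLeast0LessThan by metis
  define A where "A i = (if i < card I then B (f i) else {})" for i
  have fI: "f i \<in> I" if "i < card I" for i using f that bij_betwE by blast
  have dA: "ediam d (A i) \<le> ennreal s" for i
    using assms(3)[OF fI[of i]] by (auto simp: A_def ediam_def bot_ennreal)
  have cov: "E \<subseteq> (\<Union>i. A i)"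
  proof
    fix x assume "x \<in> E"
    then obtain j where j: "j \<in> I" "x \<in> B j" using assms(2) by blast
    then obtain i where "i < card I" "f i = j" using f by (metis bij_betw_imp_surj_on imageE lessThan_iff)
    then show "x \<in> (\<Union>i. A i)" using j by (auto simp: A_def intro!: exI[of _ i])
  qed
  have "hausdorff_premeasure d k \<delta> E \<le> (\<Sum>i. if A i = {} then 0 else ediam d (A i) ^ k)"
    unfolding hausdorff_premeasure_def
  proof (rule INF_lower, intro CollectI conjI allI cov)
    show "ediam d (A i) \<le> ennreal \<delta>" for i using dA[of i] ennreal_leI[OF \<open>s \<le> \<delta>\<close>] by (rule order_trans)
  qed
  also have "\<dots> = (\<Sum>i<card I. if A i = {} then 0 else ediam d (A i) ^ k)"
    by (intro suminf_finite) (auto simp: A_def)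
  also have "\<dots> \<le> (\<Sum>i<card I. ennreal s ^ k)"
    using dA by (intro sum_mono) (auto intro: power_mono)
  also have "\<dots> = ennreal (real (card I) * s ^ k)"
    using \<open>0 \<le> s\<close> by (simp add: ennreal_mult ennreal_power ennreal_of_nat_eq_real_of_nat)
  finally show ?thesis .
qed

text \<open>A maximal \<open>r\<close>-separated set is an \<open>r\<close>-net, and moving it back
  by \<open>x\<close> is an isometry of \<open>d\<close>. The bound \<open>N\<close> ensures that a
  separated set of greatest cardinality exists.\<close>

lemma (in homogeneous_group) premeasure_le_of_separated:
  assumes r: "0 < r" "2 * r \<le> \<delta>"
    and card: "\<And>F. finite F \<Longrightarrow> F \<subseteq> mul (- x) ` Y \<Longrightarrow> (\<forall>y\<in>F. \<forall>z\<in>F. y \<noteq> z \<longrightarrow> r \<le> d y z) \<Longrightarrow> real (card F) \<le> N"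
  shows "hausdorff_premeasure d k \<delta> Y \<le> ennreal (N * (2 * r) ^ k)"
proof -
  let ?P = "\<lambda>F. finite F \<and> F \<subseteq> mul (- x) ` Y \<and> (\<forall>y\<in>F. \<forall>z\<in>F. y \<noteq> z \<longrightarrow> r \<le> d y z)"
  have "\<forall>F. ?P F \<longrightarrow> card F < Suc (nat \<lfloor>N\<rfloor>)" using card by (auto simp: le_nat_floor less_Suc_eq_le)
  moreover have "?P {}" by simp
  ultimately have "\<exists>F. ?P F \<and> (\<forall>G. ?P G \<longrightarrow> card G \<le> card F)"
    by (intro Lattices_Big.ex_has_greatest_nat[of ?P "{}" card "Suc (nat \<lfloor>N\<rfloor>)"])
  then obtain F where FF: "?P F \<and> (\<forall>G. ?P G \<longrightarrow> card G \<le> card F)" ..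
  have F: "?P F" "?P G \<Longrightarrow> card G \<le> card F" for G using FF by blast+
  define B where "B z = {y. d (mul x z) y \<le> r}" for z
  have cov: "Y \<subseteq> (\<Union>z\<in>F. B z)"
  proof
    fix y assume y: "y \<in> Y"
    define w where "w = mul (- x) y"
    have "\<exists>z\<in>F. d z w \<le> r"
    proof (rule ccontr)
      assume n: "\<not> (\<exists>z\<in>F. d z w \<le> r)"
      then have "w \<notin> F" using r by force
      have "?P (insert w F)"
        using F(1) n y d_sym[of w] by (auto simp: w_def not_le less_imp_le)
      then have "card (insert w F) \<le> card F" by (rule F(2))
      then show False using \<open>w \<notin> F\<close> F(1) by simp
    qed
    then obtain z where z: "z \<in> F" "d z w \<le> r" by blast
    have "d (mul x z) y = d z w" using d_left[of x z w] by (simp add: w_def)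
    then have "y \<in> B z" using z(2) by (simp add: B_def)
    then show "y \<in> (\<Union>z\<in>F. B z)" using z(1) by blast
  qed
  have "ediam d (B z) \<le> ennreal (2 * r)" for z
    unfolding ediam_def
  proof (intro SUP_least ennreal_leI)
    fix a b assume "a \<in> B z" "b \<in> B z"
    then show "d a b \<le> 2 * r" using d_triangle[of a b "mul x z"] d_sym[of a] by (auto simp: B_def)
  qed
  then have "hausdorff_premeasure d k \<delta> Y \<le> ennreal (real (card F) * (2 * r) ^ k)"
    using F(1) r by (intro hausdorff_premeasure_le_finite[OF _ cov]) auto
  also have "\<dots> \<le> ennreal (N * (2 * r) ^ k)"
    using card F(1) r by (intro ennreal_leI mult_right_mono) auto
  finally show ?thesis .
qed

section \<open>Local estimates of the Hausdorff premeasure\<close>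

context homogeneous_group
begin

text \<open>Differentiating both compositions of the translations by \<open>x\<close> and
  \<open>- x\<close> shows that \<open>D\<close> inverts the left-invariant frame at
  \<open>x\<close>.\<close>

lemma left_translation_derivative:
  obtains D where "(mul (- x) has_derivative D) (at x)"
    "\<And>v. D (left_inv_field mul v x) = v"
    "\<And>v. left_inv_field mul (D v) x = v" "linear (\<lambda>v. left_inv_field mul v x)"
proof -
  let ?E = "\<lambda>v. left_inv_field mul v x"
  obtain D where D: "(mul (- x) has_derivative D) (at x)"
    using mul_left_differentiable unfolding differentiable_def by blast
  have E: "(mul x has_derivative ?E) (at 0)"
    unfolding left_inv_field_def using mul_left_differentiable by (simp add: frechet_derivative_works[symmetric])
  have "((\<lambda>v. mul (- x) (mul x v)) has_derivative (\<lambda>v. D (?E v))) (at 0)"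
    using has_derivative_compose[OF E, of "mul (- x)" D] D by simp
  then have "((\<lambda>v. v) has_derivative (\<lambda>v. D (?E v))) (at 0)" by simp
  then have 1: "D (?E v) = v" for v using has_derivative_unique[OF _ has_derivative_ident] by metis
  have "((\<lambda>v. mul x (mul (- x) v)) has_derivative (\<lambda>v. ?E (D v))) (at x)"
    using has_derivative_compose[OF D, of "mul x" ?E] E by simp
  then have "((\<lambda>v. v) has_derivative (\<lambda>v. ?E (D v))) (at x)" by simp
  then have 2: "?E (D v) = v" for v using has_derivative_unique[OF _ has_derivative_ident] by metis
  show ?thesis by (rule that[OF D 1 2 has_derivative_linear[OF E]])
qed

text \<open>The set is moved to the unit, where the counting estimate applies; \<open>C1\<close>
  bounds the stretching of this translation near \<open>x\<close>. Since \<open>A\<close> and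
  \<open>K\<close> are fixed before \<open>\<epsilon>\<close>, the latter can be chosen in terms of
  them.\<close>

lemma premeasure_near_subspace:
  assumes T: "subspace T"
    and near: "\<And>\<epsilon>. \<epsilon> > 0 \<Longrightarrow> \<exists>s0>0. \<forall>y\<in>S. norm (y - x) < s0 \<longrightarrow>
      (\<exists>t\<in>T. norm (mul (- x) y - t) \<le> \<epsilon> * norm (y - x))"
  obtains A K where "A \<subseteq> {1..DIM('a)}" "card A = dim T" "coord_inj X A T" "0 < K"
    "\<And>\<epsilon>. 0 < \<epsilon> \<Longrightarrow> \<epsilon> \<le> 1 \<Longrightarrow> \<exists>s0>0. \<exists>r0>0. \<forall>r s \<delta>. 0 < r \<longrightarrow> r < r0 \<longrightarrow> 0 < s \<longrightarrow> s < s0 \<longrightarrow> 2 * r \<le> \<delta> \<longrightarrow>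
      hausdorff_premeasure d k \<delta> (S \<inter> cball x s) \<le>
      ennreal (K * (\<Prod>k\<in>{1..DIM('a)}. max 1 ((if k \<in> A then s else \<epsilon> * s) / r ^ deg k)) * (2 * r) ^ k)"
proof -
  obtain D where D: "(mul (- x) has_derivative D) (at x)" using left_translation_derivative by blast
  then obtain B where B: "\<And>h. norm (D h) \<le> norm h * B"
    using bounded_linear.bounded[OF has_derivative_bounded_linear] by blast
  obtain s1 where s1: "s1 > 0"
    "\<And>y. norm (y - x) < s1 \<Longrightarrow> norm (mul (- x) y - mul (- x) x - D (y - x)) \<le> 1 * norm (y - x)"
    using D unfolding has_derivative_at_alt by (metis zero_less_one)
  define C1 where "C1 = max 0 B + 1"
  have C1: "0 \<le> C1" by (simp add: C1_def)
  have nz: "norm (mul (- x) y) \<le> C1 * norm (y - x)" if "norm (y - x) < s1" for y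
  proof -
    have "norm (mul (- x) y) \<le> norm (mul (- x) y - D (y - x)) + norm (D (y - x))"
      using norm_triangle_ineq[of "mul (- x) y - D (y - x)" "D (y - x)"] by simp
    also have "\<dots> \<le> 1 * norm (y - x) + norm (y - x) * B" using s1(2)[OF that] B[of "y - x"] by simp
    also have "\<dots> \<le> 1 * norm (y - x) + norm (y - x) * max 0 B" by (intro add_left_mono mult_left_mono) auto
    finally show ?thesis by (simp add: C1_def algebra_simps)
  qed
  obtain A K where A: "A \<subseteq> {1..DIM('a)}" "card A = dim T" "coord_inj X A T" and K: "0 < K"
    and count: "\<And>\<epsilon>. 0 < \<epsilon> \<Longrightarrow> \<epsilon> \<le> 1 \<Longrightarrow> \<exists>s0>0. \<exists>r0>0. \<forall>r s F. 0 < r \<longrightarrow> r < r0 \<longrightarrow> 0 < s \<longrightarrow> s < s0 \<longrightarrow> finite F \<longrightarrow>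
      (\<forall>z\<in>F. norm z \<le> C1 * s \<and> (\<exists>t\<in>T. norm (z - t) \<le> \<epsilon> * s)) \<longrightarrow>
      (\<forall>x\<in>F. \<forall>y\<in>F. x \<noteq> y \<longrightarrow> r \<le> d x y) \<longrightarrow>
      real (card F) \<le> K * (\<Prod>k\<in>{1..DIM('a)}. max 1 ((if k \<in> A then s else \<epsilon> * s) / r ^ deg k))"
    by (rule separated_card_near_subspace[OF T C1], rule that)
  show ?thesis
  proof (rule that[OF A K])
    fix \<epsilon> :: real assume \<epsilon>: "0 < \<epsilon>" "\<epsilon> \<le> 1"
    obtain s2 where s2: "s2 > 0" "\<And>y. y \<in> S \<Longrightarrow> norm (y - x) < s2 \<Longrightarrow>
      (\<exists>t\<in>T. norm (mul (- x) y - t) \<le> \<epsilon> * norm (y - x))" using near[OF \<epsilon>(1)] by blast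
    obtain s3 r0 where s3: "s3 > 0" "r0 > 0" and cnt: "\<And>r s F. 0 < r \<Longrightarrow> r < r0 \<Longrightarrow> 0 < s \<Longrightarrow> s < s3 \<Longrightarrow> finite F \<Longrightarrow>
      (\<forall>z\<in>F. norm z \<le> C1 * s \<and> (\<exists>t\<in>T. norm (z - t) \<le> \<epsilon> * s)) \<Longrightarrow>
      (\<forall>x\<in>F. \<forall>y\<in>F. x \<noteq> y \<longrightarrow> r \<le> d x y) \<Longrightarrow>
      real (card F) \<le> K * (\<Prod>k\<in>{1..DIM('a)}. max 1 ((if k \<in> A then s else \<epsilon> * s) / r ^ deg k))"
      using count[OF \<epsilon>] by blast
    define s0 where "s0 = min s1 (min s2 s3)"
    have s0: "s0 > 0" "s0 \<le> s1" "s0 \<le> s2" "s0 \<le> s3" using s1 s2 s3 by (auto simp: s0_def)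
    have "hausdorff_premeasure d k \<delta> (S \<inter> cball x s) \<le>
      ennreal (K * (\<Prod>k\<in>{1..DIM('a)}. max 1 ((if k \<in> A then s else \<epsilon> * s) / r ^ deg k)) * (2 * r) ^ k)"
      if r: "0 < r" "r < r0" and s: "0 < s" "s < s0" and \<delta>: "2 * r \<le> \<delta>" for r s \<delta>
    proof (rule premeasure_le_of_separated[OF r(1) \<delta>])
      fix F assume F: "finite F" "F \<subseteq> mul (- x) ` (S \<inter> cball x s)" "\<forall>y\<in>F. \<forall>z\<in>F. y \<noteq> z \<longrightarrow> r \<le> d y z"
      have "norm z \<le> C1 * s \<and> (\<exists>t\<in>T. norm (z - t) \<le> \<epsilon> * s)" if zF: "z \<in> F" for z
      proof -
        obtain y where y: "y \<in> S" "norm (y - x) \<le> s" "z = mul (- x) y"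
          using subsetD[OF F(2) zF] by (auto simp: dist_norm norm_minus_commute)
        have "norm z \<le> C1 * norm (y - x)" unfolding y(3) using y s s0 by (intro nz) linarith
        also have "\<dots> \<le> C1 * s" using y C1 by (intro mult_left_mono) auto
        finally have 1: "norm z \<le> C1 * s" .
        obtain t where t: "t \<in> T" "norm (z - t) \<le> \<epsilon> * norm (y - x)"
          using s2(2)[OF y(1)] y s s0 by fastforce
        have "\<epsilon> * norm (y - x) \<le> \<epsilon> * s" using y \<epsilon> by (intro mult_left_mono) auto
        then show ?thesis using 1 t by force
      qed
      then show "real (card F) \<le> K * (\<Prod>k\<in>{1..DIM('a)}. max 1 ((if k \<in> A then s else \<epsilon> * s) / r ^ deg k))"
        using r s s0 F by (intro cnt) auto
    qed
    then show "\<exists>s0>0. \<exists>r0>0. \<forall>r s \<delta>. 0 < r \<longrightarrow> r < r0 \<longrightarrow> 0 < s \<longrightarrow> s < s0 \<longrightarrow> 2 * r \<le> \<delta> \<longrightarrow>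
      hausdorff_premeasure d k \<delta> (S \<inter> cball x s) \<le>
      ennreal (K * (\<Prod>k\<in>{1..DIM('a)}. max 1 ((if k \<in> A then s else \<epsilon> * s) / r ^ deg k)) * (2 * r) ^ k)"
      using s0(1) s3(2) by blast
  qed
qed

text \<open>Taking the whole space as the subspace makes closeness trivial, so the estimate covers
  the full ball and is available at singular points. The constant depends on \<open>x\<close>,
  through the derivative of left translation.\<close>

lemma premeasure_bounded_at:
  assumes p: "1 \<le> p" "p \<le> DIM('a)"
  shows "\<exists>C. \<forall>\<delta>>0. \<forall>\<sigma>>0. \<exists>s>0. s < \<sigma> \<and>
    hausdorff_premeasure d (max_degree V p) \<delta> (cball x s) \<le> ennreal (C * s ^ p)"
proof -
  let ?N = "{1..DIM('a)}" and ?D = "max_degree V p"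
  obtain B m where B: "B \<subseteq> ?N" "card B = p" "sum deg B = ?D" and m: "m \<in> deg ` B"
    "\<And>j. j \<in> B \<Longrightarrow> m \<le> deg j" "\<And>k. k \<in> ?N - B \<Longrightarrow> deg k \<le> m"
    by (rule max_degree_attained[OF p, of V], rule that)
  have m1: "1 \<le> m" using m(1) B(1) deg_ge_1 by blast
  have near: "\<exists>s0>0. \<forall>y\<in>UNIV. norm (y - x) < s0 \<longrightarrow> (\<exists>t\<in>UNIV. norm (mul (- x) y - t) \<le> \<epsilon> * norm (y - x))"
    if "\<epsilon> > 0" for \<epsilon>
  proof (intro exI[of _ 1] conjI ballI impI)
    fix y
    show "\<exists>t\<in>UNIV. norm (mul (- x) y - t) \<le> \<epsilon> * norm (y - x)"
      by (rule bexI[of _ "mul (- x) y"]) (use that in auto)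
  qed simp
  obtain A K where A: "A \<subseteq> ?N" "card A = dim (UNIV :: 'a set)" and K: "0 < K"
    and est: "\<And>\<epsilon>. 0 < \<epsilon> \<Longrightarrow> \<epsilon> \<le> 1 \<Longrightarrow> \<exists>s0>0. \<exists>r0>0. \<forall>r s \<delta>. 0 < r \<longrightarrow> r < r0 \<longrightarrow> 0 < s \<longrightarrow> s < s0 \<longrightarrow> 2 * r \<le> \<delta> \<longrightarrow>
      hausdorff_premeasure d ?D \<delta> (UNIV \<inter> cball x s) \<le>
      ennreal (K * (\<Prod>k\<in>?N. max 1 ((if k \<in> A then s else \<epsilon> * s) / r ^ deg k)) * (2 * r) ^ ?D)"
    by (rule premeasure_near_subspace[OF subspace_UNIV near, of ?D], assumption, rule that)
  \<comment> \<open>With \<open>\<epsilon> = 1\<close> both branches of the conditional coincide,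
    and \<open>A\<close> disappears.\<close>
  obtain s0 r0 where s0: "s0 > 0" "r0 > 0" and bnd: "\<And>r s \<delta>. 0 < r \<Longrightarrow> r < r0 \<Longrightarrow> 0 < s \<Longrightarrow> s < s0 \<Longrightarrow> 2 * r \<le> \<delta> \<Longrightarrow>
      hausdorff_premeasure d ?D \<delta> (cball x s) \<le> ennreal (K * (\<Prod>k\<in>?N. max 1 (s / r ^ deg k)) * (2 * r) ^ ?D)"
    using est[OF zero_less_one order_refl] unfolding mult_1 if_cancel Int_UNIV_left by blast
  have "\<exists>s>0. s < \<sigma> \<and> hausdorff_premeasure d ?D \<delta> (cball x s) \<le> ennreal ((K * 2 ^ ?D) * s ^ p)"
    if \<delta>: "\<delta> > 0" and \<sigma>: "\<sigma> > 0" for \<delta> \<sigma>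
  proof -
    define r where "r = min 1 (min r0 (min s0 (min \<sigma> \<delta>))) / 2"
    have r: "0 < r" "r < r0" "r < s0" "r < \<sigma>" "2 * r \<le> \<delta>" "r \<le> 1" using \<delta> \<sigma> s0 by (auto simp: r_def)
    have rm: "r ^ m \<le> r" using power_decreasing[of 1 m r] m1 r by simp
    have "hausdorff_premeasure d ?D \<delta> (cball x (r ^ m)) \<le>
        ennreal (K * (\<Prod>k\<in>?N. max 1 (r ^ m / r ^ deg k)) * (2 * r) ^ ?D)"
      using r rm by (intro bnd) auto
    also have "\<dots> \<le> ennreal ((K * 2 ^ ?D) * (r ^ m) ^ p)"
    proof (rule ennreal_leI)
      have "(\<Prod>k\<in>?N. max 1 (r ^ m / r ^ deg k)) * r ^ ?D \<le> (r ^ m) ^ p"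
        using prod_quotients_le[where N="?N" and B=B and d=deg and m=m and r=r] B m r by simp
      then have "(K * 2 ^ ?D) * ((\<Prod>k\<in>?N. max 1 (r ^ m / r ^ deg k)) * r ^ ?D) \<le> (K * 2 ^ ?D) * (r ^ m) ^ p"
        using K by (intro mult_left_mono) auto
      then show "K * (\<Prod>k\<in>?N. max 1 (r ^ m / r ^ deg k)) * (2 * r) ^ ?D \<le> (K * 2 ^ ?D) * (r ^ m) ^ p"
        by (simp add: power_mult_distrib mult_ac)
    qed
    finally show ?thesis using r rm by (intro exI[of _ "r ^ m"]) auto
  qed
  then show ?thesis by blast
qed

text \<open>The order of choices is decisive: first \<open>A\<close> and \<open>K\<close>, then
  \<open>\<eta>'\<close>, which absorbs \<open>K\<close>, then \<open>M\<close> and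
  \<open>\<epsilon>\<close> from the degrees alone, and only then the thresholds \<open>s0\<close>
  and \<open>r0\<close> belonging to this \<open>\<epsilon>\<close>.\<close>

lemma premeasure_small_at:
  assumes p: "1 \<le> p" "p \<le> DIM('a)" and T: "subspace T" "dim T = p"
    and near: "\<And>\<epsilon>. \<epsilon> > 0 \<Longrightarrow> \<exists>s0>0. \<forall>y\<in>S. norm (y - x) < s0 \<longrightarrow>
      (\<exists>t\<in>T. norm (mul (- x) y - t) \<le> \<epsilon> * norm (y - x))"
    and low: "\<And>A. A \<subseteq> {1..DIM('a)} \<Longrightarrow> card A = p \<Longrightarrow> coord_inj X A T \<Longrightarrow> sum deg A < max_degree V p"
    and \<eta>: "\<eta> > 0" and \<delta>: "\<delta> > 0" and \<sigma>: "\<sigma> > 0"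
  shows "\<exists>s>0. s < \<sigma> \<and> hausdorff_premeasure d (max_degree V p) \<delta> (S \<inter> cball x s) \<le> ennreal (\<eta> * s ^ p)"
proof -
  let ?N = "{1..DIM('a)}" and ?D = "max_degree V p"
  obtain B m where B: "B \<subseteq> ?N" "card B = p" "sum deg B = ?D" and m: "m \<in> deg ` B"
    "\<And>j. j \<in> B \<Longrightarrow> m \<le> deg j" "\<And>k. k \<in> ?N - B \<Longrightarrow> deg k \<le> m"
    by (rule max_degree_attained[OF p, of V], rule that)
  have m1: "1 \<le> m" using m(1) B(1) deg_ge_1 by blast
  obtain A K where A: "A \<subseteq> ?N" "card A = dim T" "coord_inj X A T" and K: "0 < K"
    and est: "\<And>\<epsilon>. 0 < \<epsilon> \<Longrightarrow> \<epsilon> \<le> 1 \<Longrightarrow> \<exists>s0>0. \<exists>r0>0. \<forall>r s \<delta>. 0 < r \<longrightarrow> r < r0 \<longrightarrow> 0 < s \<longrightarrow> s < s0 \<longrightarrow> 2 * r \<le> \<delta> \<longrightarrow>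
      hausdorff_premeasure d ?D \<delta> (S \<inter> cball x s) \<le>
      ennreal (K * (\<Prod>k\<in>?N. max 1 ((if k \<in> A then s else \<epsilon> * s) / r ^ deg k)) * (2 * r) ^ ?D)"
    by (rule premeasure_near_subspace[OF T(1) near, of ?D], assumption, rule that)
  define \<eta>' where "\<eta>' = \<eta> / (K * 2 ^ ?D)"
  have \<eta>': "\<eta>' > 0" using \<eta> K by (simp add: \<eta>'_def)
  have less: "sum deg A < sum deg B" unfolding B(3) using A T(2) by (intro low) auto
  have cAB: "card A = card B" using A(2) T(2) B(2) by simp
  obtain M \<epsilon> r1 where M: "1 \<le> M" and \<epsilon>: "0 < \<epsilon>" "\<epsilon> \<le> 1" and r1: "0 < r1" "r1 \<le> 1"
    and small: "\<And>r::real. 0 < r \<Longrightarrow> r < r1 \<Longrightarrow>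
      (\<Prod>k\<in>?N. max 1 ((if k \<in> A then M * r ^ m else \<epsilon> * (M * r ^ m)) / r ^ deg k)) * r ^ sum deg B
        \<le> \<eta>' * (M * r ^ m) ^ card B"
    by (rule prod_quotients_small[OF _ B(1) A(1) cAB m(2,3) less \<eta>']) (auto intro: that)
  obtain s0 r0 where s0: "s0 > 0" "r0 > 0" and bnd: "\<And>r s \<delta>. 0 < r \<Longrightarrow> r < r0 \<Longrightarrow> 0 < s \<Longrightarrow> s < s0 \<Longrightarrow> 2 * r \<le> \<delta> \<Longrightarrow>
      hausdorff_premeasure d ?D \<delta> (S \<inter> cball x s) \<le>
      ennreal (K * (\<Prod>k\<in>?N. max 1 ((if k \<in> A then s else \<epsilon> * s) / r ^ deg k)) * (2 * r) ^ ?D)"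
    using est[OF \<epsilon>] by blast
  \<comment> \<open>The quotients by \<open>M\<close> make \<open>s = M * r ^ m \<le> M * r\<close>
    fall below \<open>s0\<close> and \<open>\<sigma>\<close>.\<close>
  define \<mu> where "\<mu> = min r1 (min r0 (min (s0 / M) (min (\<sigma> / M) \<delta>)))"
  have "0 < s0 / M" "0 < \<sigma> / M" using s0 \<sigma> M by auto
  then have \<mu>: "0 < \<mu>" "\<mu> \<le> r1" "\<mu> \<le> r0" "\<mu> \<le> s0 / M" "\<mu> \<le> \<sigma> / M" "\<mu> \<le> \<delta>"
    using \<delta> s0 r1 by (auto simp: \<mu>_def)
  define r where "r = \<mu> / 2"
  have r: "0 < r" "r < r0" "r < s0 / M" "r < \<sigma> / M" "2 * r \<le> \<delta>" "r < r1"
    using \<mu> unfolding r_def by linarith+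
  define s where "s = M * r ^ m"
  have "r ^ m \<le> r" using power_decreasing[of 1 m r] m1 r r1 by simp
  then have "s \<le> M * r" using M by (simp add: s_def)
  moreover have "M * r < s0" "M * r < \<sigma>" using r M by (auto simp: pos_less_divide_eq mult.commute)
  moreover have "0 < s" unfolding s_def using M zero_less_power[OF r(1), of m] by (intro mult_pos_pos) auto
  ultimately have s: "0 < s" "s < s0" "s < \<sigma>" by linarith+
  have "hausdorff_premeasure d ?D \<delta> (S \<inter> cball x s) \<le>
      ennreal (K * (\<Prod>k\<in>?N. max 1 ((if k \<in> A then s else \<epsilon> * s) / r ^ deg k)) * (2 * r) ^ ?D)"
    using r s by (intro bnd) auto
  also have "\<dots> \<le> ennreal (\<eta> * s ^ p)"
  proof (rule ennreal_leI)
    let ?P = "\<Prod>k\<in>?N. max 1 ((if k \<in> A then s else \<epsilon> * s) / r ^ deg k)"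
    have "?P * r ^ ?D \<le> \<eta>' * s ^ p" using small[OF r(1,6)] unfolding B(2,3) s_def[symmetric] .
    then have "(K * 2 ^ ?D) * (?P * r ^ ?D) \<le> (K * 2 ^ ?D) * (\<eta>' * s ^ p)"
      using K by (intro mult_left_mono) auto
    also have "\<dots> = \<eta> * s ^ p" using K by (simp add: \<eta>'_def)
    finally show "K * ?P * (2 * r) ^ ?D \<le> \<eta> * s ^ p" by (simp add: power_mult_distrib mult_ac)
  qed
  finally show ?thesis using s by blast
qed

text \<open>Compactness of the unit sphere: directions of points violating the bound would
  subconverge to some \<open>v\<close> in the cone, and then the multiple
  \<open>norm (y - x)\<close> of \<open>v\<close> approximates \<open>y - x\<close> too
  well.\<close>

lemma tangent_cone_approx:
  assumes T: "subspace (tangent_cone S x)" and \<epsilon>: "\<epsilon> > 0"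
  shows "\<exists>s0>0. \<forall>y\<in>S. norm (y - x) < s0 \<longrightarrow> (\<exists>t\<in>tangent_cone S x. norm (y - x - t) \<le> \<epsilon> * norm (y - x))"
proof (rule ccontr)
  let ?T = "tangent_cone S x"
  assume "\<not> ?thesis"
  then have "\<forall>i. \<exists>y\<in>S. norm (y - x) < 1 / real (Suc i) \<and> (\<forall>t\<in>?T. \<epsilon> * norm (y - x) < norm (y - x - t))"
    by (meson not_le zero_less_divide_1_iff of_nat_0_less_iff zero_less_Suc)
  then obtain y where y: "\<And>i. y i \<in> S" "\<And>i. norm (y i - x) < 1 / real (Suc i)"
    "\<And>i t. t \<in> ?T \<Longrightarrow> \<epsilon> * norm (y i - x) < norm (y i - x - t)" by metis
  have nx: "y i \<noteq> x" for i using y(3)[OF subspace_0[OF T], of i] by auto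
  define u where "u i = (y i - x) /\<^sub>R norm (y i - x)" for i
  have "u i \<in> sphere 0 1" for i using nx[of i] by (simp add: u_def)
  then obtain v \<phi> where \<phi>: "strict_mono (\<phi> :: nat \<Rightarrow> nat)" "(u \<circ> \<phi>) \<longlonglongrightarrow> v"
    using compact_sphere[of 0 1] unfolding compact_def by metis
  have "(\<lambda>i. y i - x) \<longlonglongrightarrow> 0"
    by (rule tendsto_norm_zero_cancel, rule tendsto_sandwich[OF _ _ tendsto_const LIMSEQ_inverse_real_of_nat])
      (use y(2) in \<open>auto simp: inverse_eq_divide less_imp_le\<close>)
  then have "y \<longlonglongrightarrow> x" by (simp add: LIM_zero_iff)
  then have lim: "(y \<circ> \<phi>) \<longlonglongrightarrow> x" using \<phi>(1) by (rule LIMSEQ_subseq_LIMSEQ)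
  have "1 *\<^sub>R v \<in> ?T"
    unfolding tangent_cone_def
  proof (intro CollectI exI[of _ 1] exI[of _ v] conjI)
    show "\<exists>\<xi>. (\<forall>i. \<xi> i \<in> S \<and> \<xi> i \<noteq> x) \<and> \<xi> \<longlonglongrightarrow> x \<and> (\<lambda>i. (\<xi> i - x) /\<^sub>R norm (\<xi> i - x)) \<longlonglongrightarrow> v"
      using lim \<phi>(2) y(1) nx by (intro exI[of _ "y \<circ> \<phi>"]) (auto simp: u_def o_def)
  qed auto
  then have vT: "v \<in> ?T" by simp
  obtain i where "dist ((u \<circ> \<phi>) i) v < \<epsilon>" using \<phi>(2) \<epsilon> unfolding lim_sequentially by blast
  then have i: "norm (u (\<phi> i) - v) < \<epsilon>" by (simp add: dist_norm)
  let ?n = "norm (y (\<phi> i) - x)"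
  have n0: "?n > 0" using nx by simp
  have "y (\<phi> i) - x - ?n *\<^sub>R v = ?n *\<^sub>R (u (\<phi> i) - v)" using n0 by (simp add: u_def scaleR_diff_right)
  then have "norm (y (\<phi> i) - x - ?n *\<^sub>R v) = ?n * norm (u (\<phi> i) - v)" by simp
  also have "\<dots> \<le> ?n * \<epsilon>" using i by (intro mult_left_mono) auto
  finally show False using y(3)[OF subspace_scale[OF T vT], of "\<phi> i" ?n] by (simp add: mult.commute)
qed

text \<open>\<open>D\<close> carries the tangent plane to the unit. Coordinates there correspond at
  \<open>x\<close> to the vectors \<open>u l\<close>, dual to the left-invariant frame, so an index
  set of full degree for the carried plane would give the point maximal degree.\<close>

lemma premeasure_small_at_low_degree:
  assumes p: "1 \<le> p" "p \<le> DIM('a)" and x: "x \<in> low_degree_set mul V X p S"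
    and \<eta>: "\<eta> > 0" "\<delta> > 0" "\<sigma> > 0"
  shows "\<exists>s>0. s < \<sigma> \<and> hausdorff_premeasure d (max_degree V p) \<delta> (S \<inter> cball x s) \<le> ennreal (\<eta> * s ^ p)"
proof -
  let ?T = "tangent_cone S x"
  have T: "subspace ?T" "dim ?T = p" and xlow: "degree_at mul V X p S x < max_degree V p"
    using x by (auto simp: low_degree_set_def singular_set_def)
  obtain D where D: "(mul (- x) has_derivative D) (at x)"
    and D1: "\<And>v. D (left_inv_field mul v x) = v" and D2: "\<And>v. left_inv_field mul (D v) x = v"
    and linE: "linear (\<lambda>v. left_inv_field mul v x)"
    by (rule left_translation_derivative, rule that)
  have lin: "linear D" using D has_derivative_linear by blast
  have "inj D" using D2 by (metis injI)
  then have T': "subspace (D ` ?T)" "dim (D ` ?T) = p"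
    using T lin by (auto simp: linear_subspace_image dim_image_eq inj_on_subset)
  obtain B where B: "\<And>h. norm (D h) \<le> norm h * B" "B > 0"
    using bounded_linear.pos_bounded[OF has_derivative_bounded_linear[OF D]] by (metis mult.commute)
  have near: "\<exists>s0>0. \<forall>y\<in>S. norm (y - x) < s0 \<longrightarrow> (\<exists>t\<in>D ` ?T. norm (mul (- x) y - t) \<le> \<epsilon> * norm (y - x))"
    if \<epsilon>: "\<epsilon> > 0" for \<epsilon>
  proof -
    obtain s1 where s1: "s1 > 0"
      "\<And>y. norm (y - x) < s1 \<Longrightarrow> norm (mul (- x) y - mul (- x) x - D (y - x)) \<le> \<epsilon> / 2 * norm (y - x)"
      using D \<epsilon> unfolding has_derivative_at_alt by (metis half_gt_zero)
    \<comment> \<open>Half of the tolerance goes to the linearisation of the translation, half to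
      the cone, whose error \<open>D\<close> may stretch by \<open>B\<close>.\<close>
    have "\<epsilon> / (2 * B) > 0" using \<epsilon> B by simp
    then obtain s2 where s2: "s2 > 0" "\<And>y. y \<in> S \<Longrightarrow> norm (y - x) < s2 \<Longrightarrow>
        (\<exists>t\<in>?T. norm (y - x - t) \<le> \<epsilon> / (2 * B) * norm (y - x))"
      using tangent_cone_approx[OF T(1)] by blast
    have "\<exists>t\<in>D ` ?T. norm (mul (- x) y - t) \<le> \<epsilon> * norm (y - x)" if y: "y \<in> S" "norm (y - x) < min s1 s2" for y
    proof -
      obtain t where t: "t \<in> ?T" "norm (y - x - t) \<le> \<epsilon> / (2 * B) * norm (y - x)" using s2(2)[of y] y by auto
      have "norm (D (y - x) - D t) \<le> norm (y - x - t) * B" using B(1)[of "y - x - t"] lin by (simp add: linear_diff)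
      also have "\<dots> \<le> \<epsilon> / (2 * B) * norm (y - x) * B" using t B by (intro mult_right_mono) auto
      also have "\<dots> = \<epsilon> / 2 * norm (y - x)" using B by simp
      finally have 1: "norm (D (y - x) - D t) \<le> \<epsilon> / 2 * norm (y - x)" .
      have 2: "norm (mul (- x) y - D (y - x)) \<le> \<epsilon> / 2 * norm (y - x)" using s1(2)[of y] y by simp
      have "norm (mul (- x) y - D t) \<le> norm (mul (- x) y - D (y - x)) + norm (D (y - x) - D t)"
        using norm_triangle_ineq[of "mul (- x) y - D (y - x)" "D (y - x) - D t"] by simp
      also have "\<dots> \<le> \<epsilon> / 2 * norm (y - x) + \<epsilon> / 2 * norm (y - x)" using 1 2 by (rule add_mono[rotated])
      also have "\<dots> = \<epsilon> * norm (y - x)" by simp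
      finally show ?thesis using t(1) by blast
    qed
    then show ?thesis using s1 s2 by (intro exI[of _ "min s1 s2"]) auto
  qed
  define u where "u l = adjoint D (X l)" for l
  have u: "t \<bullet> u l = D t \<bullet> X l" for t l unfolding u_def using adjoint_works[OF lin] by simp
  have o: "X k \<bullet> X l = (if k = l then 1 else 0)" if "k \<in> {1..DIM('a)}" "l \<in> {1..DIM('a)}" for k l
    using X_orthonormal that unfolding orthonormal_seq_def by blast
  have low: "sum deg A < max_degree V p"
    if A: "A \<subseteq> {1..DIM('a)}" "card A = p" "coord_inj X A (D ` ?T)" for A
  proof (rule ccontr)
    assume "\<not> sum deg A < max_degree V p"
    then have eq: "sum deg A = max_degree V p" using sum_degree_le_max_degree[OF A(1,2), of V] by simp
    have "degree_at mul V X p S x = max_degree V p"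
    proof (rule degree_at_eq_max_degree[OF X_orthonormal T _ _ A(1,2) _ eq])
      show "left_inv_field mul (X k) x \<bullet> u l = (if k = l then 1 else 0)"
        if "k \<in> {1..DIM('a)}" "l \<in> {1..DIM('a)}" for k l
        unfolding u D1 using o[OF that] .
      show "t = (\<Sum>k\<in>{1..DIM('a)}. (t \<bullet> u k) *\<^sub>R left_inv_field mul (X k) x)" for t
      proof -
        have "t = left_inv_field mul (\<Sum>k\<in>{1..DIM('a)}. (D t \<bullet> X k) *\<^sub>R X k) x"
          using orthonormal_seq_expand[OF X_orthonormal, of "D t"] D2[of t] by simp
        also have "\<dots> = (\<Sum>k\<in>{1..DIM('a)}. (D t \<bullet> X k) *\<^sub>R left_inv_field mul (X k) x)"
          by (simp add: linear_sum[OF linE] linear_cmul[OF linE])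
        finally show ?thesis by (simp add: u)
      qed
      show "coord_inj u A ?T"
        unfolding coord_inj_def
      proof (intro ballI impI)
        fix t assume t: "t \<in> ?T" "\<forall>j\<in>A. t \<bullet> u j = 0"
        then have "D t = 0" using A(3) unfolding coord_inj_def u by blast
        then show "t = 0" using D2[of t] linear_0[OF linE] by simp
      qed
    qed
    then show False using xlow by simp
  qed
  show ?thesis by (rule premeasure_small_at[OF p T' near low \<eta>])
qed

end

section \<open>Countable subadditivity of the premeasure\<close>

lemma hausdorff_premeasure_mono: "E \<subseteq> E' \<Longrightarrow> hausdorff_premeasure d k \<delta> E \<le> hausdorff_premeasure d k \<delta> E'"
  unfolding hausdorff_premeasure_def by (rule INF_superset_mono) auto

lemma hausdorff_premeasure_empty [simp]: "hausdorff_premeasure d k \<delta> {} = 0"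
proof -
  have "hausdorff_premeasure d k \<delta> {} \<le> (\<Sum>i::nat. if {} = {} then 0 else ediam d {} ^ k)"
    unfolding hausdorff_premeasure_def
    by (rule INF_lower2[of "\<lambda>_. {}"]) (auto simp: ediam_def bot_ennreal)
  then show ?thesis by simp
qed

text \<open>Covers of the \<open>E n\<close> with excess \<open>e / 2 ^ (n + 1)\<close> are merged
  along an enumeration of pairs. Finiteness of the right-hand side, which may be assumed, makes each
  infimum strictly approachable.\<close>

lemma hausdorff_premeasure_UN:
  "hausdorff_premeasure d k \<delta> (\<Union>n. E n) \<le> (\<Sum>n. hausdorff_premeasure d k \<delta> (E n))"
proof (rule ennreal_le_epsilon)
  let ?H = "hausdorff_premeasure d k \<delta>"
  let ?s = "\<lambda>A::'a set. if A = {} then 0 else ediam d A ^ k"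
  fix e :: real assume fin: "(\<Sum>n. ?H (E n)) < top" and e: "0 < e"
  have finn: "?H (E n) < top" for n
    using fin ennreal_suminf_lessD by blast
  have "\<exists>A. E n \<subseteq> (\<Union>i. A i) \<and> (\<forall>i::nat. ediam d (A i) \<le> ennreal \<delta>) \<and> (\<Sum>i. ?s (A i)) \<le> ?H (E n) + ennreal (e * (1/2) ^ Suc n)" for n
  proof -
    have "?H (E n) < ?H (E n) + ennreal (e * (1/2) ^ Suc n)"
      using finn[of n] e ennreal_add_left_cancel_less[of "?H (E n)" 0] by simp
    then obtain A where "A \<in> {A :: nat \<Rightarrow> 'a set. E n \<subseteq> (\<Union>i. A i) \<and> (\<forall>i. ediam d (A i) \<le> ennreal \<delta>)}"
      "(\<Sum>i. ?s (A i)) < ?H (E n) + ennreal (e * (1/2) ^ Suc n)"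
      unfolding hausdorff_premeasure_def INF_less_iff by blast
    then show ?thesis by (intro exI[of _ A]) auto
  qed
  then have "\<forall>n. \<exists>A. E n \<subseteq> (\<Union>i. A i) \<and> (\<forall>i::nat. ediam d (A i) \<le> ennreal \<delta>) \<and> (\<Sum>i. ?s (A i)) \<le> ?H (E n) + ennreal (e * (1/2) ^ Suc n)" ..
  from choice[OF this] obtain A where A: "\<And>n. E n \<subseteq> (\<Union>i. A n i)" "\<And>n i. ediam d (A n i) \<le> ennreal \<delta>"
    "\<And>n. (\<Sum>i. ?s (A n i)) \<le> ?H (E n) + ennreal (e * (1/2) ^ Suc n)" by blast
  define B where "B j = (case prod_decode j of (n, i) \<Rightarrow> A n i)" for j
  have "?H (\<Union>n. E n) \<le> (\<Sum>j. ?s (B j))"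
    unfolding hausdorff_premeasure_def
  proof (rule INF_lower, intro CollectI conjI allI)
    show "(\<Union>n. E n) \<subseteq> (\<Union>j. B j)"
    proof
      fix x assume "x \<in> (\<Union>n. E n)"
      then obtain n i where "x \<in> A n i" using A(1) by blast
      then have "x \<in> B (prod_encode (n, i))" by (simp add: B_def)
      then show "x \<in> (\<Union>j. B j)" by blast
    qed
    show "ediam d (B j) \<le> ennreal \<delta>" for j using A(2) by (simp add: B_def split: prod.split)
  qed
  also have "\<dots> = (\<Sum>j. (\<lambda>(n, i). ?s (A n i)) (prod_decode j))"
    by (intro arg_cong[where f=suminf] ext) (simp add: B_def split: prod.split)
  also have "\<dots> = (\<Sum>n. \<Sum>i. ?s (A n i))"
    by (rule suminf_ennreal_2dimen) simp
  also have "\<dots> \<le> (\<Sum>n. ?H (E n) + ennreal (e * (1/2) ^ Suc n))"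
    using A(3) by (intro suminf_le) auto
  also have "\<dots> = (\<Sum>n. ?H (E n)) + (\<Sum>n. ennreal (e * (1/2) ^ Suc n))"
    by (intro suminf_add[symmetric]) auto
  also have "(\<Sum>n. ennreal (e * (1/2) ^ Suc n)) = ennreal e"
    using e power_half_series by (intro suminf_ennreal_eq) (auto dest: sums_mult[of _ _ e])
  finally show "?H (\<Union>n. E n) \<le> (\<Sum>n. ?H (E n)) + ennreal e" .
qed

text \<open>The hypothesis bounds finite partial sums, the form in which packing estimates for
  Vitali families arrive.\<close>

lemma hausdorff_premeasure_UN_countable:
  assumes "countable C" "0 \<le> B"
    and bound: "\<And>i. i \<in> C \<Longrightarrow> hausdorff_premeasure d k \<delta> (E i) \<le> ennreal (c i)" "\<And>i. i \<in> C \<Longrightarrow> 0 \<le> c i"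
    and sum: "\<And>I. finite I \<Longrightarrow> I \<subseteq> C \<Longrightarrow> sum c I \<le> B"
  shows "hausdorff_premeasure d k \<delta> (\<Union>i\<in>C. E i) \<le> ennreal B"
proof -
  let ?H = "hausdorff_premeasure d k \<delta>"
  let ?I = "to_nat_on C ` C"
  define F where "F n = (if n \<in> ?I then E (from_nat_into C n) else {})" for n
  have fr: "from_nat_into C n \<in> C \<and> to_nat_on C (from_nat_into C n) = n" if "n \<in> ?I" for n
    using that \<open>countable C\<close> by (auto simp: from_nat_into_to_nat_on)
  have "(\<Union>i\<in>C. E i) \<subseteq> (\<Union>n. F n)"
  proof
    fix x assume "x \<in> (\<Union>i\<in>C. E i)"
    then obtain i where i: "i \<in> C" "x \<in> E i" by blast
    then have "x \<in> F (to_nat_on C i)" using \<open>countable C\<close> by (simp add: F_def from_nat_into_to_nat_on)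
    then show "x \<in> (\<Union>n. F n)" by blast
  qed
  then have "?H (\<Union>i\<in>C. E i) \<le> ?H (\<Union>n. F n)" by (rule hausdorff_premeasure_mono)
  also have "\<dots> \<le> (\<Sum>n. ?H (F n))" by (rule hausdorff_premeasure_UN)
  also have "\<dots> \<le> ennreal B"
  proof (rule suminf_le_const)
    show "summable (\<lambda>n. ?H (F n))" by simp
    fix N
    let ?J = "{n\<in>{..<N}. n \<in> ?I}"
    have inj: "inj_on (from_nat_into C) ?J" using fr by (metis (no_types, lifting) inj_onI mem_Collect_eq)
    have sub: "from_nat_into C ` ?J \<subseteq> C" using fr by blast
    have "(\<Sum>n<N. ?H (F n)) = (\<Sum>n\<in>?J. ?H (F n))"
      by (rule sum.mono_neutral_right) (auto simp: F_def)
    also have "\<dots> \<le> (\<Sum>n\<in>?J. ennreal (c (from_nat_into C n)))"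
      using fr bound(1) by (intro sum_mono) (auto simp: F_def)
    also have "\<dots> = ennreal (\<Sum>n\<in>?J. c (from_nat_into C n))"
      using fr bound(2) by (intro sum_ennreal) blast
    also have "(\<Sum>n\<in>?J. c (from_nat_into C n)) = sum c (from_nat_into C ` ?J)"
      using inj by (simp add: sum.reindex)
    also have "ennreal \<dots> \<le> ennreal B" using sub by (intro ennreal_leI sum) auto
    finally show "(\<Sum>n<N. ?H (F n)) \<le> ennreal B" .
  qed
  finally show ?thesis .
qed

section \<open>Coverings of parametrised sets\<close>

definition proj_on :: "'a::euclidean_space set \<Rightarrow> 'a \<Rightarrow> 'a" where
  "proj_on J u = (\<Sum>b\<in>J. (u \<bullet> b) *\<^sub>R b)"

lemma proj_on_inner:
  assumes "J \<subseteq> Basis" "c \<in> Basis"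
  shows "proj_on J u \<bullet> c = (if c \<in> J then u \<bullet> c else 0)"
proof -
  have fJ: "finite J" using assms(1) finite_Basis finite_subset by blast
  have "proj_on J u \<bullet> c = (\<Sum>b\<in>J. if b = c then u \<bullet> c else 0)"
    unfolding proj_on_def inner_sum_left using assms
    by (intro sum.cong) (auto simp: inner_Basis subset_eq)
  then show ?thesis using fJ by simp
qed

lemma proj_on_facts:
  assumes J: "J \<subseteq> Basis"
  shows "linear (proj_on J)" "proj_on J u \<in> span J" "norm (proj_on J u) \<le> norm u"
    "u \<in> span J \<Longrightarrow> proj_on J u = u"
proof -
  show lin: "linear (proj_on J)"
    by (rule linearI) (simp_all add: proj_on_def inner_add_left scaleR_add_left sum.distrib scaleR_sum_right)
  show "proj_on J u \<in> span J" unfolding proj_on_def by (intro span_sum span_scale span_base)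
  show "norm (proj_on J u) \<le> norm u"
    by (rule norm_le_componentwise) (simp add: proj_on_inner[OF J])
  show "proj_on J u = u" if "u \<in> span J"
  proof -
    have "proj_on J b = id b" if "b \<in> J" for b
    proof (rule euclidean_eqI)
      fix c :: 'a assume c: "c \<in> Basis"
      have "b \<in> Basis" using that J by blast
      then show "proj_on J b \<bullet> c = id b \<bullet> c"
        using that c unfolding proj_on_inner[OF J c] by (cases "b = c") (auto simp: inner_not_same_Basis)
    qed
    then show ?thesis using linear_eq_on_span[OF lin linear_id, of J u] that by auto
  qed
qed

text \<open>The dimension \<open>p\<close> of the parameter space \<open>span J\<close> is not the dimension of a type; \<open>p\<close>-dimensional
  volumes in \<open>span J\<close> are therefore measured by full-dimensional cylinders over \<open>span J\<close>.\<close>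

definition cylinder :: "'a::euclidean_space set \<Rightarrow> 'a \<Rightarrow> real \<Rightarrow> 'a set" where
  "cylinder J w \<rho> = {y. norm (proj_on J y - w) \<le> \<rho> \<and> (\<forall>b\<in>Basis - J. 0 \<le> y \<bullet> b \<and> y \<bullet> b \<le> 1)}"

text \<open>Each cylinder contains a box with half-sides \<open>\<rho> w / DIM('a)\<close> along
  \<open>J\<close> and sides 1 across; the coordinate sum of absolute values shows that it fits.
  Boxes over disjoint balls are disjoint, and their volumes dominate
  \<open>\<rho> w ^ card J\<close> up to the constant.\<close>

lemma sum_radius_power_le:
  fixes O' :: "'a::euclidean_space set"
  assumes J: "J \<subseteq> Basis" and O: "O' \<in> lmeasurable" and I: "finite I" "I \<subseteq> span J"
    and \<rho>: "\<And>w. w \<in> I \<Longrightarrow> 0 < \<rho> w" and sub: "\<And>w. w \<in> I \<Longrightarrow> cylinder J w (\<rho> w) \<subseteq> O'"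
    and disj: "pairwise (\<lambda>w w'. disjnt (cball w (\<rho> w)) (cball w' (\<rho> w'))) I"
  shows "(\<Sum>w\<in>I. \<rho> w ^ card J) \<le> real DIM('a) ^ card J * measure lebesgue O'"
proof -
  let ?n = "real DIM('a)"
  define lo where "lo w = (\<Sum>b\<in>Basis. (if b \<in> J then w \<bullet> b - \<rho> w / ?n else 0) *\<^sub>R b)" for w :: 'a
  define hi where "hi w = (\<Sum>b\<in>Basis. (if b \<in> J then w \<bullet> b + \<rho> w / ?n else 1) *\<^sub>R b)" for w :: 'a
  have lo: "lo w \<bullet> b = (if b \<in> J then w \<bullet> b - \<rho> w / ?n else 0)"
    and hi: "hi w \<bullet> b = (if b \<in> J then w \<bullet> b + \<rho> w / ?n else 1)" if "b \<in> Basis" for w b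
    using that by (simp_all add: lo_def hi_def)
  define Q where "Q w = cbox (lo w) (hi w)" for w
  have QC: "Q w \<subseteq> cylinder J w (\<rho> w)" if w: "w \<in> I" for w
  proof
    fix y assume y: "y \<in> Q w"
    have "norm (proj_on J y - w) \<le> (\<Sum>b\<in>Basis. \<bar>(proj_on J y - w) \<bullet> b\<bar>)" by (rule norm_le_l1)
    also have "\<dots> \<le> (\<Sum>b\<in>(Basis :: 'a set). \<rho> w / ?n)"
    proof (intro sum_mono)
      fix b :: 'a assume b: "b \<in> Basis"
      have ly: "lo w \<bullet> b \<le> y \<bullet> b" "y \<bullet> b \<le> hi w \<bullet> b" using y b by (auto simp: Q_def mem_box)
      show "\<bar>(proj_on J y - w) \<bullet> b\<bar> \<le> \<rho> w / ?n"
      proof (cases "b \<in> J")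
        case True
        then show ?thesis using ly lo[OF b] hi[OF b] proj_on_inner[OF J b, of y]
          by (simp add: inner_diff_left abs_le_iff)
      next
        case False
        have "w \<bullet> b = proj_on J w \<bullet> b" using proj_on_facts(4)[OF J, of w] I(2) w by auto
        then show ?thesis using False \<rho>[OF w] by (simp add: inner_diff_left proj_on_inner[OF J b])
      qed
    qed
    also have "\<dots> = \<rho> w" by simp
    finally have 1: "norm (proj_on J y - w) \<le> \<rho> w" .
    have "0 \<le> y \<bullet> b \<and> y \<bullet> b \<le> 1" if b: "b \<in> Basis - J" for b
    proof -
      have "lo w \<bullet> b \<le> y \<bullet> b" "y \<bullet> b \<le> hi w \<bullet> b" using y b by (auto simp: Q_def mem_box)
      then show ?thesis using lo[of b w] hi[of b w] b by simp
    qed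
    then show "y \<in> cylinder J w (\<rho> w)" using 1 by (simp add: cylinder_def)
  qed
  have Qm: "(\<rho> w / ?n) ^ card J \<le> measure lebesgue (Q w)" if w: "w \<in> I" for w
  proof -
    have le: "lo w \<bullet> b \<le> hi w \<bullet> b" if "b \<in> Basis" for b
      using lo[OF that] hi[OF that] \<rho>[OF w] by auto
    then have "measure lebesgue (Q w) = (\<Prod>b\<in>Basis. hi w \<bullet> b - lo w \<bullet> b)"
      using content_cbox[of "lo w" "hi w"] by (simp add: Q_def)
    also have "\<dots> = (\<Prod>b\<in>Basis. if b \<in> J then 2 * \<rho> w / ?n else 1)"
      by (intro prod.cong) (auto simp: lo hi)
    also have "\<dots> = (2 * \<rho> w / ?n) ^ card J" using J by (simp add: prod.If_cases Int_absorb1)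
    finally show ?thesis using \<rho>[OF w] by (simp add: power_mono divide_right_mono)
  qed
  have dQ: "pairwise (\<lambda>w w'. disjnt (Q w) (Q w')) I"
    unfolding pairwise_def
  proof (intro ballI impI)
    fix w w' assume w: "w \<in> I" "w' \<in> I" "w \<noteq> w'"
    show "disjnt (Q w) (Q w')"
      unfolding disjnt_def
    proof (rule ccontr)
      assume "Q w \<inter> Q w' \<noteq> {}"
      then obtain y where "y \<in> Q w" "y \<in> Q w'" by blast
      then have "y \<in> cylinder J w (\<rho> w)" "y \<in> cylinder J w' (\<rho> w')" using QC w by blast+
      then have "proj_on J y \<in> cball w (\<rho> w) \<inter> cball w' (\<rho> w')"
        by (auto simp: cylinder_def dist_norm norm_minus_commute)
      moreover have "disjnt (cball w (\<rho> w)) (cball w' (\<rho> w'))" using disj w unfolding pairwise_def by blast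
      ultimately show False unfolding disjnt_def by blast
    qed
  qed
  have "(\<Sum>w\<in>I. (\<rho> w / ?n) ^ card J) \<le> (\<Sum>w\<in>I. measure lebesgue (Q w))" by (intro sum_mono Qm)
  also have "\<dots> \<le> measure lebesgue O'"
  proof (rule sum_measure_disjoint_le[OF I(1) _ dQ _ O])
    show "Q w \<in> lmeasurable" for w by (simp add: Q_def)
    show "Q w \<subseteq> O'" if "w \<in> I" for w using QC[OF that] sub[OF that] by blast
  qed
  finally have "(\<Sum>w\<in>I. \<rho> w ^ card J) / ?n ^ card J \<le> measure lebesgue O'"
    by (simp add: power_divide sum_divide_distrib)
  then show ?thesis by (simp add: pos_divide_le_eq mult.commute)
qed

text \<open>Serves two regimes: small \<open>c\<close> with \<open>O'\<close> a fixed ball, and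
  bounded \<open>c\<close> with \<open>O'\<close> of small volume. A good radius \<open>s\<close> is
  recorded as \<open>5 * \<rho>\<close>, so that the fivefold enlargement in Vitali's lemma lands
  exactly on the ball whose premeasure is known.\<close>

lemma premeasure_image_le:
  fixes G :: "'a::euclidean_space \<Rightarrow> 'b"
  assumes J: "J \<subseteq> Basis" and O: "O' \<in> lmeasurable" and P: "P \<subseteq> span J" and c: "0 \<le> c"
    and cyl: "\<And>w. w \<in> P \<Longrightarrow> \<exists>\<rho>>0. cylinder J w \<rho> \<subseteq> O'"
    and small: "\<And>w \<sigma>. w \<in> P \<Longrightarrow> 0 < \<sigma> \<Longrightarrow> \<exists>s>0. s < \<sigma> \<and>
      hausdorff_premeasure d k \<delta> (G ` (P \<inter> cball w s)) \<le> ennreal (c * s ^ card J)"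
  shows "hausdorff_premeasure d k \<delta> (G ` P) \<le> ennreal (c * (5 * real DIM('a)) ^ card J * measure lebesgue O')"
proof -
  have "\<forall>w\<in>P. \<exists>\<rho>>0. \<rho> \<le> 1 \<and> cylinder J w \<rho> \<subseteq> O' \<and>
      hausdorff_premeasure d k \<delta> (G ` (P \<inter> cball w (5 * \<rho>))) \<le> ennreal (c * (5 * \<rho>) ^ card J)"
  proof
    fix w assume w: "w \<in> P"
    obtain \<rho>0 where \<rho>0: "\<rho>0 > 0" "cylinder J w \<rho>0 \<subseteq> O'" using cyl[OF w] by blast
    obtain s where s: "s > 0" "s < 5 * min 1 \<rho>0"
      "hausdorff_premeasure d k \<delta> (G ` (P \<inter> cball w s)) \<le> ennreal (c * s ^ card J)"
      using small[OF w, of "5 * min 1 \<rho>0"] \<rho>0 by auto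
    have "cylinder J w (s / 5) \<subseteq> cylinder J w \<rho>0" using s by (auto simp: cylinder_def)
    then show "\<exists>\<rho>>0. \<rho> \<le> 1 \<and> cylinder J w \<rho> \<subseteq> O' \<and>
      hausdorff_premeasure d k \<delta> (G ` (P \<inter> cball w (5 * \<rho>))) \<le> ennreal (c * (5 * \<rho>) ^ card J)"
      using s \<rho>0 by (intro exI[of _ "s / 5"]) auto
  qed
  then obtain \<rho> where \<rho>: "\<And>w. w \<in> P \<Longrightarrow> 0 < \<rho> w" "\<And>w. w \<in> P \<Longrightarrow> \<rho> w \<le> 1" "\<And>w. w \<in> P \<Longrightarrow> cylinder J w (\<rho> w) \<subseteq> O'"
    "\<And>w. w \<in> P \<Longrightarrow> hausdorff_premeasure d k \<delta> (G ` (P \<inter> cball w (5 * \<rho> w))) \<le> ennreal (c * (5 * \<rho> w) ^ card J)"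
    by metis
  have "P \<subseteq> (\<Union>w\<in>P. cball w (\<rho> w))" using \<rho>(1) by (force simp: less_imp_le)
  then obtain C where C: "countable C" "C \<subseteq> P"
    "pairwise (\<lambda>i j. disjnt (cball i (\<rho> i)) (cball j (\<rho> j))) C" "P \<subseteq> (\<Union>i\<in>C. cball i (5 * \<rho> i))"
    by (rule Vitali_covering_lemma_cballs[where S=P and K=P and a="\<lambda>w. w" and r=\<rho> and B=1]) (use \<rho> in auto)
  let ?B = "c * (5 * real DIM('a)) ^ card J * measure lebesgue O'"
  have "hausdorff_premeasure d k \<delta> (\<Union>w\<in>C. G ` (P \<inter> cball w (5 * \<rho> w))) \<le> ennreal ?B"
  proof (rule hausdorff_premeasure_UN_countable[OF C(1), where c="\<lambda>w. c * (5 * \<rho> w) ^ card J"])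
    show "0 \<le> ?B" using c by simp
    fix w assume "w \<in> C"
    then have w: "w \<in> P" using C(2) by blast
    show "hausdorff_premeasure d k \<delta> (G ` (P \<inter> cball w (5 * \<rho> w))) \<le> ennreal (c * (5 * \<rho> w) ^ card J)"
      by (rule \<rho>(4)[OF w])
    show "0 \<le> c * (5 * \<rho> w) ^ card J" using c \<rho>(1)[OF w] by simp
  next
    fix I assume I: "finite I" "I \<subseteq> C"
    have "(\<Sum>w\<in>I. \<rho> w ^ card J) \<le> real DIM('a) ^ card J * measure lebesgue O'"
    proof (rule sum_radius_power_le[OF J O I(1)])
      show "pairwise (\<lambda>i j. disjnt (cball i (\<rho> i)) (cball j (\<rho> j))) I"
        using C(3) I(2) by (rule pairwise_subset)
      show "I \<subseteq> span J" using I(2) C(2) P by blast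
      fix w assume "w \<in> I"
      then have "w \<in> P" using I(2) C(2) by blast
      then show "0 < \<rho> w" "cylinder J w (\<rho> w) \<subseteq> O'" using \<rho>(1,3) by blast+
    qed
    then have "c * 5 ^ card J * (\<Sum>w\<in>I. \<rho> w ^ card J) \<le> c * 5 ^ card J * (real DIM('a) ^ card J * measure lebesgue O')"
      using c by (intro mult_left_mono) auto
    then show "(\<Sum>w\<in>I. c * (5 * \<rho> w) ^ card J) \<le> ?B"
      by (simp add: sum_distrib_left power_mult_distrib mult_ac)
  qed
  moreover have "G ` P \<subseteq> (\<Union>w\<in>C. G ` (P \<inter> cball w (5 * \<rho> w)))" using C(4) by blast
  ultimately show ?thesis by (rule order_trans[OF hausdorff_premeasure_mono, rotated])
qed

lemma hausdorff_premeasure_null_UN: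
  assumes "\<And>n::nat. hausdorff_premeasure d k \<delta> (E n) = 0"
  shows "hausdorff_premeasure d k \<delta> (\<Union>n. E n) = 0"
  using hausdorff_premeasure_UN[of d k \<delta> E] assms by simp

lemma ennreal_eq_0_of_le_mult:
  assumes "\<And>\<eta>::real. \<eta> > 0 \<Longrightarrow> a \<le> ennreal (\<eta> * C)" "0 \<le> C"
  shows "a = 0"
proof -
  have *: "a \<le> 0 + ennreal e" if e: "0 < e" for e
  proof -
    have "a \<le> ennreal (e / (C + 1) * C)" using assms e by (intro assms(1)) simp
    also have "\<dots> \<le> ennreal e" using assms(2) e by (intro ennreal_leI) (simp add: field_simps)
    finally show ?thesis by simp
  qed
  have "a \<le> 0" by (rule ennreal_le_epsilon) (rule *)
  then show ?thesis by simp
qed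

section \<open>Tangent cones of parametrised sets\<close>

text \<open>The lower bound acts twice: it makes \<open>G'\<close> injective on
  \<open>span J\<close>, and it forces points of \<open>S\<close> approaching \<open>G u\<close> to
  have parameters approaching \<open>u\<close>, so every limit direction comes from
  \<open>G'\<close>. In contraposition, a singular point has a parameter at which \<open>G\<close>
  is not differentiable.\<close>

lemma tangent_cone_of_derivative:
  fixes G :: "'a::euclidean_space \<Rightarrow> 'a"
  assumes J: "J \<subseteq> Basis" "J \<noteq> {}" and \<Omega>: "open \<Omega>" and U: "open U"
    and chart: "S \<inter> U = G ` (\<Omega> \<inter> span J)" and u: "u \<in> \<Omega>" "u \<in> span J"
    and c: "c > 0" and lower: "\<And>v w. v \<in> \<Omega> \<inter> span J \<Longrightarrow> w \<in> \<Omega> \<inter> span J \<Longrightarrow> c * norm (v - w) \<le> norm (G v - G w)"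
    and G': "(G has_derivative G') (at u)"
  shows "tangent_cone S (G u) = G' ` span J" "dim (tangent_cone S (G u)) = card J" "subspace (tangent_cone S (G u))"
proof -
  let ?x = "G u"
  have lin: "linear G'" using G' has_derivative_linear by blast
  have xU: "?x \<in> U" "?x \<in> S" using chart u by blast+
  have alt: "\<exists>\<delta>>0. \<forall>y. norm (y - u) < \<delta> \<longrightarrow> norm (G y - G u - G' (y - u)) \<le> e * norm (y - u)" if "e > 0" for e
    using G' that unfolding has_derivative_at_alt by blast
  have step: "u + t *\<^sub>R h \<in> span J" if "h \<in> span J" for t h
    using that u(2) by (intro span_add span_scale)
  have \<Omega>step: "\<exists>\<tau>>0. \<forall>t. 0 < t \<longrightarrow> t \<le> \<tau> \<longrightarrow> u + t *\<^sub>R h \<in> \<Omega>" for h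
  proof -
    obtain e where e: "e > 0" "ball u e \<subseteq> \<Omega>" using \<Omega> u(1) openE by blast
    have "u + t *\<^sub>R h \<in> \<Omega>" if t: "0 < t" "t \<le> e / (norm h + 1)" for t
    proof -
      have "t * (norm h + 1) \<le> e" using t by (simp add: pos_le_divide_eq add_nonneg_pos)
      then have "t * norm h < e" using t by (simp add: algebra_simps)
      then have "u + t *\<^sub>R h \<in> ball u e" using t by (simp add: dist_norm)
      then show ?thesis using e by blast
    qed
    moreover have "e / (norm h + 1) > 0" using e by (simp add: add_nonneg_pos)
    ultimately show ?thesis by blast
  qed
  have dq: "\<exists>\<delta>>0. \<forall>t. 0 < t \<longrightarrow> t < \<delta> \<longrightarrow> norm ((G (u + t *\<^sub>R h) - G u) /\<^sub>R t - G' h) < e" if e: "e > 0" for h e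
  proof -
    have "e / (2 * (norm h + 1)) > 0" using e by (simp add: add_nonneg_pos)
    then obtain \<delta> where \<delta>: "\<delta> > 0" "\<And>y. norm (y - u) < \<delta> \<Longrightarrow> norm (G y - G u - G' (y - u)) \<le> e / (2 * (norm h + 1)) * norm (y - u)"
      using alt by blast
    have "norm ((G (u + t *\<^sub>R h) - G u) /\<^sub>R t - G' h) < e" if t: "0 < t" "t < \<delta> / (norm h + 1)" for t
    proof -
      have "t * (norm h + 1) < \<delta>" using t by (simp add: pos_less_divide_eq add_nonneg_pos)
      then have "norm ((u + t *\<^sub>R h) - u) < \<delta>" using t by (simp add: algebra_simps)
      then have "norm (G (u + t *\<^sub>R h) - G u - G' ((u + t *\<^sub>R h) - u)) \<le> e / (2 * (norm h + 1)) * norm ((u + t *\<^sub>R h) - u)"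
        by (rule \<delta>(2))
      then have 1: "norm (G (u + t *\<^sub>R h) - G u - t *\<^sub>R G' h) \<le> e / (2 * (norm h + 1)) * (t * norm h)"
        using t by (simp add: linear_cmul[OF lin])
      have "(G (u + t *\<^sub>R h) - G u) /\<^sub>R t - G' h = (G (u + t *\<^sub>R h) - G u - t *\<^sub>R G' h) /\<^sub>R t"
        using t by (simp add: scaleR_diff_right)
      then have "norm ((G (u + t *\<^sub>R h) - G u) /\<^sub>R t - G' h) = norm (G (u + t *\<^sub>R h) - G u - t *\<^sub>R G' h) / t"
        using t by (simp add: divide_inverse mult.commute)
      also have "\<dots> \<le> e / (2 * (norm h + 1)) * (t * norm h) / t" using 1 t by (intro divide_right_mono) auto
      also have "\<dots> = e / 2 * (norm h / (norm h + 1))" using t by simp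
      also have "\<dots> \<le> e / 2 * 1"
      proof (intro mult_left_mono)
        show "norm h / (norm h + 1) \<le> 1" by (subst divide_le_eq_1_pos) (auto simp: add_nonneg_pos)
      qed (use e in simp)
      also have "\<dots> < e" using e by simp
      finally show ?thesis .
    qed
    moreover have "\<delta> / (norm h + 1) > 0" using \<delta> by (simp add: add_nonneg_pos)
    ultimately show ?thesis by blast
  qed
  \<comment> \<open>The bound on \<open>G\<close> passes to \<open>G'\<close> along difference
    quotients within \<open>span J\<close>.\<close>
  have G'lower: "c * norm h \<le> norm (G' h)" if h: "h \<in> span J" for h
  proof (rule field_le_epsilon)
    fix e :: real assume e: "e > 0"
    obtain \<tau> where \<tau>: "\<tau> > 0" "\<And>t. 0 < t \<Longrightarrow> t \<le> \<tau> \<Longrightarrow> u + t *\<^sub>R h \<in> \<Omega>" using \<Omega>step by blast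
    obtain \<delta> where \<delta>: "\<delta> > 0" "\<And>t. 0 < t \<Longrightarrow> t < \<delta> \<Longrightarrow> norm ((G (u + t *\<^sub>R h) - G u) /\<^sub>R t - G' h) < e"
      using dq[OF e] by blast
    define t where "t = min \<tau> (\<delta> / 2)"
    have t: "0 < t" "t \<le> \<tau>" "t < \<delta>" using \<tau> \<delta> by (auto simp: t_def)
    have "c * norm ((u + t *\<^sub>R h) - u) \<le> norm (G (u + t *\<^sub>R h) - G u)"
      using \<tau>(2)[OF t(1,2)] step[OF h] u by (intro lower) auto
    then have "c * norm h * t \<le> norm (G (u + t *\<^sub>R h) - G u)" using t by (simp add: mult_ac)
    then have "c * norm h \<le> norm (G (u + t *\<^sub>R h) - G u) / t" using t by (simp add: pos_le_divide_eq)
    also have "\<dots> = norm ((G (u + t *\<^sub>R h) - G u) /\<^sub>R t)" using t by (simp add: divide_inverse mult.commute)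
    finally have "c * norm h \<le> norm ((G (u + t *\<^sub>R h) - G u) /\<^sub>R t)" .
    then show "c * norm h \<le> norm (G' h) + e"
      using \<delta>(2)[OF t(1,3)] norm_triangle_sub[of "(G (u + t *\<^sub>R h) - G u) /\<^sub>R t" "G' h"] by linarith
  qed
  have contG: "isCont G u" using G' has_derivative_continuous by blast
  \<comment> \<open>The vector 0 lies in the cone only as a zero multiple of some limit direction,
    so it is obtained here together with a nonzero \<open>h\<close>.\<close>
  have dir: "G' h \<in> tangent_cone S ?x \<and> 0 \<in> tangent_cone S ?x" if h: "h \<in> span J" "h \<noteq> 0" for h
  proof -
    have "0 < c * norm h" using c h by simp
    then have nG: "norm (G' h) > 0" using G'lower[OF h(1)] by linarith
    obtain \<tau> where \<tau>: "\<tau> > 0" "\<And>t. 0 < t \<Longrightarrow> t \<le> \<tau> \<Longrightarrow> u + t *\<^sub>R h \<in> \<Omega>" using \<Omega>step by blast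
    define t where "t n = \<tau> * inverse (real (Suc n))" for n
    have t: "0 < t n" "t n \<le> \<tau>" for n using \<tau> by (auto simp: t_def mult_le_cancel_left1 inverse_le_1_iff)
    have t0: "t \<longlonglongrightarrow> 0"
      using tendsto_mult_right_zero[OF LIMSEQ_inverse_real_of_nat, of \<tau>] unfolding t_def .
    define \<xi> where "\<xi> n = G (u + t n *\<^sub>R h)" for n
    have in\<Omega>: "u + t n *\<^sub>R h \<in> \<Omega> \<inter> span J" for n using \<tau>(2)[OF t] step[OF h(1)] by blast
    have \<xi>S: "\<xi> n \<in> S" for n using in\<Omega>[of n] chart by (auto simp: \<xi>_def)
    have \<xi>x: "\<xi> n \<noteq> ?x" for n
    proof -
      have "0 < c * norm ((u + t n *\<^sub>R h) - u)" using c h t[of n] by simp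
      also have "\<dots> \<le> norm (\<xi> n - ?x)" unfolding \<xi>_def using in\<Omega> u by (intro lower) auto
      finally show ?thesis by auto
    qed
    have "(\<lambda>n. u + t n *\<^sub>R h) \<longlonglongrightarrow> u + 0 *\<^sub>R h" by (intro tendsto_intros t0)
    then have "(\<lambda>n. u + t n *\<^sub>R h) \<longlonglongrightarrow> u" by simp
    then have \<xi>lim: "\<xi> \<longlonglongrightarrow> ?x" unfolding \<xi>_def by (rule isCont_tendsto_compose[OF contG])
    have q: "(\<lambda>n. (\<xi> n - ?x) /\<^sub>R t n) \<longlonglongrightarrow> G' h"
    proof (rule LIMSEQ_I)
      fix e :: real assume "e > 0"
      then obtain \<delta> where \<delta>: "\<delta> > 0" "\<And>t. 0 < t \<Longrightarrow> t < \<delta> \<Longrightarrow> norm ((G (u + t *\<^sub>R h) - G u) /\<^sub>R t - G' h) < e"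
        using dq by blast
      obtain N where N: "\<And>n. n \<ge> N \<Longrightarrow> norm (t n - 0) < \<delta>" using LIMSEQ_D[OF t0 \<delta>(1)] by blast
      have "norm ((\<xi> n - ?x) /\<^sub>R t n - G' h) < e" if "n \<ge> N" for n
        unfolding \<xi>_def using N[OF that] t(1)[of n] by (intro \<delta>(2)) auto
      then show "\<exists>N. \<forall>n\<ge>N. norm ((\<xi> n - ?x) /\<^sub>R t n - G' h) < e" by blast
    qed
    have "(\<lambda>n. ((\<xi> n - ?x) /\<^sub>R t n) /\<^sub>R norm ((\<xi> n - ?x) /\<^sub>R t n)) \<longlonglongrightarrow> G' h /\<^sub>R norm (G' h)"
      using nG by (intro tendsto_intros q) auto
    moreover have "((\<xi> n - ?x) /\<^sub>R t n) /\<^sub>R norm ((\<xi> n - ?x) /\<^sub>R t n) = (\<xi> n - ?x) /\<^sub>R norm (\<xi> n - ?x)" for n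
      using t(1)[of n] by simp
    ultimately have v: "(\<lambda>n. (\<xi> n - ?x) /\<^sub>R norm (\<xi> n - ?x)) \<longlonglongrightarrow> G' h /\<^sub>R norm (G' h)" by (simp only:)
    have mem: "s *\<^sub>R (G' h /\<^sub>R norm (G' h)) \<in> tangent_cone S ?x" if "s \<ge> 0" for s
      unfolding tangent_cone_def using that v \<xi>S \<xi>x \<xi>lim by blast
    show ?thesis using mem[of "norm (G' h)"] mem[of 0] nG by simp
  qed
  have sup: "G' ` span J \<subseteq> tangent_cone S ?x"
  proof
    fix y assume "y \<in> G' ` span J"
    then obtain h where h: "h \<in> span J" "y = G' h" by blast
    show "y \<in> tangent_cone S ?x"
    proof (cases "h = 0")
      case True
      obtain b where "b \<in> J" using J(2) by blast
      then have "b \<in> span J" "b \<noteq> 0" using J(1) by (auto simp: span_base nonzero_Basis)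
      then show ?thesis using dir[of b] h True linear_0[OF lin] by simp
    next
      case False
      then show ?thesis using dir h by blast
    qed
  qed
  have subG: "subspace (G' ` span J)" using lin by (simp add: linear_subspace_image)
  have sub: "tangent_cone S ?x \<subseteq> G' ` span J"
  proof
    fix y assume "y \<in> tangent_cone S ?x"
    then obtain s v \<xi> where y: "y = s *\<^sub>R v" and \<xi>: "\<And>i. \<xi> i \<in> S" "\<And>i. \<xi> i \<noteq> ?x" "\<xi> \<longlonglongrightarrow> ?x"
      "(\<lambda>i::nat. (\<xi> i - ?x) /\<^sub>R norm (\<xi> i - ?x)) \<longlonglongrightarrow> v"
      unfolding tangent_cone_def by blast
    \<comment> \<open>The approximants are images of \<open>w - u\<close> divided by the length of
      the increment in the target; as \<open>G'\<close> preserves \<open>span J\<close> as a linear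
      image, closedness of that subspace finishes the step.\<close>
    have "v \<in> closure (G' ` span J)"
      unfolding closure_approachable
    proof (intro allI impI)
      fix e :: real assume e: "e > 0"
      have "e * c / 2 > 0" using e c by simp
      then obtain \<delta> where \<delta>: "\<delta> > 0" "\<And>y. norm (y - u) < \<delta> \<Longrightarrow> norm (G y - G u - G' (y - u)) \<le> e * c / 2 * norm (y - u)"
        using alt by blast
      obtain N1 where N1: "\<And>n. n \<ge> N1 \<Longrightarrow> \<xi> n \<in> U"
        using topological_tendstoD[OF \<xi>(3) U xU(1)] unfolding eventually_sequentially by blast
      have "c * \<delta> > 0" using c \<delta> by simp
      then obtain N2 where N2: "\<And>n. n \<ge> N2 \<Longrightarrow> norm (\<xi> n - ?x) < c * \<delta>" using LIMSEQ_D[OF \<xi>(3)] by blast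
      have "e / 2 > 0" using e by simp
      then obtain N3 where N3: "\<And>n. n \<ge> N3 \<Longrightarrow> norm ((\<xi> n - ?x) /\<^sub>R norm (\<xi> n - ?x) - v) < e / 2"
        using LIMSEQ_D[OF \<xi>(4)] by blast
      define n where "n = max N1 (max N2 N3)"
      have n: "n \<ge> N1" "n \<ge> N2" "n \<ge> N3" by (auto simp: n_def)
      have "\<xi> n \<in> S \<inter> U" using N1[OF n(1)] \<xi>(1) by blast
      then obtain w where w: "w \<in> \<Omega>" "w \<in> span J" "\<xi> n = G w" unfolding chart by blast
      let ?r = "norm (\<xi> n - ?x)"
      have r: "?r > 0" using \<xi>(2)[of n] by simp
      have cw: "c * norm (w - u) \<le> ?r" unfolding w(3) using w u by (intro lower) auto
      then have "c * norm (w - u) < c * \<delta>" using N2[OF n(2)] by linarith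
      then have "norm (w - u) < \<delta>" using c by simp
      then have 1: "norm (G w - G u - G' (w - u)) \<le> e * c / 2 * norm (w - u)" by (rule \<delta>(2))
      also have "\<dots> = e / 2 * (c * norm (w - u))" by simp
      also have "\<dots> \<le> e / 2 * ?r" using cw e by (intro mult_left_mono) auto
      finally have 2: "norm (\<xi> n - ?x - G' (w - u)) \<le> e / 2 * ?r" unfolding w(3) .
      let ?z = "G' ((w - u) /\<^sub>R ?r)"
      have "?z = G' (w - u) /\<^sub>R ?r" by (rule linear_cmul[OF lin])
      then have "(\<xi> n - ?x) /\<^sub>R ?r - ?z = (\<xi> n - ?x - G' (w - u)) /\<^sub>R ?r"
        by (simp only: scaleR_diff_right[symmetric])
      then have "norm ((\<xi> n - ?x) /\<^sub>R ?r - ?z) = norm (\<xi> n - ?x - G' (w - u)) / ?r"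
        using r by (simp add: divide_inverse mult.commute)
      also have "\<dots> \<le> e / 2" using 2 r by (simp add: pos_divide_le_eq)
      finally have 3: "norm ((\<xi> n - ?x) /\<^sub>R ?r - ?z) \<le> e / 2" .
      have "norm (?z - v) < e"
        using norm_triangle_ineq[of "?z - (\<xi> n - ?x) /\<^sub>R ?r" "(\<xi> n - ?x) /\<^sub>R ?r - v"] 3 N3[OF n(3)]
          norm_minus_commute[of ?z "(\<xi> n - ?x) /\<^sub>R ?r"] by simp
      moreover have "?z \<in> G' ` span J" using w u by (intro imageI span_scale span_diff)
      ultimately show "\<exists>y\<in>G' ` span J. dist y v < e" by (auto simp: dist_norm)
    qed
    then have "v \<in> G' ` span J" using closed_subspace[OF subG] by simp
    then show "y \<in> G' ` span J" unfolding y using subG by (simp add: subspace_scale)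
  qed
  show eq: "tangent_cone S (G u) = G' ` span J" using sub sup by blast
  show "subspace (tangent_cone S (G u))" unfolding eq by (rule subG)
  have "inj_on G' (span J)"
  proof (rule inj_onI)
    fix a b assume ab: "a \<in> span J" "b \<in> span J" "G' a = G' b"
    have "c * norm (a - b) \<le> norm (G' (a - b))" using ab by (intro G'lower span_diff)
    then have "c * norm (a - b) \<le> 0" using ab(3) by (simp add: linear_diff[OF lin])
    then show "a = b" using c by (simp add: mult_le_0_iff)
  qed
  then have "dim (G' ` span J) = dim (span J)" by (intro dim_image_eq[OF lin]) (simp add: span_span)
  also have "\<dots> = card J"
    using independent_mono[OF independent_Basis J(1)] by (simp add: dim_eq_card_independent)
  finally show "dim (tangent_cone S (G u)) = card J" unfolding eq .
qed

section \<open>Lipschitz graphs\<close>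

text \<open>Addition is injective on \<open>W \<times> W'\<close>, and an injective linear map on a
  finite-dimensional space is bounded below.\<close>

lemma complementary_lower_bound:
  fixes W W' :: "'a::euclidean_space set"
  assumes "subspace W" "subspace W'" "W \<inter> W' = {0}"
  obtains c where "c > 0" "\<And>w w'. w \<in> W \<Longrightarrow> w' \<in> W' \<Longrightarrow> c * norm w \<le> norm (w + w')"
proof -
  have sub: "subspace (W \<times> W')" using assms by (intro subspace_Times)
  have lin: "linear (\<lambda>(x::'a, y). x + y)"
    by (rule linearI) (auto simp: algebra_simps)
  have "\<forall>z\<in>W \<times> W'. (case z of (x, y) \<Rightarrow> x + y) = 0 \<longrightarrow> z = 0"
  proof (intro ballI impI)
    fix z assume z: "z \<in> W \<times> W'" "(case z of (x, y) \<Rightarrow> x + y) = 0"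
    then obtain x y where xy: "z = (x, y)" "x \<in> W" "y \<in> W'" "x + y = 0" by auto
    then have "x = - y" by (simp add: eq_neg_iff_add_eq_0)
    then have "x \<in> W'" using xy assms(2) by (simp add: subspace_neg)
    then have "x = 0" using xy assms(3) by blast
    then show "z = 0" using xy by (simp add: zero_prod_def)
  qed
  then obtain c where c: "c > 0" "\<And>z. z \<in> W \<times> W' \<Longrightarrow> c * norm z \<le> norm (case z of (x, y) \<Rightarrow> x + y)"
    using injective_imp_isometric[OF closed_subspace[OF sub] sub linear_conv_bounded_linear[THEN iffD1, OF lin]] by blast
  show ?thesis
  proof (rule that[OF c(1)])
    fix w w' assume w: "w \<in> W" "w' \<in> W'"
    have "norm w \<le> norm (w, w')" by (simp add: norm_Pair real_le_rsqrt)
    then have "c * norm w \<le> c * norm (w, w')" using c(1) by (intro mult_left_mono) auto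
    also have "\<dots> \<le> norm (w + w')" using c(2)[of "(w, w')"] w by simp
    finally show "c * norm w \<le> norm (w + w')" .
  qed
qed

text \<open>\<open>W\<close> is replaced isometrically by a coordinate subspace
  \<open>span J\<close>, and the graph map is composed with the projection onto it. Thus
  \<open>G\<close> is Lipschitz on an open subset of the whole space, as Rademacher's theorem
  requires, and constant along the fibres of the projection.\<close>

lemma graph_chart:
  fixes W W' :: "'a::euclidean_space set"
  assumes W: "subspace W" "dim W = p" and W': "subspace W'" "W \<inter> W' = {0}"
    and A: "openin (top_of_set W) A" and f: "f ` A \<subseteq> W'" and lip: "L-lipschitz_on A f"
    and SU: "S \<inter> U = (\<lambda>w. w + f w) ` A"
  obtains J \<Omega> :: "'a set" and G :: "'a \<Rightarrow> 'a" and K c :: real where "J \<subseteq> Basis" "card J = p" "open \<Omega>" "K-lipschitz_on \<Omega> G"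
    "S \<inter> U = G ` (\<Omega> \<inter> span J)" "0 < c"
    "\<And>v w. v \<in> \<Omega> \<inter> span J \<Longrightarrow> w \<in> \<Omega> \<inter> span J \<Longrightarrow> c * norm (v - w) \<le> norm (G v - G w)"
    "\<And>u v. proj_on J u = proj_on J v \<Longrightarrow> G u = G v"
    "\<And>u v. proj_on J u = proj_on J v \<Longrightarrow> u \<in> \<Omega> \<Longrightarrow> v \<in> \<Omega>"
proof -
  have "p \<le> card (Basis :: 'a set)" using W(2) dim_subset_UNIV[of W] by simp
  then obtain J where J: "J \<subseteq> (Basis :: 'a set)" "card J = p"
    using obtain_subset_with_card_n by metis
  note proj = proj_on_facts[OF J(1)]
  have dimJ: "dim (span J) = dim W"
    using independent_mono[OF independent_Basis J(1)] J(2) W(2) by (simp add: dim_eq_card_independent)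
  obtain Q where Q: "linear Q" "Q ` span J = W" "\<And>x. x \<in> span J \<Longrightarrow> norm (Q x) = norm x"
    using isometry_subspaces[OF subspace_span W(1) dimJ] by metis
  define q where "q u = Q (proj_on J u)" for u
  have linq: "linear q"
    using linear_compose[OF proj(1) Q(1)] by (simp add: q_def[abs_def] o_def)
  have qW: "q u \<in> W" for u unfolding q_def using Q(2) proj(2) by blast
  have nq: "norm (q u) \<le> norm u" for u unfolding q_def using Q(3)[OF proj(2)] proj(3) by simp
  have nqJ: "norm (q u) = norm u" if "u \<in> span J" for u unfolding q_def proj(4)[OF that] by (rule Q(3)[OF that])
  have qdiff: "q u - q v = q (u - v)" for u v using linear_diff[OF linq] by simp
  define \<Omega> where "\<Omega> = {u. q u \<in> A}"
  define G where "G u = q u + f (q u)" for u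
  obtain T where T: "open T" "A = W \<inter> T" using A by (auto simp: openin_open)
  have "\<Omega> = q -` T" unfolding \<Omega>_def T(2) using qW by auto
  moreover have "continuous_on UNIV q" using linq by (simp add: linear_continuous_on linear_conv_bounded_linear)
  ultimately have \<Omega>: "open \<Omega>" using open_vimage[OF T(1)] by simp
  have Glip: "(1 + L)-lipschitz_on \<Omega> G"
  proof (rule lipschitz_onI)
    fix u v assume uv: "u \<in> \<Omega>" "v \<in> \<Omega>"
    have L0: "L \<ge> 0" using lip lipschitz_on_nonneg by blast
    have 1: "dist (q u) (q v) \<le> dist u v" using nq[of "u - v"] by (simp add: dist_norm qdiff)
    have "dist (f (q u)) (f (q v)) \<le> L * dist (q u) (q v)" using lipschitz_onD[OF lip] uv by (simp add: \<Omega>_def)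
    also have "\<dots> \<le> L * dist u v" using 1 L0 by (intro mult_left_mono)
    finally have 2: "dist (f (q u)) (f (q v)) \<le> L * dist u v" .
    have "dist (G u) (G v) \<le> dist (q u) (q v) + dist (f (q u)) (f (q v))"
      unfolding G_def by (rule dist_triangle_add)
    then show "dist (G u) (G v) \<le> (1 + L) * dist u v" using 1 2 by (simp add: distrib_right)
  next
    show "0 \<le> 1 + L" using lip lipschitz_on_nonneg by fastforce
  qed
  have img: "S \<inter> U = G ` (\<Omega> \<inter> span J)"
  proof -
    have "A = q ` (\<Omega> \<inter> span J)"
    proof
      show "A \<subseteq> q ` (\<Omega> \<inter> span J)"
      proof
        fix w assume w: "w \<in> A"
        then have "w \<in> Q ` span J" using T(2) Q(2) by blast
        then obtain u where u: "u \<in> span J" "w = Q u" by blast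
        then have "q u = w" using proj(4) by (simp add: q_def)
        then have "u \<in> \<Omega> \<inter> span J" using u(1) w by (simp add: \<Omega>_def)
        then show "w \<in> q ` (\<Omega> \<inter> span J)" using \<open>q u = w\<close> by blast
      qed
    qed (auto simp: \<Omega>_def)
    then show ?thesis unfolding SU by (auto simp: G_def image_image)
  qed
  obtain c where c: "c > 0" "\<And>w w'. w \<in> W \<Longrightarrow> w' \<in> W' \<Longrightarrow> c * norm w \<le> norm (w + w')"
    using complementary_lower_bound[OF W(1) W'] by blast
  have lower: "c * norm (v - w) \<le> norm (G v - G w)" if vw: "v \<in> \<Omega> \<inter> span J" "w \<in> \<Omega> \<inter> span J" for v w
  proof -
    have "f (q v) \<in> W'" "f (q w) \<in> W'" using vw f by (auto simp: \<Omega>_def)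
    then have "f (q v) - f (q w) \<in> W'" using W'(1) by (simp add: subspace_diff)
    then have "c * norm (q (v - w)) \<le> norm (q (v - w) + (f (q v) - f (q w)))" by (intro c(2) qW)
    also have "q (v - w) + (f (q v) - f (q w)) = G v - G w" by (simp add: G_def qdiff[symmetric])
    also have "norm (q (v - w)) = norm (v - w)" using vw by (intro nqJ span_diff) auto
    finally show ?thesis .
  qed
  show ?thesis
  proof (rule that)
    show "J \<subseteq> Basis" "card J = p" "open \<Omega>" "(1 + L)-lipschitz_on \<Omega> G"
      "S \<inter> U = G ` (\<Omega> \<inter> span J)" "0 < c"
      by (fact J \<Omega> Glip img c(1))+
    show "c * norm (v - w) \<le> norm (G v - G w)" if "v \<in> \<Omega> \<inter> span J" "w \<in> \<Omega> \<inter> span J" for v w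
      using that by (rule lower)
    show "G u = G v" if "proj_on J u = proj_on J v" for u v using that by (simp add: G_def q_def)
    show "v \<in> \<Omega>" if "proj_on J u = proj_on J v" "u \<in> \<Omega>" for u v using that by (simp add: \<Omega>_def q_def)
  qed
qed

lemma cylinder_bounded:
  assumes J: "J \<subseteq> (Basis :: 'a::euclidean_space set)" and y: "y \<in> cylinder J w \<rho>"
  shows "norm y \<le> norm w + \<rho> + real DIM('a)"
proof -
  have "norm (y - proj_on J y) \<le> (\<Sum>b\<in>Basis. \<bar>(y - proj_on J y) \<bullet> b\<bar>)" by (rule norm_le_l1)
  also have "\<dots> \<le> (\<Sum>b\<in>(Basis :: 'a set). 1)"
    using y by (intro sum_mono) (auto simp: inner_diff_left proj_on_inner[OF J] cylinder_def)
  finally have 1: "norm (y - proj_on J y) \<le> real DIM('a)" by simp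
  have 2: "norm (proj_on J y - w) \<le> \<rho>" using y by (simp add: cylinder_def)
  have "y = w + (proj_on J y - w) + (y - proj_on J y)" by simp
  then have "norm y \<le> norm w + norm (proj_on J y - w) + norm (y - proj_on J y)"
    by (metis norm_triangle_mono norm_triangle_ineq order_refl)
  then show ?thesis using 1 2 by linarith
qed

text \<open>Tube lemma: the fibre over \<open>u\<close>, cut off by the unit cube, is compact, and a
  point of a thin cylinder reaches it by a short shift along \<open>span J\<close>.\<close>

lemma cylinder_in_open:
  assumes J: "J \<subseteq> (Basis :: 'a::euclidean_space set)" and u: "u \<in> span J"
    and T: "open T" "cylinder J u 0 \<subseteq> T"
  shows "\<exists>\<rho>>0. cylinder J u \<rho> \<subseteq> T"
proof -
  note proj = proj_on_facts[OF J]
  have contp: "continuous_on UNIV (proj_on J)"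
    using proj(1) by (simp add: linear_continuous_on linear_conv_bounded_linear)
  have "cylinder J u 0 = {y. norm (proj_on J y - u) \<le> 0} \<inter> (\<Inter>b\<in>Basis - J. {y. 0 \<le> y \<bullet> b} \<inter> {y. y \<bullet> b \<le> 1})"
    by (auto simp: cylinder_def)
  moreover have "closed \<dots>"
    by (intro closed_Int closed_INT ballI closed_Collect_le continuous_intros contp)
  ultimately have "closed (cylinder J u 0)" by simp
  moreover have "bounded (cylinder J u 0)"
    using cylinder_bounded[OF J] by (auto simp: bounded_iff)
  ultimately have "compact (cylinder J u 0)" by (simp add: compact_eq_bounded_closed)
  then obtain e where e: "e > 0" "(\<Union>x\<in>cylinder J u 0. ball x e) \<subseteq> T"
    using compact_subset_open_imp_ball_epsilon_subset T by metis
  have "cylinder J u (e / 2) \<subseteq> T"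
  proof
    fix y assume y: "y \<in> cylinder J u (e / 2)"
    define z where "z = y + (u - proj_on J y)"
    have "proj_on J z = u"
      unfolding z_def linear_add[OF proj(1)] linear_diff[OF proj(1)] proj(4)[OF u] proj(4)[OF proj(2)] by simp
    moreover have "z \<bullet> b = y \<bullet> b" if b: "b \<in> Basis - J" for b
    proof -
      have "(u - proj_on J y) \<bullet> b = proj_on J (u - proj_on J y) \<bullet> b"
        using proj(4)[OF span_diff[OF u proj(2)]] by simp
      also have "\<dots> = 0" using b by (simp add: proj_on_inner[OF J])
      finally show ?thesis by (simp add: z_def inner_add_left)
    qed
    ultimately have "z \<in> cylinder J u 0" using y by (simp add: cylinder_def)
    moreover have "dist z y < e"
      using y e(1) by (simp add: z_def dist_norm cylinder_def norm_minus_commute)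
    then have "y \<in> ball z e" by simp
    ultimately show "y \<in> T" using e(2) by blast
  qed
  then show ?thesis using e(1) by (intro exI[of _ "e / 2"]) auto
qed

context homogeneous_group
begin

lemma premeasure_null_in_chart:
  assumes p: "1 \<le> p" "p \<le> DIM('a)" and \<delta>: "\<delta> > 0"
    and J: "J \<subseteq> (Basis :: 'a set)" "card J = p" and \<Omega>: "open \<Omega>" and lip: "K-lipschitz_on \<Omega> G"
    and U: "open U" and SU: "S \<inter> U = G ` (\<Omega> \<inter> span J)" and c: "0 < c"
    and lower: "\<And>v w. v \<in> \<Omega> \<inter> span J \<Longrightarrow> w \<in> \<Omega> \<inter> span J \<Longrightarrow> c * norm (v - w) \<le> norm (G v - G w)"
    and projG: "\<And>u v. proj_on J u = proj_on J v \<Longrightarrow> G u = G v"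
    and proj\<Omega>: "\<And>u v. proj_on J u = proj_on J v \<Longrightarrow> u \<in> \<Omega> \<Longrightarrow> v \<in> \<Omega>"
  shows "hausdorff_premeasure d (max_degree V p) \<delta> (low_degree_set mul V X p S \<inter> U) = 0"
    "hausdorff_premeasure d (max_degree V p) \<delta> (singular_set p S \<inter> U) = 0"
proof -
  let ?H = "hausdorff_premeasure d (max_degree V p) \<delta>"
  note proj = proj_on_facts[OF J(1)]
  \<comment> \<open>Adding 1 makes the constant positive, since radii are divided by it.\<close>
  define K1 where "K1 = K + 1"
  have K1: "K1 > 0" using lip lipschitz_on_nonneg[OF lip] by (simp add: K1_def)
  have small: "\<exists>s>0. s < \<sigma> \<and> ?H (G ` (P \<inter> cball u s)) \<le> ennreal (C * K1 ^ p * s ^ card J)"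
    if P: "P \<subseteq> \<Omega> \<inter> span J" and u: "u \<in> P" and \<sigma>: "0 < \<sigma>"
      and C: "\<exists>s>0. s < \<sigma> * K1 \<and> ?H (S \<inter> cball (G u) s) \<le> ennreal (C * s ^ p)" for P u \<sigma> C
  proof -
    obtain s where s: "s > 0" "s < \<sigma> * K1" "?H (S \<inter> cball (G u) s) \<le> ennreal (C * s ^ p)" using C by blast
    have "G ` (P \<inter> cball u (s / K1)) \<subseteq> S \<inter> cball (G u) s"
    proof
      fix y assume "y \<in> G ` (P \<inter> cball u (s / K1))"
      then obtain v where v: "v \<in> P" "dist u v \<le> s / K1" "y = G v" by auto
      have "dist (G u) (G v) \<le> K * dist u v" using P u v by (intro lipschitz_onD[OF lip]) auto
      also have "\<dots> \<le> K1 * dist u v" by (intro mult_right_mono) (auto simp: K1_def)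
      also have "\<dots> \<le> K1 * (s / K1)" using v K1 by (intro mult_left_mono) auto
      also have "\<dots> = s" using K1 by simp
      finally show "y \<in> S \<inter> cball (G u) s" using v P SU by auto
    qed
    then have "?H (G ` (P \<inter> cball u (s / K1))) \<le> ennreal (C * s ^ p)"
      using s(3) hausdorff_premeasure_mono order_trans by metis
    also have "C * s ^ p = C * K1 ^ p * (s / K1) ^ card J" using K1 J(2) by (simp add: power_divide)
    finally show ?thesis using s K1 by (intro exI[of _ "s / K1"]) (auto simp: pos_divide_less_eq)
  qed
  show "?H (low_degree_set mul V X p S \<inter> U) = 0"
  proof -
    \<comment> \<open>Bounded pieces, so that the cylinders over them stay in a ball of finite
      volume.\<close>
    define P where "P k = {u\<in>\<Omega> \<inter> span J. norm u \<le> real k \<and> G u \<in> low_degree_set mul V X p S}" for k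
    have "?H (G ` P k) = 0" for k
    proof (rule ennreal_eq_0_of_le_mult)
      \<comment> \<open>The radius adds \<open>norm w \<le> real k\<close>, the cylinder radius 1,
        and at most \<open>DIM('a)\<close> from the transversal coordinates.\<close>
      let ?O = "cball (0 :: 'a) (real k + 1 + real DIM('a))"
      let ?C = "K1 ^ p * (5 * real DIM('a)) ^ card J * measure lebesgue ?O"
      show "0 \<le> ?C" using K1 by simp
      fix \<eta> :: real assume \<eta>: "\<eta> > 0"
      have "?H (G ` P k) \<le> ennreal (\<eta> * K1 ^ p * (5 * real DIM('a)) ^ card J * measure lebesgue ?O)"
      proof (rule premeasure_image_le[OF J(1) lmeasurable_cball])
        show "P k \<subseteq> span J" by (auto simp: P_def)
        show "0 \<le> \<eta> * K1 ^ p" using \<eta> K1 by simp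
        show "\<exists>\<rho>>0. cylinder J w \<rho> \<subseteq> ?O" if "w \<in> P k" for w
        proof (intro exI[of _ 1] conjI subsetI)
          fix y assume "y \<in> cylinder J w 1"
          then have "norm y \<le> norm w + 1 + real DIM('a)" by (rule cylinder_bounded[OF J(1)])
          then show "y \<in> ?O" using that by (simp add: P_def)
        qed simp
        show "\<exists>s>0. s < \<sigma> \<and> ?H (G ` (P k \<inter> cball w s)) \<le> ennreal (\<eta> * K1 ^ p * s ^ card J)"
          if w: "w \<in> P k" and \<sigma>: "0 < \<sigma>" for w \<sigma>
        proof (rule small[OF _ w \<sigma>])
          show "P k \<subseteq> \<Omega> \<inter> span J" by (auto simp: P_def)
          show "\<exists>s>0. s < \<sigma> * K1 \<and> ?H (S \<inter> cball (G w) s) \<le> ennreal (\<eta> * s ^ p)"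
            using w \<sigma> K1 by (intro premeasure_small_at_low_degree[OF p _ \<eta> \<delta>]) (auto simp: P_def)
        qed
      qed
      then show "?H (G ` P k) \<le> ennreal (\<eta> * ?C)" by (simp add: mult.assoc)
    qed
    then have "?H (\<Union>k. G ` P k) = 0" by (rule hausdorff_premeasure_null_UN)
    moreover have "low_degree_set mul V X p S \<inter> U \<subseteq> (\<Union>k. G ` P k)"
    proof
      fix x assume x: "x \<in> low_degree_set mul V X p S \<inter> U"
      then have "x \<in> S \<inter> U" by (auto simp: low_degree_set_def)
      then obtain u where u: "u \<in> \<Omega> \<inter> span J" "x = G u" unfolding SU by blast
      obtain k where "norm u \<le> real k" using real_arch_simple by blast
      then have "u \<in> P k" using u x by (auto simp: P_def)
      then show "x \<in> (\<Union>k. G ` P k)" using u by blast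
    qed
    ultimately show ?thesis using hausdorff_premeasure_mono by (metis le_zero_eq)
  qed
  show "?H (singular_set p S \<inter> U) = 0"
  proof -
    define N where "N = {u\<in>\<Omega>. \<not> G differentiable (at u)}"
    have "negligible N" unfolding N_def by (rule rademacher[OF \<Omega> lip])
    then have N: "N \<in> lmeasurable" "measure lebesgue N = 0"
      using negligible_imp_measurable negligible_imp_measure0 by blast+
    have "\<forall>x. \<exists>C. \<forall>\<delta>>0. \<forall>\<sigma>>0. \<exists>s>0. s < \<sigma> \<and>
      hausdorff_premeasure d (max_degree V p) \<delta> (cball x s) \<le> ennreal (C * s ^ p)"
      using premeasure_bounded_at[OF p] by blast
    from choice[OF this] obtain C where C: "\<And>x \<delta> \<sigma>. \<delta> > 0 \<Longrightarrow> \<sigma> > 0 \<Longrightarrow> \<exists>s>0. s < \<sigma> \<and>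
      hausdorff_premeasure d (max_degree V p) \<delta> (cball x s) \<le> ennreal (C x * s ^ p)" by blast
    \<comment> \<open>The constant varies with the point without control; its sublevel sets reduce
      the claim to countably many uniform cases.\<close>
    define P where "P k = {u\<in>N \<inter> span J. C (G u) \<le> real k}" for k
    \<comment> \<open>\<open>G\<close> and \<open>\<Omega>\<close> are invariant along fibres, so
      non-differentiability at one parameter spreads over its fibre. This is how a full-dimensional
      null set says something about parameters in \<open>span J\<close>.\<close>
    have fibre: "cylinder J u 0 \<subseteq> N" if u: "u \<in> N" "u \<in> span J" for u
    proof
      fix y assume "y \<in> cylinder J u 0"
      then have py: "proj_on J y = u" by (simp add: cylinder_def)
      then have pu: "proj_on J u = proj_on J y" using proj(4)[OF u(2)] by simp
      have "y \<in> \<Omega>" using proj\<Omega>[OF pu] u(1) by (simp add: N_def)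
      moreover have "\<not> G differentiable (at y)"
      proof
        assume "G differentiable (at y)"
        then obtain D where D: "(G has_derivative D) (at y)" unfolding differentiable_def by blast
        have "((\<lambda>z. z + (y - u)) has_derivative (\<lambda>h. h)) (at u)" by (auto intro!: derivative_eq_intros)
        then have "((\<lambda>z. G (z + (y - u))) has_derivative D) (at u)"
          using has_derivative_compose[of "\<lambda>z. z + (y - u)" "\<lambda>h. h" u UNIV G D] D by simp
        moreover have "G (z + (y - u)) = G z" for z
          by (rule projG) (simp add: linear_add[OF proj(1)] linear_diff[OF proj(1)] pu)
        ultimately have "(G has_derivative D) (at u)" by simp
        then show False using u(1) by (auto simp: N_def differentiable_def)
      qed
      ultimately show "y \<in> N" by (simp add: N_def)
    qed
    have "?H (G ` P k) = 0" for k
    proof (rule ennreal_eq_0_of_le_mult)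
      let ?C = "real k * K1 ^ p * (5 * real DIM('a)) ^ card J"
      show C0: "0 \<le> ?C" using K1 by simp
      fix \<eta> :: real assume \<eta>: "\<eta> > 0"
      obtain T where T: "open T" "N \<subseteq> T" "T \<in> lmeasurable" "measure lebesgue T < \<eta>"
        using lmeasurable_outer_open[OF N(1) \<eta>] N(2) by auto
      have "?H (G ` P k) \<le> ennreal (real k * K1 ^ p * (5 * real DIM('a)) ^ card J * measure lebesgue T)"
      proof (rule premeasure_image_le[OF J(1) T(3)])
        show "P k \<subseteq> span J" by (auto simp: P_def)
        show "0 \<le> real k * K1 ^ p" using K1 by simp
        show "\<exists>\<rho>>0. cylinder J w \<rho> \<subseteq> T" if "w \<in> P k" for w
          using that fibre[of w] T by (intro cylinder_in_open[OF J(1)]) (auto simp: P_def)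
        show "\<exists>s>0. s < \<sigma> \<and> ?H (G ` (P k \<inter> cball w s)) \<le> ennreal (real k * K1 ^ p * s ^ card J)"
          if w: "w \<in> P k" and \<sigma>: "0 < \<sigma>" for w \<sigma>
        proof (rule small[OF _ w \<sigma>])
          show "P k \<subseteq> \<Omega> \<inter> span J" by (auto simp: P_def N_def)
          have "0 < \<sigma> * K1" using \<sigma> K1 by simp
          then obtain s where s: "s > 0" "s < \<sigma> * K1" "?H (cball (G w) s) \<le> ennreal (C (G w) * s ^ p)"
            using C[OF \<delta>] by blast
          have "?H (S \<inter> cball (G w) s) \<le> ?H (cball (G w) s)" by (rule hausdorff_premeasure_mono) auto
          also have "\<dots> \<le> ennreal (C (G w) * s ^ p)" by (rule s(3))
          also have "\<dots> \<le> ennreal (real k * s ^ p)"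
            using w s by (intro ennreal_leI mult_right_mono) (auto simp: P_def)
          finally show "\<exists>s>0. s < \<sigma> * K1 \<and> ?H (S \<inter> cball (G w) s) \<le> ennreal (real k * s ^ p)"
            using s by blast
        qed
      qed
      also have "\<dots> \<le> ennreal (\<eta> * ?C)"
        using T(4) mult_left_mono[OF less_imp_le[OF T(4)] C0] by (intro ennreal_leI) (simp add: mult.commute)
      finally show "?H (G ` P k) \<le> ennreal (\<eta> * ?C)" .
    qed
    then have "?H (\<Union>k. G ` P k) = 0" by (rule hausdorff_premeasure_null_UN)
    moreover have "singular_set p S \<inter> U \<subseteq> (\<Union>k. G ` P k)"
    proof
      fix x assume x: "x \<in> singular_set p S \<inter> U"
      then have "x \<in> S \<inter> U" by (auto simp: singular_set_def)
      then obtain u where u: "u \<in> \<Omega>" "u \<in> span J" "x = G u" unfolding SU by blast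
      have "\<not> G differentiable (at u)"
      proof
        assume "G differentiable (at u)"
        then obtain G' where G': "(G has_derivative G') (at u)" unfolding differentiable_def by blast
        have "J \<noteq> {}" using J(2) p by auto
        then have "dim (tangent_cone S (G u)) = card J" "subspace (tangent_cone S (G u))"
          using tangent_cone_of_derivative(2,3)[where c=c, OF J(1) _ \<Omega> U SU u(1,2) c _ G'] lower by blast+
        then show False using x J(2) u(3) by (simp add: singular_set_def)
      qed
      then have "u \<in> N" using u by (simp add: N_def)
      moreover obtain k where "C (G u) \<le> real k" using real_arch_simple by blast
      ultimately have "u \<in> P k" using u by (simp add: P_def)
      then show "x \<in> (\<Union>k. G ` P k)" using u by blast
    qed
    ultimately show ?thesis using hausdorff_premeasure_mono by (metis le_zero_eq)
  qed
qed

end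

section \<open>From charts to the whole submanifold\<close>

theorem theorem4p5:
  fixes mul :: "'a::euclidean_space \<Rightarrow> 'a \<Rightarrow> 'a"
    and V :: "nat \<Rightarrow> 'a set"
    and \<iota> :: nat
    and X :: "nat \<Rightarrow> 'a"
    and d :: "'a \<Rightarrow> 'a \<Rightarrow> real"
    and p :: nat
    and \<Sigma> :: "'a set"
  assumes "stratified_group mul V \<iota>"
    and "graded_metric V \<iota>"
    and "graded_basis V \<iota> X"
    and "homogeneous_distance mul V X d"
    and "1 \<le> p" and "p \<le> DIM('a)"
    and "lipschitz_submanifold p \<Sigma>"
  shows "hausdorff_measure d (max_degree V p)
           (singular_set p \<Sigma> \<union> low_degree_set mul V X p \<Sigma>) = 0"
proof -
  interpret homogeneous_group mul V \<iota> X d using assms by unfold_locales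
  let ?E = "singular_set p \<Sigma> \<union> low_degree_set mul V X p \<Sigma>"
  have "hausdorff_premeasure d (max_degree V p) \<delta> ?E = 0" if \<delta>: "\<delta> > 0" for \<delta>
  proof -
    let ?H = "hausdorff_premeasure d (max_degree V p) \<delta>"
    have null2: "?H (A \<union> B) = 0" if "?H A = 0" "?H B = 0" for A B
    proof -
      have "?H (\<Union>n::nat. if n = 0 then A else B) = 0" using that by (intro hausdorff_premeasure_null_UN) auto
      moreover have "A \<union> B \<subseteq> (\<Union>n::nat. if n = 0 then A else B)" by (auto split: if_splits)
      ultimately show ?thesis using hausdorff_premeasure_mono by (metis le_zero_eq)
    qed
    have "\<exists>U. open U \<and> x \<in> U \<and> ?H (?E \<inter> U) = 0" if x: "x \<in> \<Sigma>" for x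
    proof -
      obtain U W W' A f L where U: "open U" "x \<in> U" and W: "subspace W" "dim W = p"
        and W': "subspace W'" "W \<inter> W' = {0}" and A: "openin (top_of_set W) A"
        and f: "f ` A \<subseteq> W'" "L-lipschitz_on A f" "\<Sigma> \<inter> U = (\<lambda>w. w + f w) ` A"
      proof -
        have "\<exists>U W W' A f L. open U \<and> x \<in> U \<and> subspace W \<and> dim W = p \<and> subspace W' \<and>
          dim W' = DIM('a) - p \<and> W \<inter> W' = {0} \<and> openin (top_of_set W) A \<and> f ` A \<subseteq> W' \<and>
          L-lipschitz_on A f \<and> \<Sigma> \<inter> U = (\<lambda>w. w + f w) ` A"
          using assms(7) x unfolding lipschitz_submanifold_def by (rule bspec)
        then show thesis using that by (elim exE conjE)
      qed
      obtain J \<Omega> :: "'a set" and G :: "'a \<Rightarrow> 'a" and K c :: real where chart: "J \<subseteq> Basis" "card J = p" "open \<Omega>" "K-lipschitz_on \<Omega> G"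
        "\<Sigma> \<inter> U = G ` (\<Omega> \<inter> span J)" "0 < c"
        "\<And>v w. v \<in> \<Omega> \<inter> span J \<Longrightarrow> w \<in> \<Omega> \<inter> span J \<Longrightarrow> c * norm (v - w) \<le> norm (G v - G w)"
        "\<And>u v. proj_on J u = proj_on J v \<Longrightarrow> G u = G v"
        "\<And>u v. proj_on J u = proj_on J v \<Longrightarrow> u \<in> \<Omega> \<Longrightarrow> v \<in> \<Omega>"
        by (rule graph_chart[OF W W' A f], rule that)
      have null: "?H (low_degree_set mul V X p \<Sigma> \<inter> U) = 0" "?H (singular_set p \<Sigma> \<inter> U) = 0"
        using premeasure_null_in_chart[where c=c, OF assms(5,6) \<delta> chart(1-4) U(1) chart(5,6)]
          chart(7-9) by blast+
      have "?E \<inter> U = (singular_set p \<Sigma> \<inter> U) \<union> (low_degree_set mul V X p \<Sigma> \<inter> U)" by blast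
      then have "?H (?E \<inter> U) = 0" using null2[OF null(2) null(1)] by simp
      then show ?thesis using U by blast
    qed
    then obtain U where U: "\<And>x. x \<in> \<Sigma> \<Longrightarrow> open (U x)" "\<And>x. x \<in> \<Sigma> \<Longrightarrow> x \<in> U x"
      "\<And>x. x \<in> \<Sigma> \<Longrightarrow> ?H (?E \<inter> U x) = 0" by metis
    \<comment> \<open>The charts are only local; second countability leaves countably many of
      them.\<close>
    obtain F where F: "F \<subseteq> U ` \<Sigma>" "countable F" "\<Union>F = \<Union>(U ` \<Sigma>)"
      using Lindelof[of "U ` \<Sigma>"] U(1) by blast
    have null: "?H (\<Union>T\<in>F. ?E \<inter> T) \<le> ennreal 0"
      using F(1) U(3) by (intro hausdorff_premeasure_UN_countable[OF F(2), where c="\<lambda>_. 0"]) auto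
    have "?E \<subseteq> \<Sigma>" by (auto simp: singular_set_def low_degree_set_def)
    have cover: "?E \<subseteq> (\<Union>T\<in>F. ?E \<inter> T)"
    proof
      fix x assume x: "x \<in> ?E"
      then have "x \<in> \<Sigma>" using \<open>?E \<subseteq> \<Sigma>\<close> by (rule subsetD[rotated])
      then have "U x \<in> U ` \<Sigma>" "x \<in> U x" using U(2) by auto
      then have "x \<in> \<Union>F" unfolding F(3) by (rule UnionI)
      then obtain T where "T \<in> F" "x \<in> T" by (rule UnionE)
      then show "x \<in> (\<Union>T\<in>F. ?E \<inter> T)" by (intro UN_I[of T] IntI x)
    qed
    from hausdorff_premeasure_mono[OF cover] null have "?H ?E \<le> ennreal 0" by (rule order_trans)
    then show ?thesis by simp
  qed
  then show ?thesis unfolding hausdorff_measure_def by (simp add: SUP_eq_const)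
qed

end
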